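(* Let $M$ be a loopless matroid of rank $k$ on a ground set of size $n$. Then, coefficient-wise, $\underline{H}_M(x)\preceq\underline{H}_{U_{k,n}}(x)$ and $H_M(x)\preceq H_{U_{k,n}}(x)$.
   Context: For polynomials $A,B$ with real coefficients, $A\preceq B$ means $B-A$ has nonnegative coefficients. $U_{k,n}$ is the uniform matroid of rank $k$ on $n$ elements (bases: all $k$-subsets). For a loopless matroid $M$ on $E$ with lattice of flats $\mathcal{L}(M)$: $\underline{\mathrm{CH}}(M)=\mathbb{Q}[x_F: F\in\mathcal{L}(M)\setminus\{\varnothing,E\}]/(I+J)$, $I$ generated by $x_{F_1}x_{F_2}$ for incomparable $F_1,F_2$, $J$ by $\sum_{F\ni i}x_F-\sum_{F\ni j}x_F$ for $i,j\in E$; $\mathrm{CH}(M)=\mathbb{Q}[x_F,y_i: F\in\mathcal{L}(M)\setminus\{E\},\, i\in E]/(I'+J')$, $I'$ generated by $y_i-\sum_{F\not\ni i}x_F$, $J'$ by $x_{F_1}x_{F_2}$ for incomparable $F_1,F_2$ and $y_ix_F$ for $i\notin F$. Variables of degree $1$; $\underline{H}_M$ and $H_M$ are the Hilbert series $\sum_j\dim_{\mathbb{Q}}(\cdot)^jx^j$. *)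

theory Defs
  imports Complex_Main "HOL-Library.Multiset" "HOL-Library.Function_Algebras"
begin

definition matroid :: "'a set \<Rightarrow> ('a set \<Rightarrow> bool) \<Rightarrow> bool" where
  "matroid E indep \<longleftrightarrow> finite E \<and> indep {} \<and>
     (\<forall>I. indep I \<longrightarrow> I \<subseteq> E) \<and>
     (\<forall>I J. indep J \<and> I \<subseteq> J \<longrightarrow> indep I) \<and>
     (\<forall>I J. indep I \<and> indep J \<and> card I < card J \<longrightarrow>
        (\<exists>e \<in> J - I. indep (insert e I)))"

definition mrank :: "('a set \<Rightarrow> bool) \<Rightarrow> 'a set \<Rightarrow> nat" where
  "mrank indep X = Max {card I | I. I \<subseteq> X \<and> indep I}"

definition loopless :: "'a set \<Rightarrow> ('a set \<Rightarrow> bool) \<Rightarrow> bool" where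
  "loopless E indep \<longleftrightarrow> (\<forall>e \<in> E. indep {e})"

definition flats :: "'a set \<Rightarrow> ('a set \<Rightarrow> bool) \<Rightarrow> 'a set set" where
  "flats E indep = {F. F \<subseteq> E \<and> (\<forall>e \<in> E - F. mrank indep (insert e F) > mrank indep F)}"

definition unif_ground :: "nat \<Rightarrow> nat set" where
  "unif_ground n = {..<n}"

definition unif_indep :: "nat \<Rightarrow> nat \<Rightarrow> nat set \<Rightarrow> bool" where
  "unif_indep k n I \<longleftrightarrow> I \<subseteq> {..<n} \<and> card I \<le> k"

text \<open>A polynomial in variables of type 'v is its coefficient function on monomials
  (monomials = finite multisets of variables); all polynomials used have finite support.\<close>
type_synonym 'v qpoly = "'v multiset \<Rightarrow> rat"

definition qscale :: "rat \<Rightarrow> 'v qpoly \<Rightarrow> 'v qpoly" where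
  "qscale c p = (\<lambda>m. c * p m)"

definition pvar :: "'v \<Rightarrow> 'v qpoly" where
  "pvar v = (\<lambda>m. if m = {#v#} then 1 else 0)"

definition pmono :: "'v multiset \<Rightarrow> 'v qpoly" where
  "pmono u = (\<lambda>m. if m = u then 1 else 0)"

definition mono_mult :: "'v multiset \<Rightarrow> 'v qpoly \<Rightarrow> 'v qpoly" where
  "mono_mult u p = (\<lambda>m. if u \<subseteq># m then p (m - u) else 0)"

definition gen_ideal :: "'v set \<Rightarrow> 'v qpoly set \<Rightarrow> 'v qpoly set" where
  "gen_ideal V G = module.span qscale {mono_mult u g | u g. set_mset u \<subseteq> V \<and> g \<in> G}"

text \<open>dim_Q of the degree-j part of Q[V]/(G) = #monomials of degree j - dim (ideal \<inter> degree-j part).\<close>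
definition hilb_coeff :: "'v set \<Rightarrow> 'v qpoly set \<Rightarrow> nat \<Rightarrow> nat" where
  "hilb_coeff V G j =
     card {m. set_mset m \<subseteq> V \<and> size m = j}
     - vector_space.dim qscale {p \<in> gen_ideal V G. \<forall>m. p m \<noteq> 0 \<longrightarrow> size m = j}"

definition chow_vars :: "'a set \<Rightarrow> ('a set \<Rightarrow> bool) \<Rightarrow> 'a set set" where
  "chow_vars E indep = flats E indep - {{}, E}"

definition chow_gens :: "'a set \<Rightarrow> ('a set \<Rightarrow> bool) \<Rightarrow> 'a set qpoly set" where
  "chow_gens E indep =
     {pmono {#F1, F2#} | F1 F2. F1 \<in> chow_vars E indep \<and> F2 \<in> chow_vars E indep
        \<and> \<not> F1 \<subseteq> F2 \<and> \<not> F2 \<subseteq> F1}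
   \<union> {(\<Sum>F \<in> {F \<in> chow_vars E indep. i \<in> F}. pvar F)
       - (\<Sum>F \<in> {F \<in> chow_vars E indep. j \<in> F}. pvar F) | i j. i \<in> E \<and> j \<in> E}"

definition red_chow_hilb :: "'a set \<Rightarrow> ('a set \<Rightarrow> bool) \<Rightarrow> nat \<Rightarrow> nat" where
  "red_chow_hilb E indep = hilb_coeff (chow_vars E indep) (chow_gens E indep)"

text \<open>Augmented Chow ring: variables x_F = Inl F (F a flat, F \<noteq> E), y_i = Inr i (i \<in> E).\<close>
definition aug_vars :: "'a set \<Rightarrow> ('a set \<Rightarrow> bool) \<Rightarrow> ('a set + 'a) set" where
  "aug_vars E indep = Inl ` (flats E indep - {E}) \<union> Inr ` E"

definition aug_gens :: "'a set \<Rightarrow> ('a set \<Rightarrow> bool) \<Rightarrow> ('a set + 'a) qpoly set" where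
  "aug_gens E indep =
     {pvar (Inr i) - (\<Sum>F \<in> {F \<in> flats E indep - {E}. i \<notin> F}. pvar (Inl F)) | i. i \<in> E}
   \<union> {pmono {#Inl F1, Inl F2#} | F1 F2. F1 \<in> flats E indep - {E} \<and> F2 \<in> flats E indep - {E}
        \<and> \<not> F1 \<subseteq> F2 \<and> \<not> F2 \<subseteq> F1}
   \<union> {pmono {#Inr i, Inl F#} | i F. i \<in> E \<and> F \<in> flats E indep - {E} \<and> i \<notin> F}"

definition aug_chow_hilb :: "'a set \<Rightarrow> ('a set \<Rightarrow> bool) \<Rightarrow> nat \<Rightarrow> nat" where
  "aug_chow_hilb E indep = hilb_coeff (aug_vars E indep) (aug_gens E indep)"

end

(* Both Hilbert functions are compared through Feichtner-Yuzvinsky monomials x_{F_1}^{d_1} ... x_{F_t}^{d_t},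
   F_1 < ... < F_t, d_i < c(F_i) - c(F_{i-1}), where c is the rank (reduced ring) or the rank plus one
   (augmented ring).

   Upper bound, any M: with x_E := - sum_{F containing i} x_F (augmented: - sum_{F < E} x_F) and
   h_G = - sum_{F >= G} x_F one has x_F h_G^(c(G) - c(F)) = 0, which rewrites any monomial into
   Feichtner-Yuzvinsky ones. Choosing nested bases of the flats in a chain injects those of M into
   those of U_{k,n}.

   Lower bound, U_{k,n}: every rank function r on the Boolean lattice defines a functional on polynomials
   in the h_S by the dragon Hall-Rado rule (Backman-Eur-Simpson): h_{S_1} ... h_{S_d}, d = r(E) - 1, goes to 1
   if r(union of S_i over J) > |J| for all nonempty J, and to 0 otherwise; it kills the relations of the reduced Chow
   ring. A Feichtner-Yuzvinsky monomial m of U_{k,n} determines a nested matroid, and the functional of m' on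
   a test element attached to m is nonzero only if r_{m'} <= r_m pointwise, and 1 if m' = m. So these functionals
   are linearly independent. The augmented case is the reduced one on E + {0}, restricted to the sets containing 0. *)

theory Submission
  imports Defs "HOL-Library.Poly_Mapping"
begin

section \<open>Degree functional of a rank function\<close>

text \<open>For M the Feichtner-Yuzvinsky monomials are shown to span, for U_{k,n} to be
  independent; together this gives the inequality. The obstacle to independence is that a degree j
  below the top has no degree map to pair with. It is replaced by the degree maps of smaller
  matroids: a monomial of degree j yields a nested matroid of rank j + 1, whose degree map lives in
  degree j. The rank of F_i in it is d_1 + ... + d_i, with one more at E. The strict bound d_i <
  c(F_i) - c(F_{i-1}) leaves one unit of slack, so that F_i < E has no coloops and the matroid
  determines the monomial; the bound also makes all sets of size at least k spanning, so that x_F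
  dies unless F is a flat of U_{k,n}. The test element is the product of the x_{F_i} h_{F_i}^(d_i -
  1) with F_i < E, times a power of h_E: each x_{F_i} cuts the degree computation at F_i. Its
  factors h are polynomials in the variables of the Chow ring only as far as the functionals can
  see, so they have to be pulled back to honest forms.\<close>

abbreviation lookup :: "('k \<Rightarrow>\<^sub>0 'c::zero) \<Rightarrow> 'k \<Rightarrow> 'c" where
  "lookup \<equiv> Poly_Mapping.lookup"

abbreviation keys :: "('k \<Rightarrow>\<^sub>0 'c::zero) \<Rightarrow> 'k set" where
  "keys \<equiv> Poly_Mapping.keys"

abbreviation single :: "'k \<Rightarrow> 'c \<Rightarrow> 'k \<Rightarrow>\<^sub>0 'c::zero" where
  "single \<equiv> Poly_Mapping.single"

text \<open>The terms of \<open>G\<close> and \<open>insert e G\<close> cancel. With constant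
  \<open>g\<close> this is Moebius inversion on an interval; with \<open>g\<close> a Hall condition
  that ignores \<open>e\<close> it drives \<open>deg_xvar_restrict\<close>.\<close>

lemma alternating_sum_toggle:
  fixes g :: "'a set \<Rightarrow> 'b::comm_ring_1"
  assumes "finite P" "e \<in> P" "e \<notin> F"
    and inv: "\<And>G. F \<subseteq> G \<Longrightarrow> G \<subseteq> P \<Longrightarrow> e \<notin> G \<Longrightarrow> g (insert e G) = g G"
  shows "(\<Sum>G\<in>{F..P}. (-1) ^ card (G - F) * g G) = 0"
proof -
  define A where "A = {G \<in> {F..P}. e \<notin> G}"
  have fin: "finite {F..P}"
    using assms(1) by (rule finite_subset[rotated, OF finite_Pow_iff[THEN iffD2]]) auto
  have inj: "inj_on (insert e) A"
    unfolding A_def by (auto simp: inj_on_def)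
  have split: "{F..P} = A \<union> insert e ` A"
  proof
    show "{F..P} \<subseteq> A \<union> insert e ` A"
    proof
      fix G assume G: "G \<in> {F..P}"
      show "G \<in> A \<union> insert e ` A"
      proof (cases "e \<in> G")
        case True
        then have "G = insert e (G - {e})" "G - {e} \<in> A" using G assms(3) by (auto simp: A_def)
        then show ?thesis by blast
      qed (use G in \<open>auto simp: A_def\<close>)
    qed
    show "A \<union> insert e ` A \<subseteq> {F..P}" using assms(2) by (auto simp: A_def)
  qed
  have disj: "A \<inter> insert e ` A = {}" by (auto simp: A_def)
  have "(\<Sum>G\<in>insert e ` A. (-1) ^ card (G - F) * g G)
      = (\<Sum>G\<in>A. (-1) ^ card (insert e G - F) * g (insert e G))"
    using inj by (simp add: sum.reindex)
  also have "\<dots> = (\<Sum>G\<in>A. - ((-1) ^ card (G - F) * g G))"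
  proof (rule sum.cong[OF refl])
    fix G assume G: "G \<in> A"
    then have "finite G" using assms(1) finite_subset by (auto simp: A_def)
    moreover have "insert e G - F = insert e (G - F)" using assms(3) by auto
    ultimately have "card (insert e G - F) = Suc (card (G - F))" using G by (simp add: A_def)
    moreover have "g (insert e G) = g G" using G inv by (simp add: A_def)
    ultimately show "(-1) ^ card (insert e G - F) * g (insert e G) = - ((-1) ^ card (G - F) * g G)"
      by simp
  qed
  finally have neg: "(\<Sum>G\<in>insert e ` A. (-1) ^ card (G - F) * g G) = - (\<Sum>G\<in>A. (-1) ^ card (G - F) * g G)"
    by (simp add: sum_negf)
  have "finite A" using fin unfolding A_def by (rule finite_subset[rotated]) auto
  then have "(\<Sum>G\<in>A \<union> insert e ` A. (-1) ^ card (G - F) * g G) = 0"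
    using disj neg by (simp add: sum.union_disjoint)
  then show ?thesis by (simp only: split)
qed

lemma alternating_sum_interval:
  assumes "finite P" "F \<subseteq> P"
  shows "(\<Sum>G\<in>{F..P}. (-1) ^ card (G - F) :: 'b::comm_ring_1) = of_bool (F = P)"
proof (cases "F = P")
  case False
  then obtain e where "e \<in> P" "e \<notin> F" using assms(2) by auto
  from alternating_sum_toggle[OF assms(1) this, of "\<lambda>_. 1"] False show ?thesis by simp
next
  case True
  then have "{F..P} = {P}" by auto
  then show ?thesis using True by simp
qed

section \<open>Linear functionals on polynomials in the \<open>h_S\<close>\<close>

definition lin_ext :: "('k \<Rightarrow> rat) \<Rightarrow> ('k \<Rightarrow>\<^sub>0 rat) \<Rightarrow> rat" where
  "lin_ext \<psi> p = (\<Sum>k\<in>keys p. lookup p k * \<psi> k)"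

lemma lin_ext_superset:
  assumes "finite K" "keys p \<subseteq> K"
  shows "lin_ext \<psi> p = (\<Sum>k\<in>K. lookup p k * \<psi> k)"
  unfolding lin_ext_def using assms
  by (intro sum.mono_neutral_left) (auto simp: in_keys_iff)

lemma lin_ext_add: "lin_ext \<psi> (p + q) = lin_ext \<psi> p + lin_ext \<psi> q"
proof -
  let ?K = "keys p \<union> keys q"
  have "finite ?K" "keys p \<subseteq> ?K" "keys q \<subseteq> ?K" "keys (p + q) \<subseteq> ?K"
    using Poly_Mapping.keys_add[of p q] by auto
  then show ?thesis
    by (simp add: lin_ext_superset[of ?K] lookup_add distrib_right sum.distrib)
qed

lemma lin_ext_uminus: "lin_ext \<psi> (- p) = - lin_ext \<psi> p"
  by (simp add: lin_ext_def sum_negf keys_def)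

lemma lin_ext_zero [simp]: "lin_ext \<psi> 0 = 0"
  by (simp add: lin_ext_def)

lemma lin_ext_sum: "lin_ext \<psi> (sum f A) = (\<Sum>a\<in>A. lin_ext \<psi> (f a))"
  by (induction A rule: infinite_finite_induct) (simp_all add: lin_ext_add)

lemma lin_ext_single [simp]: "lin_ext \<psi> (single k c) = c * \<psi> k"
  by (simp add: lin_ext_def)

lemma poly_mapping_expand: "p = (\<Sum>k\<in>keys p. single k (lookup p k))"
  by (rule poly_mapping_eqI)
     (auto simp: lookup_sum lookup_single when_def in_keys_iff sum.delta)

text \<open>Reduces identities between functionals on products to cofactors that are single
  monomials, for which the degree is a plain Hall condition.\<close>

lemma lin_ext_mult_expand:
  fixes a s :: "('k::comm_monoid_add) \<Rightarrow>\<^sub>0 rat"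
  shows "lin_ext \<psi> (a * s) = (\<Sum>k\<in>keys s. lookup s k * lin_ext \<psi> (a * single k 1))"
proof -
  have scale: "lin_ext \<psi> (a * single k c) = c * lin_ext \<psi> (a * single k 1)" for k c
  proof -
    have exp: "a * single k d = (\<Sum>l\<in>keys a. single (l + k) (lookup a l * d))" for d
      by (subst (1) poly_mapping_expand[of a]) (simp add: sum_distrib_right mult_single)
    show ?thesis unfolding exp by (simp add: lin_ext_sum sum_distrib_left mult_ac)
  qed
  have "a * s = (\<Sum>k\<in>keys s. a * single k (lookup s k))"
    by (subst (1) poly_mapping_expand[of s]) (rule sum_distrib_left)
  then have "lin_ext \<psi> (a * s) = (\<Sum>k\<in>keys s. lin_ext \<psi> (a * single k (lookup s k)))"
    by (simp add: lin_ext_sum)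
  also have "\<dots> = (\<Sum>k\<in>keys s. lookup s k * lin_ext \<psi> (a * single k 1))"
    by (rule sum.cong[OF refl], rule scale)
  finally show ?thesis .
qed

lemma lin_ext_mult_cong:
  fixes a b s :: "('k::comm_monoid_add) \<Rightarrow>\<^sub>0 rat"
  assumes "\<And>k. k \<in> keys s \<Longrightarrow> lin_ext \<psi> (a * single k 1) = lin_ext \<phi> (b * single k 1)"
  shows "lin_ext \<psi> (a * s) = lin_ext \<phi> (b * s)"
  using assms by (simp add: lin_ext_mult_expand[of _ _ s])

definition hvar :: "'a set \<Rightarrow> ('a set multiset \<Rightarrow>\<^sub>0 rat)" where
  "hvar S = single {#S#} 1"

text \<open>Moebius inversion of \<open>h\<^sub>G = - \<Sum>F\<supseteq>G. x\<^sub>F\<close> in the subsets of \<open>P\<close>.\<close>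

definition xvar :: "'a set \<Rightarrow> 'a set \<Rightarrow> ('a set multiset \<Rightarrow>\<^sub>0 rat)" where
  "xvar P F = - (\<Sum>G\<in>{F..P}. (-1) ^ card (G - F) * hvar G)"

lemma lin_ext_neg_one_power:
  fixes p :: "('k::comm_monoid_add) \<Rightarrow>\<^sub>0 rat"
  shows "lin_ext \<psi> ((-1) ^ n * p) = (-1) ^ n * lin_ext \<psi> p"
  by (induction n) (simp_all add: lin_ext_uminus)

lemma lin_ext_xvar:
  "lin_ext \<psi> (xvar P F * s) = - (\<Sum>G\<in>{F..P}. (-1) ^ card (G - F) * lin_ext \<psi> (hvar G * s))"
  by (simp add: xvar_def lin_ext_uminus sum_distrib_right lin_ext_sum mult.assoc lin_ext_neg_one_power)

section \<open>The Hall-Rado condition and its maximal tight sets\<close>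

locale ranked_ground =
  fixes E :: "'a set" and r :: "'a set \<Rightarrow> nat"
  assumes finite_ground: "finite E"
    and r_mono: "A \<subseteq> B \<Longrightarrow> B \<subseteq> E \<Longrightarrow> r A \<le> r B"
    and r_submod: "A \<subseteq> E \<Longrightarrow> B \<subseteq> E \<Longrightarrow> r (A \<union> B) + r (A \<inter> B) \<le> r A + r B"
    and r_single: "i \<in> E \<Longrightarrow> r {i} = 1"
begin

text \<open>Rado's condition with the extra \<open>+ 1\<close> of the dragon marriage theorem.
  \<open>J\<close> is a submultiset, so repeated labels count with multiplicity.\<close>

definition hall :: "'a set multiset \<Rightarrow> bool" where
  "hall H \<longleftrightarrow> set_mset H \<subseteq> Pow E \<and>
     (\<forall>J. J \<subseteq># H \<and> J \<noteq> {#} \<longrightarrow> size J + 1 \<le> r (\<Union> (set_mset J)))"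

text \<open>For \<open>c = 1\<close> and \<open>hall H\<close> this says that adding
  \<open>X\<close> to \<open>H\<close> breaks \<open>hall\<close>. The value \<open>c = 2\<close>
  arises when a second label is added at the same time, which costs one more unit of rank.\<close>

definition tight :: "nat \<Rightarrow> 'a set multiset \<Rightarrow> 'a set \<Rightarrow> bool" where
  "tight c H X \<longleftrightarrow> (\<exists>J. J \<subseteq># H \<and> r (X \<union> \<Union> (set_mset J)) \<le> size J + c)"

text \<open>If \<open>hall H\<close> holds, the blocks partition \<open>E\<close>: singletons are
  tight, and tight sets that meet have a tight union.\<close>

definition block :: "'a set multiset \<Rightarrow> 'a set \<Rightarrow> bool" where
  "block H F \<longleftrightarrow> F \<noteq> {} \<and> F \<subseteq> E \<and> tight 1 H F \<and> (\<forall>X. F \<subset> X \<and> X \<subseteq> E \<longrightarrow> \<not> tight 1 H X)"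

definition deg :: "('a set multiset \<Rightarrow>\<^sub>0 rat) \<Rightarrow> rat" where
  "deg = lin_ext (\<lambda>H. of_bool (Suc (size H) = r E \<and> hall H))"

lemma deg_sum: "deg (sum f A) = (\<Sum>a\<in>A. deg (f a))"
  by (simp add: deg_def lin_ext_sum)

lemma deg_zero [simp]: "deg 0 = 0"
  by (simp add: deg_def)

lemma deg_mult_expand: "deg (a * s) = (\<Sum>H\<in>keys s. lookup s H * deg (a * single H 1))"
  unfolding deg_def by (rule lin_ext_mult_expand)

lemma deg_mult_cong:
  assumes "\<And>H. deg (a * single H 1) = deg (b * single H 1)"
  shows "deg (a * s) = deg (b * s)"
  using assms by (simp add: deg_mult_expand[of _ s])

lemma subset_add_msetE:
  assumes "J \<subseteq># add_mset X H"
  obtains "J \<subseteq># H" | J' where "J = add_mset X J'" "J' \<subseteq># H"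
proof (cases "X \<in># J")
  case True
  then obtain J' where "J = add_mset X J'" by (metis mset_add)
  then show ?thesis using assms that(2) by simp
next
  case False
  then have "J \<subseteq># H" using assms
    by (metis diff_single_trivial subset_eq_diff_conv add_mset_add_single)
  then show ?thesis using that(1) by simp
qed

lemma hallD_subset: "hall H \<Longrightarrow> J \<subseteq># H \<Longrightarrow> \<Union> (set_mset J) \<subseteq> E"
  unfolding hall_def using set_mset_mono by blast

lemma hall_add_mset:
  assumes "X \<subseteq> E"
  shows "hall (add_mset X H) \<longleftrightarrow> hall H \<and> \<not> tight 1 H X"
proof
  assume *: "hall (add_mset X H)"
  have "hall H" unfolding hall_def
    using * by (auto simp: hall_def intro: subset_mset.order_trans[OF _ subset_mset.less_imp_le])
       (meson mset_subset_eq_add_right subset_mset.trans multi_psub_of_add_self subset_mset.less_imp_le)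
  moreover have "\<not> tight 1 H X"
  proof
    assume "tight 1 H X"
    then obtain J where J: "J \<subseteq># H" "r (X \<union> \<Union> (set_mset J)) \<le> size J + 1"
      by (auto simp: tight_def)
    have "size (add_mset X J) + 1 \<le> r (\<Union> (set_mset (add_mset X J)))"
      using * J(1) unfolding hall_def by (metis add_mset_not_empty mset_subset_eq_add_mset_cancel)
    then show False using J by simp
  qed
  ultimately show "hall H \<and> \<not> tight 1 H X" ..
next
  assume *: "hall H \<and> \<not> tight 1 H X"
  show "hall (add_mset X H)"
    unfolding hall_def
  proof (intro conjI allI impI)
    show "set_mset (add_mset X H) \<subseteq> Pow E" using * assms by (auto simp: hall_def)
    fix J assume J: "J \<subseteq># add_mset X H \<and> J \<noteq> {#}"
    then consider "J \<subseteq># H" | J' where "J = add_mset X J'" "J' \<subseteq># H" by (auto elim: subset_add_msetE)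
    then show "size J + 1 \<le> r (\<Union> (set_mset J))"
    proof cases
      case 1 then show ?thesis using * J by (auto simp: hall_def)
    next
      case 2 then show ?thesis using * by (auto simp: tight_def not_le Suc_le_eq)
    qed
  qed
qed

lemma tight_add_mset:
  "tight c (add_mset G H) X \<longleftrightarrow> tight c H X \<or> tight (Suc c) H (X \<union> G)"
proof
  assume "tight c (add_mset G H) X"
  then obtain J where J: "J \<subseteq># add_mset G H" "r (X \<union> \<Union> (set_mset J)) \<le> size J + c"
    by (auto simp: tight_def)
  from J(1) show "tight c H X \<or> tight (Suc c) H (X \<union> G)"
  proof (cases rule: subset_add_msetE)
    case 1 then show ?thesis using J by (auto simp: tight_def)
  next
    case (2 J') then show ?thesis using J by (auto simp: tight_def Un_assoc intro!: exI[of _ J'])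
  qed
next
  assume "tight c H X \<or> tight (Suc c) H (X \<union> G)"
  then show "tight c (add_mset G H) X"
  proof
    assume "tight c H X"
    then obtain J where J: "J \<subseteq># H" "r (X \<union> \<Union> (set_mset J)) \<le> size J + c"
      by (auto simp: tight_def)
    have "J \<subseteq># add_mset G H" using J(1) by (metis add_mset_add_single subset_mset.add_increasing2 zero_le mset_subset_eq_add_left subset_mset.trans)
    then show ?thesis using J by (auto simp: tight_def)
  next
    assume "tight (Suc c) H (X \<union> G)"
    then obtain J where "J \<subseteq># H" "r ((X \<union> G) \<union> \<Union> (set_mset J)) \<le> size J + Suc c"
      by (auto simp: tight_def)
    then show ?thesis by (auto simp: tight_def Un_assoc intro!: exI[of _ "add_mset G J"])
  qed
qed

lemma tight_mono: 
  assumes "tight c H Y" "X \<subseteq> Y" "Y \<subseteq> E" "set_mset H \<subseteq> Pow E"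
  shows "tight c H X"
proof -
  obtain J where J: "J \<subseteq># H" "r (Y \<union> \<Union> (set_mset J)) \<le> size J + c"
    using assms(1) by (auto simp: tight_def)
  have "\<Union> (set_mset J) \<subseteq> E" using J(1) assms(4) set_mset_mono by blast
  then have "r (X \<union> \<Union> (set_mset J)) \<le> r (Y \<union> \<Union> (set_mset J))"
    using assms by (intro r_mono) auto
  then show ?thesis using J unfolding tight_def by (meson le_trans)
qed

text \<open>Submodularity for the two sets joined with their witnesses \<open>J\<close> and
  \<open>K\<close>. If \<open>J\<close> and \<open>K\<close> share labels, \<open>hall\<close>
  bounds the rank of the intersection from below by one more than their number; if they share none,
  a common point of \<open>X\<close> and \<open>Y\<close> supplies that unit. Without a common point
  the unit is lost and only \<open>tight 2\<close> remains.\<close>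

lemma tight_Un_aux:
  assumes "hall H" "tight 1 H X" "tight 1 H Y" "X \<subseteq> E" "Y \<subseteq> E"
  shows "tight 2 H (X \<union> Y)" and "X \<inter> Y \<noteq> {} \<Longrightarrow> tight 1 H (X \<union> Y)"
proof -
  obtain J where J: "J \<subseteq># H" "r (X \<union> \<Union> (set_mset J)) \<le> size J + 1"
    using assms(2) by (auto simp: tight_def)
  obtain K where K: "K \<subseteq># H" "r (Y \<union> \<Union> (set_mset K)) \<le> size K + 1"
    using assms(3) by (auto simp: tight_def)
  let ?U = "X \<union> \<Union> (set_mset J)" and ?V = "Y \<union> \<Union> (set_mset K)"
  have sub: "?U \<subseteq> E" "?V \<subseteq> E"
    using hallD_subset[OF assms(1) J(1)] hallD_subset[OF assms(1) K(1)] assms by auto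
  have JK: "J \<union># K \<subseteq># H" using J(1) K(1) by simp
  have sz: "size (J \<union># K) + size (J \<inter># K) = size J + size K"
    by (metis size_Un_Int)
  have un: "(X \<union> Y) \<union> \<Union> (set_mset (J \<union># K)) = ?U \<union> ?V" by auto
  have le: "r (?U \<union> ?V) + r (?U \<inter> ?V) \<le> size J + size K + 2"
    using r_submod[OF sub] J(2) K(2) by linarith
  have int_ne: "size (J \<inter># K) + 1 \<le> r (?U \<inter> ?V)" if "J \<inter># K \<noteq> {#}"
  proof -
    have "J \<inter># K \<subseteq># H" using J(1) by (simp add: subset_mset.le_infI1)
    then have "size (J \<inter># K) + 1 \<le> r (\<Union> (set_mset (J \<inter># K)))"
      using assms(1) that by (auto simp: hall_def)
    also have "\<dots> \<le> r (?U \<inter> ?V)" using sub by (intro r_mono) auto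
    finally show ?thesis .
  qed
  have "size (J \<inter># K) \<le> r (?U \<inter> ?V)"
    using int_ne by (cases "J \<inter># K = {#}") auto
  then have "r (?U \<union> ?V) \<le> size (J \<union># K) + 2" using le sz by linarith
  then show "tight 2 H (X \<union> Y)"
    unfolding tight_def using JK un by (intro exI[of _ "J \<union># K"]) simp
  assume ne: "X \<inter> Y \<noteq> {}"
  have "size (J \<inter># K) + 1 \<le> r (?U \<inter> ?V)"
  proof (cases "J \<inter># K = {#}")
    case True
    obtain i where "i \<in> X" "i \<in> Y" using ne by auto
    then have "r {i} \<le> r (?U \<inter> ?V)" "i \<in> E" using sub by (auto intro!: r_mono)
    then show ?thesis using True r_single by simp
  qed (rule int_ne)
  then have "r (?U \<union> ?V) \<le> size (J \<union># K) + 1" using le sz by linarith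
  then show "tight 1 H (X \<union> Y)"
    unfolding tight_def using JK un by (intro exI[of _ "J \<union># K"]) simp
qed

lemma tight_singleton: "i \<in> E \<Longrightarrow> tight 1 H {i}"
  unfolding tight_def by (intro exI[of _ "{#}"]) (simp add: r_single)

text \<open>Tight sets containing \<open>F\<close> are closed under union by
  \<open>tight_Un_aux\<close>, so there is a largest one. The last conclusion turns tightness into
  containment in \<open>P\<close>, the form in which alternating sums can be evaluated.\<close>

lemma ex_block:
  assumes "hall H" "tight 1 H F" "F \<noteq> {}" "F \<subseteq> E"
  obtains P where "block H P" "F \<subseteq> P" "\<And>X. X \<subseteq> E \<Longrightarrow> X \<inter> F \<noteq> {} \<Longrightarrow> tight 1 H X \<longleftrightarrow> X \<subseteq> P"
proof -
  have "finite {X. X \<subseteq> E \<and> F \<subseteq> X \<and> tight 1 H X}"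
    using finite_ground by (intro finite_subset[OF _ finite_Pow_iff[THEN iffD2]]) auto
  moreover have "F \<in> {X. X \<subseteq> E \<and> F \<subseteq> X \<and> tight 1 H X}" using assms by auto
  ultimately obtain P where P: "P \<subseteq> E" "F \<subseteq> P" "tight 1 H P"
    and max: "\<And>X. X \<subseteq> E \<Longrightarrow> F \<subseteq> X \<Longrightarrow> tight 1 H X \<Longrightarrow> P \<subseteq> X \<Longrightarrow> X = P"
    using finite_has_maximal2[of "{X. X \<subseteq> E \<and> F \<subseteq> X \<and> tight 1 H X}" F]
    by (metis (no_types, lifting) mem_Collect_eq)
  have H: "set_mset H \<subseteq> Pow E" using assms(1) by (auto simp: hall_def)
  show ?thesis
  proof
    have "\<not> tight 1 H X" if "P \<subset> X" "X \<subseteq> E" for X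
      using max[of X] that P(2) by blast
    moreover have "P \<noteq> {}" using P(2) assms(3) by auto
    ultimately show "block H P" unfolding block_def using P by blast
    show "F \<subseteq> P" by fact
    fix X assume X: "X \<subseteq> E" "X \<inter> F \<noteq> {}"
    show "tight 1 H X \<longleftrightarrow> X \<subseteq> P"
    proof
      assume t: "tight 1 H X"
      have "X \<inter> P \<noteq> {}" using X P by auto
      then have "tight 1 H (X \<union> P)" using tight_Un_aux(2)[OF assms(1) t P(3) X(1) P(1)] by simp
      then show "X \<subseteq> P" using max[of "X \<union> P"] X P by blast
    next
      assume "X \<subseteq> P" then show "tight 1 H X" using tight_mono[OF P(3)] P(1) H by blast
    qed
  qed
qed

lemma deg_hvar:
  assumes "G \<subseteq> E"
  shows "deg (hvar G * single H 1) = of_bool (Suc (Suc (size H)) = r E \<and> hall H \<and> \<not> tight 1 H G)"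
  using hall_add_mset[OF assms] by (simp add: deg_def hvar_def mult_single)

text \<open>Above \<open>F\<close>, being tight means lying in the block \<open>P\<close> around
  \<open>F\<close>. The alternating sum over tight sets therefore runs over the interval from
  \<open>F\<close> to \<open>P\<close> and survives only for \<open>F = P\<close>.\<close>

lemma deg_xvar:
  assumes "F \<noteq> {}" "F \<subset> E"
  shows "deg (xvar E F * single H 1) = of_bool (Suc (Suc (size H)) = r E \<and> hall H \<and> block H F)"
proof (cases "Suc (Suc (size H)) = r E \<and> hall H")
  case True
  have "deg (xvar E F * single H 1)
      = - (\<Sum>G\<in>{F..E}. (-1) ^ card (G - F) * deg (hvar G * single H 1))"
    unfolding deg_def by (rule lin_ext_xvar)
  also have "\<dots> = - (\<Sum>G\<in>{F..E}. (-1) ^ card (G - F) * (1 - of_bool (tight 1 H G)))"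
    using True by (intro arg_cong[of _ _ uminus] sum.cong) (auto simp: deg_hvar)
  also have "\<dots> = (\<Sum>G\<in>{F..E}. (-1) ^ card (G - F) * of_bool (tight 1 H G)) - (\<Sum>G\<in>{F..E}. (-1) ^ card (G - F))"
    by (simp add: right_diff_distrib sum_subtractf)
  also have "(\<Sum>G\<in>{F..E}. (-1) ^ card (G - F)) = (0::rat)"
    using assms alternating_sum_interval[of E F] finite_ground by (simp add: psubset_eq)
  also have "(\<Sum>G\<in>{F..E}. (-1) ^ card (G - F) * of_bool (tight 1 H G)) - 0
      = (of_bool (block H F) :: rat)"
  proof (cases "tight 1 H F")
    case t: True
    obtain P where P: "block H P" "F \<subseteq> P" and PX: "\<And>X. X \<subseteq> E \<Longrightarrow> X \<inter> F \<noteq> {} \<Longrightarrow> tight 1 H X \<longleftrightarrow> X \<subseteq> P"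
      using ex_block[of H F] True t assms by auto
    have PE: "P \<subseteq> E" using P by (simp add: block_def)
    have "(\<Sum>G\<in>{F..E}. (-1) ^ card (G - F) * of_bool (tight 1 H G))
        = (\<Sum>G\<in>{F..P}. (-1) ^ card (G - F) :: rat)"
    proof (rule sum.mono_neutral_cong_right)
      show "finite {F..E}" using finite_ground by (intro finite_subset[OF _ finite_Pow_iff[THEN iffD2]]) auto
      have tG: "tight 1 H G \<longleftrightarrow> G \<subseteq> P" if "F \<subseteq> G" "G \<subseteq> E" for G
        using PX[of G] that assms by auto
      show "{F..P} \<subseteq> {F..E}" using PE by auto
      show "\<forall>i\<in>{F..E} - {F..P}. (-1) ^ card (i - F) * of_bool (tight 1 H i) = (0::rat)"
        using tG by auto
      show "\<And>x. x \<in> {F..P} \<Longrightarrow> (-1) ^ card (x - F) * of_bool (tight 1 H x) = ((-1) ^ card (x - F) :: rat)"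
        using tG PE by auto
    qed
    also have "\<dots> = of_bool (F = P)"
      using alternating_sum_interval[of P F] P PE finite_ground finite_subset by blast
    also have "F = P \<longleftrightarrow> block H F"
    proof
      assume "block H F"
      moreover have "tight 1 H P" using P(1) by (simp add: block_def)
      ultimately have "\<not> F \<subset> P" using PE unfolding block_def by blast
      then show "F = P" using P(2) by blast
    qed (use P in simp)
    finally show ?thesis by simp
  next
    case False
    then have "\<not> tight 1 H G" if "F \<subseteq> G" "G \<subseteq> E" for G
      using tight_mono[of 1 H G F] that True by (auto simp: hall_def)
    then show ?thesis using False by (simp add: block_def)
  qed
  finally show ?thesis using True by simp
next
  case False
  have "deg (xvar E F * single H 1)
      = - (\<Sum>G\<in>{F..E}. (-1) ^ card (G - F) * deg (hvar G * single H 1))"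
    unfolding deg_def by (rule lin_ext_xvar)
  also have "\<dots> = 0" using False by (auto simp: deg_hvar intro!: sum.neutral)
  finally show ?thesis using False by auto
qed

text \<open>The right-hand side sees \<open>G\<close> only through \<open>F \<union> G\<close>, so
  elements of \<open>F\<close> may be added to \<open>G\<close> at will; this invariance is what
  \<open>deg_xvar_restrict\<close> toggles.\<close>

lemma block_add_mset_iff:
  assumes "F \<noteq> {}" "F \<subset> E" "G \<subseteq> E" "\<not> G \<subseteq> F" "G \<noteq> {}"
  shows "hall (add_mset G H) \<and> block (add_mset G H) F \<longleftrightarrow> hall H \<and> block H F \<and> \<not> tight 2 H (F \<union> G)"
proof
  assume *: "hall (add_mset G H) \<and> block (add_mset G H) F"
  then have h: "hall H" "\<not> tight 1 H G" using hall_add_mset assms by auto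
  have t: "tight 1 H F \<or> tight 2 H (F \<union> G)" using * by (auto simp: block_def tight_add_mset numeral_2_eq_2)
  have "F \<subset> F \<union> G" "F \<union> G \<subseteq> E" using assms by auto
  then have "\<not> tight 1 (add_mset G H) (F \<union> G)" using * unfolding block_def by blast
  then have nt: "\<not> tight 2 H (F \<union> G)" by (simp add: tight_add_mset numeral_2_eq_2 Un_assoc)
  moreover have "block H F" using * t nt unfolding block_def by (auto simp: tight_add_mset)
  ultimately show "hall H \<and> block H F \<and> \<not> tight 2 H (F \<union> G)" using h by blast
next
  assume *: "hall H \<and> block H F \<and> \<not> tight 2 H (F \<union> G)"
  then have tF: "tight 1 H F" by (simp add: block_def)
  have "\<not> tight 1 H G" using tight_Un_aux(1)[of H F G] * tF assms by auto
  then have "hall (add_mset G H)" using hall_add_mset assms * by auto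
  moreover have "block (add_mset G H) F"
    unfolding block_def
  proof (intro conjI allI impI)
    fix X assume X: "F \<subset> X \<and> X \<subseteq> E"
    have "\<not> tight 1 H X" using * X by (auto simp: block_def)
    moreover have "\<not> tight 2 H (X \<union> G)"
    proof
      assume t: "tight 2 H (X \<union> G)"
      have "set_mset H \<subseteq> Pow E" using * by (simp add: hall_def)
      moreover have "F \<union> G \<subseteq> X \<union> G" "X \<union> G \<subseteq> E" using X assms by auto
      ultimately have "tight 2 H (F \<union> G)" using tight_mono[OF t] by blast
      then show False using * by simp
    qed
    ultimately show "\<not> tight 1 (add_mset G H) X" by (simp add: tight_add_mset numeral_2_eq_2)
  qed (use assms tF in \<open>auto simp: tight_add_mset\<close>)
  ultimately show "hall (add_mset G H) \<and> block (add_mset G H) F" ..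
qed

text \<open>Multiplication by \<open>x_F\<close> localises at \<open>F\<close>: the terms
  \<open>h_K\<close> of \<open>x_G\<close> with \<open>K\<close> not inside \<open>F\<close> cancel,
  and the rest is the expansion of \<open>x_G\<close> with \<open>F\<close> as ambient set. If
  \<open>G\<close> is not inside \<open>F\<close>, nothing is left, which is the relation for
  incomparable sets.\<close>

lemma deg_xvar_restrict:
  assumes "F \<noteq> {}" "F \<subset> E" "\<not> F \<subseteq> G" "G \<noteq> {}" "G \<subseteq> E"
  shows "deg (xvar E F * xvar E G * s) = deg (xvar E F * xvar F G * s)"
proof (rule deg_mult_cong)
  fix H
  obtain e where e: "e \<in> F" "e \<notin> G" using assms by auto
  define t where "t K = deg (xvar E F * (hvar K * single H 1))" for K
  have t: "t K = of_bool (Suc (Suc (Suc (size H))) = r E \<and> hall (add_mset K H) \<and> block (add_mset K H) F)" for K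
    using deg_xvar[OF assms(1,2), of "add_mset K H"] by (simp add: t_def hvar_def mult_single)
  have expand: "deg (xvar E F * xvar P G * single H 1) = - (\<Sum>K\<in>{G..P}. (-1) ^ card (K - G) * t K)" for P
    unfolding t_def using lin_ext_xvar[of _ P G "xvar E F * single H 1"]
    by (simp add: deg_def mult_ac)
  have fin: "finite {G..E}"
    using finite_ground by (intro finite_subset[OF _ finite_Pow_iff[THEN iffD2]]) auto
  \<comment> \<open>Masking the \<open>K\<close> inside \<open>F\<close> is compatible with toggling
    \<open>e\<close>, because \<open>e\<close> lies in \<open>F\<close>.\<close>
  have "(\<Sum>K\<in>{G..E}. (-1) ^ card (K - G) * (if K \<subseteq> F then 0 else t K)) = 0"
  proof (rule alternating_sum_toggle[OF finite_ground _ e(2)])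
    fix K assume K: "G \<subseteq> K" "K \<subseteq> E" "e \<notin> K"
    show "(if insert e K \<subseteq> F then 0 else t (insert e K)) = (if K \<subseteq> F then 0 else t K)"
    proof (cases "K \<subseteq> F")
      case False
      have un: "F \<union> insert e K = F \<union> K" using e by auto
      have K': "insert e K \<subseteq> E" "\<not> insert e K \<subseteq> F" "insert e K \<noteq> {}" "K \<noteq> {}"
        using K False e assms by auto
      have "(hall (add_mset (insert e K) H) \<and> block (add_mset (insert e K) H) F) \<longleftrightarrow>
          (hall (add_mset K H) \<and> block (add_mset K H) F)"
        unfolding block_add_mset_iff[OF assms(1,2) K'(1-3)] block_add_mset_iff[OF assms(1,2) K(2) False K'(4)] un ..
      then have "t (insert e K) = t K" unfolding t by simp
      then show ?thesis using False K'(2) by simp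
    qed (use e in simp)
  qed (use e assms in auto)
  moreover have "(\<Sum>K\<in>{G..E}. (-1) ^ card (K - G) * (if K \<subseteq> F then 0 else t K))
     = (\<Sum>K\<in>{G..E}. (-1) ^ card (K - G) * t K) - (\<Sum>K\<in>{G..F}. (-1) ^ card (K - G) * t K)"
  proof -
    have "(\<Sum>K\<in>{G..F}. (-1) ^ card (K - G) * t K)
        = (\<Sum>K\<in>{G..E}. (-1) ^ card (K - G) * (if K \<subseteq> F then t K else 0))"
      using assms fin by (intro sum.mono_neutral_cong_left) auto
    then show ?thesis
      by (simp add: sum_subtractf[symmetric] right_diff_distrib[symmetric] if_distrib cong: if_cong)
  qed
  ultimately show "deg (xvar E F * xvar E G * single H 1) = deg (xvar E F * xvar F G * single H 1)"
    unfolding expand by simp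
qed

lemma deg_xvar_incomparable:
  assumes "F \<noteq> {}" "F \<subset> E" "G \<noteq> {}" "G \<subset> E" "\<not> F \<subseteq> G" "\<not> G \<subseteq> F"
  shows "deg (xvar E F * xvar E G * s) = 0"
proof -
  have "xvar F G = 0" using assms(6) by (simp add: xvar_def)
  then show ?thesis using deg_xvar_restrict[of F G s] assms by simp
qed

text \<open>Among the sets containing \<open>i\<close> only the block \<open>P\<close> of
  \<open>i\<close> contributes, and \<open>h_S\<close> is killed exactly when
  \<open>S \<subseteq> P\<close>. The freedom in the choice of \<open>i\<close> is the source of the
  linear relations.\<close>

lemma deg_hvar_eq_sum:
  assumes "i \<in> S" "S \<subseteq> E"
  shows "deg (hvar S * s) = (\<Sum>G | G \<subset> E \<and> i \<in> G \<and> \<not> S \<subseteq> G. deg (xvar E G * s))"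
proof -
  have single: "deg (hvar S * single H 1) = (\<Sum>G | G \<subset> E \<and> i \<in> G \<and> \<not> S \<subseteq> G. deg (xvar E G * single H 1))" for H
  proof -
    let ?c = "Suc (Suc (size H)) = r E \<and> hall H"
    have eq: "(\<Sum>G | G \<subset> E \<and> i \<in> G \<and> \<not> S \<subseteq> G. deg (xvar E G * single H 1))
        = (\<Sum>G | G \<subset> E \<and> i \<in> G \<and> \<not> S \<subseteq> G. of_bool (?c \<and> block H G))"
      by (intro sum.cong refl, subst deg_xvar) auto
    show ?thesis
    proof (cases ?c)
      case True
      obtain P where P: "block H P" "{i} \<subseteq> P" and PX: "\<And>X. X \<subseteq> E \<Longrightarrow> X \<inter> {i} \<noteq> {} \<Longrightarrow> tight 1 H X \<longleftrightarrow> X \<subseteq> P"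
      proof (rule ex_block[of H "{i}"])
        show "tight 1 H {i}" using assms by (intro tight_singleton) auto
      qed (use True assms in auto)
      have PE: "P \<subseteq> E" using P by (simp add: block_def)
      have uniq: "G = P" if "block H G" "i \<in> G" for G
      proof -
        have "tight 1 H P" "tight 1 H G" "G \<subseteq> E" using P(1) that(1) by (simp_all add: block_def)
        then have "G \<subseteq> P" using PX[of G] that(2) by blast
        moreover have "\<not> G \<subset> P" using that(1) PE \<open>tight 1 H P\<close> unfolding block_def by blast
        ultimately show ?thesis by blast
      qed
      have S: "tight 1 H S \<longleftrightarrow> S \<subseteq> P" by (rule PX) (use assms in auto)
      have fin: "finite {G. G \<subset> E \<and> i \<in> G \<and> \<not> S \<subseteq> G}"
        using finite_ground by (intro finite_subset[OF _ finite_Pow_iff[THEN iffD2]]) auto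
      have "(\<Sum>G | G \<subset> E \<and> i \<in> G \<and> \<not> S \<subseteq> G. of_bool (?c \<and> block H G))
          = (\<Sum>G | G \<subset> E \<and> i \<in> G \<and> \<not> S \<subseteq> G. if G = P then 1 else 0 :: rat)"
      proof (rule sum.cong[OF refl])
        fix G assume "G \<in> {G. G \<subset> E \<and> i \<in> G \<and> \<not> S \<subseteq> G}"
        then have "block H G \<longleftrightarrow> G = P" using uniq P(1) by blast
        then show "of_bool (?c \<and> block H G) = (if G = P then 1 else 0 :: rat)" using True by simp
      qed
      also have "\<dots> = of_bool (P \<subset> E \<and> \<not> S \<subseteq> P)" using fin P by simp
      also have "\<dots> = of_bool (\<not> S \<subseteq> P)" using PE assms(2) by auto
      finally show ?thesis unfolding eq deg_hvar[OF assms(2)] using True S by simp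
    next
      case False
      then show ?thesis unfolding eq deg_hvar[OF assms(2)] by auto
    qed
  qed
  have "deg (hvar S * s) = deg ((\<Sum>G | G \<subset> E \<and> i \<in> G \<and> \<not> S \<subseteq> G. xvar E G) * s)"
    by (rule deg_mult_cong) (simp add: single sum_distrib_right deg_sum)
  then show ?thesis by (simp add: sum_distrib_right deg_sum)
qed

text \<open>Tightness of \<open>F\<close> would require \<open>r E \<le> size J + 1\<close> for some
  \<open>J\<close> inside \<open>H\<close>, but \<open>H\<close> has only \<open>r E - 2\<close>
  labels.\<close>

lemma deg_xvar_full_rank:
  assumes "F \<subset> E" "r F = r E" "F \<noteq> {}"
  shows "deg (xvar E F * s) = 0"
proof -
  have single: "deg (xvar E F * single H 1) = 0" for H
  proof -
    have "\<not> (Suc (Suc (size H)) = r E \<and> hall H \<and> block H F)"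
    proof
      assume *: "Suc (Suc (size H)) = r E \<and> hall H \<and> block H F"
      then obtain J where J: "J \<subseteq># H" "r (F \<union> \<Union> (set_mset J)) \<le> size J + 1"
        by (auto simp: block_def tight_def)
      have "r F \<le> r (F \<union> \<Union> (set_mset J))"
        using hallD_subset[OF _ J(1)] * assms by (intro r_mono) auto
      moreover have "size J \<le> size H" using J(1) by (rule size_mset_mono)
      ultimately show False using J * assms by linarith
    qed
    then show ?thesis using deg_xvar[OF assms(3,1), of H] by auto
  qed
  have "deg (xvar E F * s) = deg (0 * s)"
    by (rule deg_mult_cong) (simp add: single)
  then show ?thesis by simp
qed

end

section \<open>Nested rank functions\<close>

text \<open>\<open>count m G < c G\<close> is the condition for the smallest member of the chain,
  whose missing predecessor counts as having \<open>c\<close> equal to 0. Testing all smaller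
  \<open>F\<close> avoids naming the predecessor.\<close>

definition fy_mono :: "'b set set \<Rightarrow> ('b set \<Rightarrow> nat) \<Rightarrow> nat \<Rightarrow> 'b set multiset set" where
  "fy_mono L c j = {m. set_mset m \<subseteq> L \<and> size m = j \<and> (\<forall>F\<in>#m. \<forall>G\<in>#m. F \<subseteq> G \<or> G \<subseteq> F) \<and>
     (\<forall>G\<in>#m. count m G < c G \<and> (\<forall>F\<in>#m. F \<subset> G \<longrightarrow> count m G + c F < c G))}"

definition unif_rank :: "'b set \<Rightarrow> nat \<Rightarrow> 'b set \<Rightarrow> nat" where
  "unif_rank E k F = (if F = E then k else card F)"

definition unif_flats :: "'b set \<Rightarrow> nat \<Rightarrow> 'b set set" where
  "unif_flats E k = insert E {F. F \<subseteq> E \<and> F \<noteq> {} \<and> card F < k}"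

text \<open>The prescribed rank of a chain member: the exponents collected up to \<open>F\<close>.
  The extra unit at \<open>E\<close> makes the total rank \<open>j + 1\<close>, so that the
  functional has degree \<open>j\<close>.\<close>

definition nested_rank_at :: "'b set \<Rightarrow> 'b set multiset \<Rightarrow> 'b set \<Rightarrow> nat" where
  "nested_rank_at E m F = size {#G \<in># m. G \<subseteq> F#} + of_bool (F = E)"

definition nested_chain :: "'b set \<Rightarrow> 'b set multiset \<Rightarrow> 'b set set" where
  "nested_chain E m = insert {} (insert E (set_mset m))"

text \<open>On finite sets, the largest monotone function that is bounded by the prescribed values
  on the chain and grows by at most one per element; \<open>rank_le_of_deg\<close> relies on this
  shape.\<close>

definition nested_rank :: "'b set \<Rightarrow> 'b set multiset \<Rightarrow> 'b set \<Rightarrow> nat" where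
  "nested_rank E m S = Min ((\<lambda>F. nested_rank_at E m F + card (S - F)) ` nested_chain E m)"

context ranked_ground begin

lemma deg_prod_restrict:
  assumes "F \<noteq> {}" "F \<subset> E" "finite A" "\<And>G. G \<in> A \<Longrightarrow> G \<noteq> {} \<and> G \<subset> F"
  shows "deg (xvar E F * (\<Prod>G\<in>A. xvar E G * w G) * s) = deg (xvar E F * (\<Prod>G\<in>A. xvar F G * w G) * s)"
  using assms(3,4)
proof (induction A arbitrary: s rule: finite_induct)
  case (insert G A)
  have "deg (xvar E F * (\<Prod>G\<in>insert G A. xvar E G * w G) * s)
      = deg (xvar E F * (\<Prod>G\<in>A. xvar E G * w G) * (xvar E G * w G * s))"
    using insert by (simp add: mult_ac)
  also have "\<dots> = deg (xvar E F * (\<Prod>G\<in>A. xvar F G * w G) * (xvar E G * w G * s))"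
    using insert by blast
  also have "\<dots> = deg (xvar E F * xvar E G * ((\<Prod>G\<in>A. xvar F G * w G) * w G * s))"
    by (simp add: mult_ac)
  also have "\<dots> = deg (xvar E F * xvar F G * ((\<Prod>G\<in>A. xvar F G * w G) * w G * s))"
    using insert.prems[of G] assms by (intro deg_xvar_restrict) auto
  also have "\<dots> = deg (xvar E F * (\<Prod>G\<in>insert G A. xvar F G * w G) * s)"
    using insert by (simp add: mult_ac)
  finally show ?case .
qed simp

lemma ranked_ground_subset:
  assumes "P \<subseteq> E" shows "ranked_ground P r"
proof
  show "finite P" using assms finite_ground finite_subset by blast
qed (use assms r_mono r_submod r_single in auto)

end

lemma keys_mult_all:
  assumes "\<And>k. k \<in> keys p \<Longrightarrow> A k" "\<And>k. k \<in> keys q \<Longrightarrow> B k" "\<And>k l. A k \<Longrightarrow> B l \<Longrightarrow> C (k + l)"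
    and "k \<in> keys (p * q)"
  shows "C k"
  using keys_mult[of p q] assms by blast

lemma keys_hvar: "H \<in> keys (hvar S) \<Longrightarrow> H = {#S#}"
  by (simp add: hvar_def)

lemma keys_xvar: 
  assumes "H \<in> keys (xvar P F)"
  obtains S where "H = {#S#}" "F \<subseteq> S" "S \<subseteq> P"
proof -
  have "keys ((-1) ^ n * p) \<subseteq> keys p" for n and p :: "'a set multiset \<Rightarrow>\<^sub>0 rat"
  proof -
    have "(-1) ^ n * p = p \<or> (-1) ^ n * p = - p"
      by (induction n) auto
    moreover have "keys (- p) = keys p" by (simp add: Poly_Mapping.keys_def)
    ultimately show ?thesis by auto
  qed
  moreover have "H \<in> (\<Union>G\<in>{F..P}. keys ((-1) ^ card (G - F) * hvar G :: 'a set multiset \<Rightarrow>\<^sub>0 rat))"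
  proof -
    have "H \<in> keys (\<Sum>G\<in>{F..P}. (-1) ^ card (G - F) * hvar G :: 'a set multiset \<Rightarrow>\<^sub>0 rat)"
      using assms by (simp add: xvar_def in_keys_iff)
    then obtain G where "G \<in> {F..P}" "lookup ((-1) ^ card (G - F) * hvar G :: 'a set multiset \<Rightarrow>\<^sub>0 rat) H \<noteq> 0"
      unfolding in_keys_iff lookup_sum by (meson sum.not_neutral_contains_not_neutral)
    then show ?thesis by (auto simp: in_keys_iff)
  qed
  ultimately obtain G where "G \<in> {F..P}" "H \<in> keys (hvar G)" by blast
  then show ?thesis using that keys_hvar[of H G] by auto
qed

text \<open>\<open>Q n\<close> is meant as an additive grading; in
  \<open>deg_test_part_nonzero\<close> it counts the labels lying in a fixed set.\<close>

lemma keys_prod_all: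
  assumes "finite A" "\<And>a k. a \<in> A \<Longrightarrow> k \<in> keys (f a) \<Longrightarrow> Q (n a) k" "Q (0::nat) 0"
    and add: "\<And>m n k l. Q m k \<Longrightarrow> Q n l \<Longrightarrow> Q (m + n) (k + l)"
    and "k \<in> keys (\<Prod>a\<in>A. f a :: 'k::comm_monoid_add \<Rightarrow>\<^sub>0 rat)"
  shows "Q (\<Sum>a\<in>A. n a) k"
  using assms(1,2,5)
proof (induction A arbitrary: k rule: finite_induct)
  case empty
  then show ?case using assms(3) by (simp split: if_splits)
next
  case (insert a A)
  have "k \<in> keys (f a * (\<Prod>a\<in>A. f a))" using insert by simp
  then have "Q (n a + (\<Sum>a\<in>A. n a)) k"
    by (rule keys_mult_all[rotated 3, where A = "Q (n a)" and B = "Q (\<Sum>a\<in>A. n a)"])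
       (use insert add in auto)
  then show ?case using insert by simp
qed

lemma keys_power_all:
  assumes "\<And>k. k \<in> keys p \<Longrightarrow> Q n k" "Q (0::nat) 0"
    and "\<And>m n k l. Q m k \<Longrightarrow> Q n l \<Longrightarrow> Q (m + n) (k + l)"
    and "k \<in> keys (p ^ e :: 'k::comm_monoid_add \<Rightarrow>\<^sub>0 rat)"
  shows "Q (e * n) k"
  using keys_prod_all[of "{..<e}" "\<lambda>_. p" Q "\<lambda>_. n" k] assms by simp

section \<open>The nested matroid of a Feichtner-Yuzvinsky monomial\<close>

locale fy_data =
  fixes E :: "'a set" and k :: nat and m :: "'a set multiset" and j :: nat
  assumes finite_E: "finite E" and k_pos: "0 < k" and k_le: "k \<le> card E"
    and fy: "m \<in> fy_mono (unif_flats E k) (unif_rank E k) j"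
begin

abbreviation "C \<equiv> nested_chain E m"
abbreviation "\<rho> \<equiv> nested_rank_at E m"
abbreviation "rk \<equiv> nested_rank E m"
abbreviation "c \<equiv> unif_rank E k"

lemma E_ne: "E \<noteq> {}"
  using k_pos k_le by auto

lemma mem: "F \<in># m \<Longrightarrow> F \<noteq> {}" "F \<in># m \<Longrightarrow> F \<subseteq> E" "F \<in># m \<Longrightarrow> F \<noteq> E \<Longrightarrow> card F < k"
  using fy E_ne by (auto simp: fy_mono_def unif_flats_def)

lemma C_sub: "F \<in> C \<Longrightarrow> F \<subseteq> E"
  using mem by (auto simp: nested_chain_def)

lemma finite_C: "finite C"
  by (simp add: nested_chain_def)

lemma C_chain: "F \<in> C \<Longrightarrow> G \<in> C \<Longrightarrow> F \<subseteq> G \<or> G \<subseteq> F"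
proof -
  assume "F \<in> C" "G \<in> C"
  then consider "F = {} \<or> G = {}" | "F = E \<or> G = E" | "F \<in># m" "G \<in># m"
    by (auto simp: nested_chain_def)
  then show ?thesis
  proof cases
    case 3 then show ?thesis using fy by (simp add: fy_mono_def)
  qed (use \<open>F \<in> C\<close> \<open>G \<in> C\<close> C_sub in blast)+
qed

lemma C_finite_mem: "F \<in> C \<Longrightarrow> finite F"
  using C_sub finite_E finite_subset by blast

lemma \<rho>_E: "\<rho> E = j + 1"
proof -
  have "{#G \<in># m. G \<subseteq> E#} = m" using mem by (simp add: filter_mset_eq_conv)
  then show ?thesis using fy by (simp add: nested_rank_at_def fy_mono_def)
qed

lemma \<rho>_empty: "\<rho> {} = 0"
proof -
  have "{#G \<in># m. G \<subseteq> {}#} = {#}" using mem by (auto simp: filter_mset_eq_conv)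
  then show ?thesis using E_ne by (simp add: nested_rank_at_def)
qed

text \<open>Carries the Feichtner-Yuzvinsky bound over to the chain enlarged by \<open>{}\<close>
  and \<open>E\<close>; if \<open>E\<close> is not in \<open>m\<close>, it holds because proper
  flats have fewer than \<open>k\<close> elements.\<close>

lemma slack:
  assumes "F \<in> C" "G \<in> C" "G \<subset> F"
  shows "count m F + c G < c F"
proof (cases "F \<in># m")
  case True
  show ?thesis
  proof (cases "G = {}")
    case True
    then show ?thesis using \<open>F \<in># m\<close> fy E_ne by (auto simp: fy_mono_def unif_rank_def)
  next
    case False
    have "G \<noteq> E" using assms C_sub by blast
    then have "G \<in># m" using False assms by (auto simp: nested_chain_def)
    then show ?thesis using \<open>F \<in># m\<close> assms fy by (auto simp: fy_mono_def)
  qed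
next
  case False
  then have F: "F = E" using assms by (auto simp: nested_chain_def)
  then have "count m F = 0" using False by (simp add: count_eq_zero_iff)
  moreover have "c G < k"
    using assms F mem(3)[of G] k_pos by (auto simp: nested_chain_def unif_rank_def)
  ultimately show ?thesis using F by (simp add: unif_rank_def)
qed

lemma pred:
  assumes "F \<in> C" "F \<noteq> {}"
  obtains G where "G \<in> C" "G \<subset> F" "\<And>H. H \<in> C \<Longrightarrow> H \<subset> F \<Longrightarrow> H \<subseteq> G"
    "\<rho> F = \<rho> G + count m F + of_bool (F = E)"
proof -
  let ?D = "{H \<in> C. H \<subset> F}"
  have "finite ?D" "{} \<in> ?D" using assms finite_C by (auto simp: nested_chain_def)
  then obtain G where G: "G \<in> ?D" and max: "\<And>H. H \<in> ?D \<Longrightarrow> G \<subseteq> H \<Longrightarrow> H = G"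
    using finite_has_maximal[of ?D] by (metis (no_types, lifting) empty_iff)
  have top: "H \<subseteq> G" if "H \<in> C" "H \<subset> F" for H
    using max[of H] C_chain[of H G] that G by blast
  have "{#H \<in># m. H \<subseteq> F#} = {#H \<in># m. H \<subseteq> G#} + {#H \<in># m. H = F#}"
  proof (rule multiset_eqI)
    fix H
    show "count {#H \<in># m. H \<subseteq> F#} H = count ({#H \<in># m. H \<subseteq> G#} + {#H \<in># m. H = F#}) H"
    proof (cases "H \<in># m")
      case True
      then have "H \<in> C" by (simp add: nested_chain_def)
      then have "H \<subseteq> F \<longleftrightarrow> H \<subseteq> G \<or> H = F" "\<not> F \<subseteq> G" using top[of H] G by blast+
      then show ?thesis by (auto simp: count_filter_mset)
    qed (auto simp: not_in_iff)
  qed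
  then have "size {#H \<in># m. H \<subseteq> F#} = size {#H \<in># m. H \<subseteq> G#} + count m F"
    by (simp add: filter_eq_replicate_mset)
  moreover have "G \<noteq> E" using G assms C_sub by blast
  ultimately have "\<rho> F = \<rho> G + count m F + of_bool (F = E)" by (simp add: nested_rank_at_def)
  then show ?thesis using that[of G] G top by blast
qed

text \<open>\<open>slack\<close> summed along the chain. A step ending below \<open>E\<close> leaves
  a unit to spare; the step ending at \<open>E\<close> spends its unit on the extra 1 in
  \<open>nested_rank_at\<close>, hence the \<open>of_bool\<close>.\<close>

lemma \<rho>_c:
  assumes "F \<in> C" "G \<in> C" "G \<subset> F"
  shows "\<rho> F + c G + of_bool (F \<noteq> E) \<le> \<rho> G + c F"
  using assms
proof (induction "card F" arbitrary: F rule: less_induct)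
  case less
  then obtain H where H: "H \<in> C" "H \<subset> F" "\<And>H'. H' \<in> C \<Longrightarrow> H' \<subset> F \<Longrightarrow> H' \<subseteq> H"
    "\<rho> F = \<rho> H + count m F + of_bool (F = E)"
    using pred[of F] by blast
  have sl: "count m F + c H < c F" using slack less H by blast
  have "G \<subseteq> H" using H less by blast
  have "\<rho> H + c G \<le> \<rho> G + c H"
  proof (cases "G = H")
    case False
    have "card H < card F" using H(2) less.prems(1) C_finite_mem psubset_card_mono by blast
    then show ?thesis using less.hyps[of H] H False less.prems \<open>G \<subseteq> H\<close> by fastforce
  qed simp
  then show ?case using sl H(4) by (auto split: if_splits simp: of_bool_def)
qed

lemma c_diff:
  assumes "F \<in> C" "G \<in> C" "G \<subseteq> F"
  shows "c F \<le> c G + card (F - G)"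
proof -
  have "card F = card G + card (F - G)"
    using assms C_finite_mem by (metis card_Diff_subset card_mono le_add_diff_inverse finite_subset)
  moreover have "c F \<le> card F" using k_le by (simp add: unif_rank_def)
  moreover have "G = E \<Longrightarrow> F = E" using assms C_sub by blast
  ultimately show ?thesis by (auto simp: unif_rank_def)
qed

lemma \<rho>_strict:
  assumes "F \<in> C" "G \<in> C" "G \<subset> F"
  shows "\<rho> G < \<rho> F"
proof -
  obtain H where H: "H \<in> C" "H \<subset> F" "\<And>H'. H' \<in> C \<Longrightarrow> H' \<subset> F \<Longrightarrow> H' \<subseteq> H"
    "\<rho> F = \<rho> H + count m F + of_bool (F = E)"
    using pred[of F] assms by blast
  have "G \<subseteq> H" using assms H by blast
  have "G \<noteq> E" "H \<noteq> E" using assms C_sub H by blast+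
  moreover have "{#K \<in># m. K \<subseteq> G#} \<subseteq># {#K \<in># m. K \<subseteq> H#}"
    using \<open>G \<subseteq> H\<close> by (auto simp: subseteq_mset_def count_filter_mset)
  ultimately have "\<rho> G \<le> \<rho> H" unfolding nested_rank_at_def by (simp add: size_mset_mono)
  moreover have "0 < count m F + of_bool (F = E)"
    using assms by (auto simp: nested_chain_def)
  ultimately show ?thesis using H(4) by linarith
qed

lemma rk_le: "F \<in> C \<Longrightarrow> rk S \<le> \<rho> F + card (S - F)"
  unfolding nested_rank_def using finite_C by (intro Min_le) auto

lemma rk_attained: obtains F where "F \<in> C" "rk S = \<rho> F + card (S - F)"
proof -
  have "rk S \<in> (\<lambda>F. \<rho> F + card (S - F)) ` C"
    unfolding nested_rank_def using finite_C by (intro Min_in) (auto simp: nested_chain_def)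
  then show ?thesis using that by auto
qed

lemma le_rkI: "(\<And>F. F \<in> C \<Longrightarrow> n \<le> \<rho> F + card (S - F)) \<Longrightarrow> n \<le> rk S"
  using rk_attained[of S] by metis

text \<open>The prescribed ranks are consistent: by \<open>\<rho>_c\<close> and
  \<open>c_diff\<close> a smaller \<open>G\<close> gives a term of at least \<open>\<rho> F\<close>,
  and a larger one does so by \<open>\<rho>_strict\<close>.\<close>

lemma rk_chain:
  assumes "F \<in> C" shows "rk F = \<rho> F"
proof (rule antisym)
  show "rk F \<le> \<rho> F" using rk_le[OF assms, of F] by simp
  show "\<rho> F \<le> rk F"
  proof (rule le_rkI)
    fix G assume G: "G \<in> C"
    show "\<rho> F \<le> \<rho> G + card (F - G)"
    proof (cases "F \<subseteq> G")
      case True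
      then show ?thesis using \<rho>_strict[OF G assms] by (cases "F = G") (auto simp: psubset_eq)
    next
      case False
      then have "G \<subset> F" using C_chain G assms by blast
      then show ?thesis using \<rho>_c[OF assms G] c_diff[OF assms G] by (simp add: psubset_imp_subset)
    qed
  qed
qed

text \<open>The chain consists of flats of the nested matroid; this later makes its members maximal
  tight sets.\<close>

lemma rk_above_chain:
  assumes "F \<in> C" "F \<subset> X" "X \<subseteq> E"
  shows "\<rho> F < rk X"
proof -
  have finX: "finite X" using assms finite_E finite_subset by blast
  have "Suc (\<rho> F) \<le> rk X"
  proof (rule le_rkI)
    fix G assume G: "G \<in> C"
    show "Suc (\<rho> F) \<le> \<rho> G + card (X - G)"
    proof (cases "G \<subseteq> F")
      case True
      have "card (F - G) < card (X - G)" using assms True finX by (intro psubset_card_mono) auto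
      moreover have "\<rho> F \<le> \<rho> G + card (F - G)" using rk_le[OF G, of F] rk_chain assms by simp
      ultimately show ?thesis by linarith
    next
      case False
      then have "F \<subset> G" using C_chain G assms by blast
      then show ?thesis using \<rho>_strict[OF G assms(1)] by linarith
    qed
  qed
  then show ?thesis by simp
qed

text \<open>\<open>\<rho>_c\<close> between \<open>G\<close> and \<open>E\<close> bounds the missing
  rank by \<open>k - card G\<close>, which \<open>S - G\<close> supplies. This is the link to the
  uniform matroid: \<open>x_G\<close> vanishes for large \<open>G\<close>.\<close>

lemma rk_large:
  assumes "S \<subseteq> E" "k \<le> card S"
  shows "rk S = j + 1"
proof (rule antisym)
  have EC: "E \<in> C" by (simp add: nested_chain_def)
  have "card (S - E) = 0" using assms(1) by (metis Diff_eq_empty_iff card.empty)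
  then show "rk S \<le> j + 1" using rk_le[OF EC, of S] \<rho>_E by simp
  show "j + 1 \<le> rk S"
  proof (rule le_rkI)
    fix G assume G: "G \<in> C"
    show "j + 1 \<le> \<rho> G + card (S - G)"
    proof (cases "G = E")
      case False
      then have "G \<subset> E" using C_sub G by blast
      from \<rho>_c[OF EC G this] have "\<rho> E + card G \<le> \<rho> G + k" using False by (simp add: unif_rank_def)
      moreover have "card S \<le> card G + card (S - G)"
        using C_finite_mem[OF G] by (metis add.commute diff_card_le_card_Diff le_diff_conv)
      ultimately show ?thesis using \<rho>_E assms by linarith
    qed (use \<rho>_E in simp)
  qed
qed

text \<open>Uncrossing: if the minima for the two sets are attained at
  \<open>F \<subseteq> G\<close>, the union is tested with \<open>G\<close> and the intersection
  with \<open>F\<close>.\<close>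

lemma rk_submod:
  assumes "A \<subseteq> E" "B \<subseteq> E"
  shows "rk (A \<union> B) + rk (A \<inter> B) \<le> rk A + rk B"
proof -
  have *: "rk (A \<union> B) + rk (A \<inter> B) \<le> \<rho> F + card (A - F) + (\<rho> G + card (B - G))"
    if "F \<in> C" "G \<in> C" "F \<subseteq> G" "A \<subseteq> E" "B \<subseteq> E" for A B F G
  proof -
    have fin: "finite A" "finite B" using that finite_E finite_subset by blast+
    have "card ((A \<union> B) - G) + card ((A \<inter> B) - F) \<le> card ((A - F) \<union> (B - G)) + card ((A - F) \<inter> (B - G))"
    proof -
      let ?M = "(A \<inter> B) \<inter> (G - F)"
      have "card ((A \<inter> B) - F) = card (?M \<union> (A \<inter> B - G))" using that(3) by (intro arg_cong[of _ _ card]) auto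
      also have "\<dots> = card ?M + card (A \<inter> B - G)" using fin by (intro card_Un_disjoint) auto
      finally have 1: "card ((A \<inter> B) - F) = card ?M + card (A \<inter> B - G)" .
      have "card ((A \<union> B - G) \<union> ?M) = card (A \<union> B - G) + card ?M" using fin by (intro card_Un_disjoint) auto
      moreover have "card ((A \<union> B - G) \<union> ?M) \<le> card ((A - F) \<union> (B - G))"
        using fin that(3) by (intro card_mono) auto
      moreover have "card (A \<inter> B - G) \<le> card ((A - F) \<inter> (B - G))"
        using fin that(3) by (intro card_mono) auto
      ultimately show ?thesis using 1 by linarith
    qed
    also have "\<dots> = card (A - F) + card (B - G)" using fin by (simp add: card_Un_Int[of "A - F" "B - G"])
    finally show ?thesis using rk_le[OF that(2), of "A \<union> B"] rk_le[OF that(1), of "A \<inter> B"] by linarith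
  qed
  obtain F where F: "F \<in> C" "rk A = \<rho> F + card (A - F)" by (rule rk_attained)
  obtain G where G: "G \<in> C" "rk B = \<rho> G + card (B - G)" by (rule rk_attained)
  consider "F \<subseteq> G" | "G \<subseteq> F" using C_chain F G by blast
  then show ?thesis
    using *[of F G A B] *[of G F B A] F G assms by cases (auto simp: Un_commute Int_commute)
qed

sublocale ranked_ground E rk
proof
  show "rk A \<le> rk B" if "A \<subseteq> B" "B \<subseteq> E" for A B
  proof -
    obtain F where F: "F \<in> C" "rk B = \<rho> F + card (B - F)" by (rule rk_attained)
    have "card (A - F) \<le> card (B - F)"
      using that finite_E finite_subset by (intro card_mono) (auto intro: finite_subset)
    then show ?thesis using rk_le[OF F(1), of A] F(2) by linarith
  qed
  show "rk {i} = 1" if "i \<in> E" for i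
  proof (rule antisym)
    have 0: "{} \<in> C" by (simp add: nested_chain_def)
    show "rk {i} \<le> 1" using rk_le[OF 0, of "{i}"] \<rho>_empty by simp
    show "1 \<le> rk {i}"
    proof (rule le_rkI)
      fix F assume "F \<in> C"
      then show "1 \<le> \<rho> F + card ({i} - F)" using \<rho>_strict[OF \<open>F \<in> C\<close> 0] by (cases "F = {}") (auto simp: psubset_eq)
    qed
  qed
qed (fact finite_E, fact rk_submod)

text \<open>The ambient set \<open>Q\<close> is kept apart from the range \<open>P\<close> of the
  product, because \<open>deg_prod_restrict\<close> changes the former and not the latter.\<close>

definition below :: "'a set \<Rightarrow> 'a set \<Rightarrow> ('a set multiset \<Rightarrow>\<^sub>0 rat)" where
  "below P Q = (\<Prod>F | F \<in># m \<and> F \<subset> P. xvar Q F * hvar F ^ (count m F - 1))"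

text \<open>For \<open>P \<noteq> E\<close> in \<open>m\<close> one of the \<open>count m P\<close>
  factors is the \<open>x_P\<close> of the surrounding product, hence the \<open>- 1\<close>. At
  \<open>E\<close> there is no such factor and \<open>h_E\<close> keeps the full exponent.\<close>

definition test_part :: "'a set \<Rightarrow> ('a set multiset \<Rightarrow>\<^sub>0 rat)" where
  "test_part P = below P P * hvar P ^ (count m P + of_bool (P = E) - 1)"

lemma keys_test_part:
  assumes "H \<in> keys (test_part P)"
  shows "set_mset H \<subseteq> Pow P"
proof -
  define Q where "Q n H \<longleftrightarrow> set_mset H \<subseteq> Pow P" for n :: nat and H :: "'a set multiset"
  have add: "Q a K \<Longrightarrow> Q b L \<Longrightarrow> Q (a + b) (K + L)" for a b K L by (auto simp: Q_def)
  have pw: "Q 0 H" if "H \<in> keys (hvar F ^ e)" "F \<subseteq> P" for F H e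
  proof -
    have "Q (e * 0) H"
    proof (rule keys_power_all[where Q = Q, OF _ _ add that(1)])
      show "Q 0 K" if "K \<in> keys (hvar F)" for K using keys_hvar[OF that] \<open>F \<subseteq> P\<close> by (simp add: Q_def)
    qed (simp add: Q_def)
    then show ?thesis by simp
  qed
  have 1: "Q 0 H" if "H \<in> keys (below P P)" for H
    unfolding Q_def
  proof -
    have "Q (\<Sum>F\<in>{F. F \<in># m \<and> F \<subset> P}. 0) H"
    proof (rule keys_prod_all[where Q = Q, OF _ _ _ add that[unfolded below_def]])
      fix F K assume F: "F \<in> {F. F \<in># m \<and> F \<subset> P}" "K \<in> keys (xvar P F * hvar F ^ (count m F - 1))"
      show "Q 0 K"
      proof (rule keys_mult_all[OF _ _ _ F(2), where A = "Q 0" and B = "Q 0"])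
        show "Q 0 L" if "L \<in> keys (xvar P F)" for L using that by (auto elim!: keys_xvar simp: Q_def)
        show "Q 0 L" if "L \<in> keys (hvar F ^ (count m F - 1))" for L using that F by (intro pw) auto
      qed (use add[of 0 _ 0] in auto)
    qed (auto simp: Q_def)
    then show "set_mset H \<subseteq> Pow P" by (simp add: Q_def)
  qed
  have "Q 0 H"
    by (rule keys_mult_all[OF _ _ _ assms[unfolded test_part_def], where A = "Q 0" and B = "Q 0"])
       (use 1 pw add[of 0 _ 0] in auto)
  then show ?thesis by (simp add: Q_def)
qed

lemma hvar_power: "hvar S ^ n = single (replicate_mset n S) 1"
  by (induction n) (simp_all add: hvar_def mult_single)

text \<open>Induction along the chain. The factor \<open>x_F\<close> of the predecessor
  \<open>F\<close> of \<open>P\<close> moves all lower factors into \<open>F\<close>, and pairing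
  with \<open>x_F\<close> and the powers of \<open>h_P\<close> turns the functional on
  \<open>P\<close> into the functional on \<open>F\<close>.\<close>

lemma deg_test_part:
  assumes "P \<in> C" "P \<noteq> {}"
  shows "ranked_ground.deg P rk (test_part P) = 1"
  using assms
proof (induction "card P" arbitrary: P rule: less_induct)
  case less
  have PE: "P \<subseteq> E" using less.prems C_sub by blast
  interpret P: ranked_ground P rk using ranked_ground_subset[OF PE] .
  obtain F where F: "F \<in> C" "F \<subset> P" and top: "\<And>H. H \<in> C \<Longrightarrow> H \<subset> P \<Longrightarrow> H \<subseteq> F"
    and \<rho>P: "\<rho> P = \<rho> F + count m P + of_bool (P = E)"
    using pred less.prems by blast
  define e where "e = count m P + of_bool (P = E) - 1"
  have "0 < count m P + of_bool (P = E)" using less.prems by (auto simp: nested_chain_def)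
  \<comment> \<open>The \<open>e\<close> copies of \<open>h_P\<close> and the single
    \<open>x_F\<close> account for the rank gap \<open>e + 1\<close> between \<open>F\<close> and
    \<open>P\<close>.\<close>
  then have rP: "rk P = \<rho> F + e + 1" using \<rho>P rk_chain[OF less.prems(1)] by (simp add: e_def)
  show ?case
  proof (cases "F = {}")
    case True
    have empty: "{F. F \<in># m \<and> F \<subset> P} = {}"
    proof -
      have "G \<subseteq> {}" if "G \<in># m" "G \<subset> P" for G
        using top[of G] that True by (simp add: nested_chain_def)
      then have "G \<notin># m" if "G \<subset> P" for G using mem(1)[of G] that by blast
      then show ?thesis by blast
    qed
    have tp: "test_part P = single (replicate_mset e P) 1"
      unfolding test_part_def below_def empty by (simp add: hvar_power e_def)
    have "P.hall (replicate_mset e P)"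
      unfolding P.hall_def
    proof (intro conjI allI impI)
      show "set_mset (replicate_mset e P) \<subseteq> Pow P" by (auto split: if_splits)
      fix J assume J: "J \<subseteq># replicate_mset e P \<and> J \<noteq> {#}"
      then have "set_mset J \<subseteq> {P}" using set_mset_mono by (fastforce split: if_splits)
      then have "\<Union> (set_mset J) = P" using J by (metis Union_insert ccpo_Sup_singleton set_mset_eq_empty_iff subset_singletonD)
      moreover have "size J \<le> e" using J size_mset_mono by fastforce
      ultimately show "size J + 1 \<le> rk (\<Union> (set_mset J))" using rP by simp
    qed
    then show ?thesis unfolding tp P.deg_def using rP True \<rho>_empty by simp
  next
    case False
    have FE: "F \<noteq> E" using F PE by blast
    then have Fm: "F \<in># m" using F False by (auto simp: nested_chain_def)
    have set: "{G. G \<in># m \<and> G \<subset> P} = insert F {G. G \<in># m \<and> G \<subset> F}"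
      using top F(2) Fm
    proof -
      have "G \<subset> F" if "G \<in># m" "G \<subset> P" "G \<noteq> F" for G
        using top[of G] that by (auto simp: nested_chain_def)
      then show ?thesis using F(2) Fm by blast
    qed
    have "below P P = xvar P F * hvar F ^ (count m F - 1) * below F P"
      unfolding below_def set by (subst prod.insert) auto
    then have "P.deg (test_part P) = P.deg (xvar P F * below F P * (hvar F ^ (count m F - 1) * hvar P ^ e))"
      by (simp add: test_part_def e_def mult_ac)
    also have "\<dots> = P.deg (xvar P F * below F F * (hvar F ^ (count m F - 1) * hvar P ^ e))"
      unfolding below_def by (rule P.deg_prod_restrict) (use False F mem in auto)
    also have "\<dots> = P.deg ((xvar P F * hvar P ^ e) * test_part F)"
      using FE by (simp add: test_part_def mult_ac)
    also have "\<dots> = ranked_ground.deg F rk (1 * test_part F)"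
      unfolding P.deg_def ranked_ground.deg_def[OF ranked_ground_subset[OF C_sub[OF F(1)]]]
    proof (rule lin_ext_mult_cong, fold P.deg_def ranked_ground.deg_def[OF ranked_ground_subset[OF C_sub[OF F(1)]]])
      interpret F: ranked_ground F rk using ranked_ground_subset[OF C_sub[OF F(1)]] .
      fix H assume "H \<in> keys (test_part F)"
      then have H: "set_mset H \<subseteq> Pow F" by (rule keys_test_part)
      let ?H = "replicate_mset e P + H"
      have JH: "J \<subseteq># H" if "J \<subseteq># ?H" "P \<notin># J" for J
        using that by (auto simp: subseteq_mset_def count_eq_zero_iff) 
          (metis add_0 count_replicate_mset not_in_iff le0)
      \<comment> \<open>A submultiset containing \<open>P\<close> has union \<open>P\<close>, whose
        rank is \<open>size ?H + 2\<close>; it can neither violate \<open>hall\<close> nor witness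
        tightness. Only the labels in \<open>F\<close> matter.\<close>
      have szH: "P.hall ?H \<and> P.block ?H F \<longleftrightarrow> F.hall H" if sz: "Suc (size H) = rk F"
      proof
        assume h: "P.hall ?H \<and> P.block ?H F"
        show "F.hall H" unfolding F.hall_def
        proof (intro conjI allI impI)
          fix J assume "J \<subseteq># H \<and> J \<noteq> {#}"
          moreover from this have "J \<subseteq># ?H" by (simp add: subset_mset.add_increasing)
          ultimately show "size J + 1 \<le> rk (\<Union> (set_mset J))" using h by (auto simp: P.hall_def)
        qed (fact H)
      next
        assume h: "F.hall H"
        have "P.hall ?H" unfolding P.hall_def
        proof (intro conjI allI impI)
          show "set_mset ?H \<subseteq> Pow P" using H F by (auto split: if_splits)
          fix J assume J: "J \<subseteq># ?H \<and> J \<noteq> {#}"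
          show "size J + 1 \<le> rk (\<Union> (set_mset J))"
          proof (cases "P \<in># J")
            case True
            have "set_mset J \<subseteq> Pow P" using J H F set_mset_mono[of J ?H] by (fastforce split: if_splits)
            then have "\<Union> (set_mset J) = P" using True by auto
            moreover have "size J \<le> size ?H" using J size_mset_mono by blast
            ultimately show ?thesis using rP sz rk_chain[OF F(1)] by simp
          next
            case False
            then have "J \<subseteq># H" using JH J by blast
            then show ?thesis using h J by (auto simp: F.hall_def)
          qed
        qed
        moreover have "P.block ?H F" unfolding P.block_def
        proof (intro conjI allI impI)
          show "F \<noteq> {}" by fact
          show "F \<subseteq> P" using F by blast
          have "F \<union> \<Union> (set_mset H) = F" using H by auto
          then show "P.tight 1 ?H F"
            unfolding P.tight_def using sz by (intro exI[of _ H]) simp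
          fix X assume X: "F \<subset> X \<and> X \<subseteq> P"
          show "\<not> P.tight 1 ?H X"
          proof
            assume "P.tight 1 ?H X"
            then obtain J where J: "J \<subseteq># ?H" "rk (X \<union> \<Union> (set_mset J)) \<le> size J + 1"
              by (auto simp: P.tight_def)
            have JP: "\<Union> (set_mset J) \<subseteq> P" using J H F set_mset_mono[of J ?H] by (fastforce split: if_splits)
            show False
            proof (cases "P \<in># J")
              case True
              then have "X \<union> \<Union> (set_mset J) = P" using JP X by auto
              moreover have "size J \<le> size ?H" using J size_mset_mono by blast
              ultimately show False using J rP sz rk_chain[OF F(1)] by simp
            next
              case False
              then have "size J \<le> size H" using JH J size_mset_mono by blast
              moreover have "rk X \<le> rk (X \<union> \<Union> (set_mset J))" using X JP by (intro P.r_mono) auto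
              moreover have "\<rho> F < rk X" using rk_above_chain[OF F(1)] X PE by blast
              ultimately show False using J sz rk_chain[OF F(1)] by simp
            qed
          qed
        qed
        ultimately show "P.hall ?H \<and> P.block ?H F" ..
      qed
      have "P.deg (xvar P F * hvar P ^ e * single H 1) = P.deg (xvar P F * single ?H 1)"
        by (simp add: hvar_power mult.assoc mult_single)
      also have "\<dots> = of_bool (Suc (Suc (size ?H)) = rk P \<and> P.hall ?H \<and> P.block ?H F)"
        by (rule P.deg_xvar) (use False F in auto)
      also have "\<dots> = of_bool (Suc (size H) = rk F \<and> F.hall H)"
        using szH rP rk_chain[OF F(1)] by auto
      also have "\<dots> = F.deg (1 * single H 1)" by (simp add: F.deg_def)
      finally show "P.deg (xvar P F * hvar P ^ e * single H 1) = F.deg (1 * single H 1)" .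
    qed
    also have "\<dots> = 1"
      using less.hyps[of F] F False psubset_card_mono[OF C_finite_mem[OF less.prems(1)] F(2)] by simp
    finally show ?thesis .
  qed
qed

text \<open>A nonzero value gives a term \<open>H\<close> of the cofactor of \<open>x_F\<close> that
  has \<open>F\<close> as a block. Each such term has exactly \<open>\<rho> F - 1\<close> labels
  inside \<open>F\<close>, and maximality of the block forces the labels that witness its tightness
  into \<open>F\<close>; so \<open>r F\<close> is at most their number plus one.\<close>

lemma deg_test_part_nonzero:
  assumes R: "ranked_ground E r" and F: "F \<in># m" "F \<noteq> E"
    and nz: "ranked_ground.deg E r (test_part E) \<noteq> 0"
  shows "r F \<le> \<rho> F"
proof -
  interpret R: ranked_ground E r by (rule R)
  have FE: "F \<subset> E" and F0: "F \<noteq> {}" using mem F by auto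
  have chain: "G \<subset> F \<or> F \<subset> G" if "G \<in># m" "G \<noteq> F" for G
    using C_chain[of F G] that F by (auto simp: nested_chain_def)
  let ?w = "\<lambda>G. hvar G ^ (count m G - 1)"
  let ?A = "{G. G \<in># m \<and> G \<subset> F}" and ?B = "{G. G \<in># m \<and> F \<subset> G \<and> G \<subset> E}"
  define s where "s = ?w F * (\<Prod>G\<in>?B. xvar E G * ?w G) * hvar E ^ count m E"
  have set: "{G. G \<in># m \<and> G \<subset> E} = insert F (?A \<union> ?B)" using chain F FE by blast
  have finAB: "finite ?A" "finite ?B" "finite (?A \<union> ?B)" by simp_all
  have "below E E = xvar E F * ?w F * ((\<Prod>G\<in>?A. xvar E G * ?w G) * (\<Prod>G\<in>?B. xvar E G * ?w G))"
    unfolding below_def set using finAB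
    by (subst prod.insert) (auto intro!: arg_cong[of _ _ "(*) _"] prod.union_disjoint)
  then have "test_part E = xvar E F * (\<Prod>G\<in>?A. xvar E G * ?w G) * s"
    by (simp add: test_part_def s_def mult_ac)
  then have "R.deg (test_part E) = R.deg (xvar E F * (\<Prod>G\<in>?A. xvar F G * ?w G) * s)"
    using R.deg_prod_restrict[OF F0 FE finAB(1), of ?w s] mem by auto
  then have "R.deg (xvar E F * ((\<Prod>G\<in>?A. xvar F G * ?w G) * s)) \<noteq> 0"
    using nz by (simp add: mult.assoc)
  then obtain H where H: "H \<in> keys ((\<Prod>G\<in>?A. xvar F G * ?w G) * s)" "R.deg (xvar E F * single H 1) \<noteq> 0"
    using R.deg_mult_expand[of "xvar E F" "(\<Prod>G\<in>?A. xvar F G * ?w G) * s"]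
    by (metis (no_types, lifting) mult_zero_right sum.neutral)
  \<comment> \<open>Counts labels inside \<open>F\<close>. A flat \<open>G\<close> strictly inside
    \<open>F\<close> contributes \<open>count m G\<close>, since its \<open>x_G\<close> has been
    restricted to \<open>F\<close>; \<open>h_F\<close> contributes \<open>count m F - 1\<close>, and
    every factor above \<open>F\<close> contributes nothing.\<close>
  define Q where "Q n H \<longleftrightarrow> size {#S \<in># H. S \<subseteq> F#} = n" for n :: nat and H :: "'a set multiset"
  have add: "Q a K \<Longrightarrow> Q b L \<Longrightarrow> Q (a + b) (K + L)" for a b K L by (auto simp: Q_def)
  have Q0: "Q 0 0" by (simp add: Q_def)
  have prodQ: "Q (a + b) H" if "\<And>k. k \<in> keys p \<Longrightarrow> Q a k" "\<And>k. k \<in> keys q \<Longrightarrow> Q b k" "H \<in> keys (p * q)" for p q a b H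
    by (rule keys_mult_all[OF _ _ _ that(3), where A = "Q a" and B = "Q b"]) (use that add in auto)
  have pw: "Q (e * of_bool (G \<subseteq> F)) H" if "H \<in> keys (hvar G ^ e)" for G H e
    by (rule keys_power_all[where Q = Q, OF _ Q0 add that]) (auto simp: Q_def dest!: keys_hvar)
  have QA: "Q (\<Sum>G\<in>?A. count m G) H" if "H \<in> keys (\<Prod>G\<in>?A. xvar F G * ?w G)" for H
  proof (rule keys_prod_all[where Q = Q, OF finAB(1) _ Q0 add that])
    fix G K assume G: "G \<in> ?A" "K \<in> keys (xvar F G * ?w G)"
    have "Q (1 + (count m G - 1) * of_bool (G \<subseteq> F)) K"
      by (rule prodQ[OF _ pw G(2)]) (auto elim!: keys_xvar simp: Q_def)
    moreover have "0 < count m G" using G by simp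
    ultimately show "Q (count m G) K" using G by auto
  qed
  have QB: "Q (\<Sum>G\<in>?B. 0) H" if "H \<in> keys (\<Prod>G\<in>?B. xvar E G * ?w G)" for H
  proof (rule keys_prod_all[where Q = Q, OF finAB(2) _ Q0 add that])
    fix G K assume G: "G \<in> ?B" "K \<in> keys (xvar E G * ?w G)"
    have "Q (0 + (count m G - 1) * of_bool (G \<subseteq> F)) K"
    proof (rule prodQ[OF _ pw G(2)])
      fix L assume "L \<in> keys (xvar E G)"
      then obtain S where "L = {#S#}" "G \<subseteq> S" by (rule keys_xvar)
      moreover have "\<not> G \<subseteq> F" using G by blast
      ultimately show "Q 0 L" by (auto simp: Q_def)
    qed
    moreover have "\<not> G \<subseteq> F" using G by blast
    ultimately show "Q 0 K" by simp
  qed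
  have Qs: "Q ((count m F - 1) * of_bool (F \<subseteq> F) + (\<Sum>G\<in>?B. 0) + count m E * of_bool (E \<subseteq> F)) K" if "K \<in> keys s" for K
    by (rule prodQ[OF _ pw that[unfolded s_def]], rule prodQ[OF pw QB])
  have "Q ((\<Sum>G\<in>?A. count m G) + ((count m F - 1) * of_bool (F \<subseteq> F) + (\<Sum>G\<in>?B. 0) + count m E * of_bool (E \<subseteq> F))) H"
    by (rule prodQ[OF QA Qs H(1)])
  then have szH: "size {#S \<in># H. S \<subseteq> F#} = (\<Sum>G\<in>?A. count m G) + (count m F - 1)"
    using FE by (auto simp: Q_def)
  have "\<rho> F = (\<Sum>G\<in>insert F ?A. count m G)"
  proof -
    have "set_mset {#G \<in># m. G \<subseteq> F#} = insert F ?A" using F by auto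
    then show ?thesis using F(2) unfolding nested_rank_at_def size_multiset_overloaded_eq
      by (auto intro!: sum.cong)
  qed
  also have "\<dots> = count m F + (\<Sum>G\<in>?A. count m G)" using finAB(1) by (subst sum.insert) auto
  finally have \<rho>F: "\<rho> F = size {#S \<in># H. S \<subseteq> F#} + 1" using szH F by simp
  have "R.hall H" "R.block H F" using H(2) unfolding R.deg_xvar[OF F0 FE] by auto
  then have "R.tight 1 H F" by (simp add: R.block_def)
  then obtain J where J: "J \<subseteq># H" "r (F \<union> \<Union> (set_mset J)) \<le> size J + 1"
    unfolding R.tight_def by blast
  have JE: "\<Union> (set_mset J) \<subseteq> E" using R.hallD_subset[OF \<open>R.hall H\<close> J(1)] .
  have "F \<union> \<Union> (set_mset J) \<union> \<Union> (set_mset J) = F \<union> \<Union> (set_mset J)" by blast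
  then have "R.tight 1 H (F \<union> \<Union> (set_mset J))"
    unfolding R.tight_def using J by (intro exI[of _ J]) simp
  moreover have "F \<union> \<Union> (set_mset J) \<subseteq> E" using JE FE by blast
  moreover have "\<forall>X. F \<subset> X \<and> X \<subseteq> E \<longrightarrow> \<not> R.tight 1 H X"
    using \<open>R.block H F\<close> unfolding R.block_def by blast
  ultimately have "\<not> F \<subset> F \<union> \<Union> (set_mset J)" by blast
  then have JF: "\<Union> (set_mset J) \<subseteq> F" by blast
  then have "{#S \<in># J. S \<subseteq> F#} = J" by (auto simp: filter_mset_eq_conv)
  then have "J \<subseteq># {#S \<in># H. S \<subseteq> F#}" using J(1) by (metis multiset_filter_mono)
  then have "size J \<le> size {#S \<in># H. S \<subseteq> F#}" by (rule size_mset_mono)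
  moreover have "F \<union> \<Union> (set_mset J) = F" using JF by blast
  ultimately show ?thesis using J(2) \<rho>F by simp
qed

end

section \<open>Hilbert functions and linear algebra\<close>

context fy_data begin

text \<open>No element of \<open>F\<close> is a coloop of \<open>F\<close>: the spare unit of
  \<open>\<rho>_c\<close> below \<open>E\<close> pays for the removal of \<open>e\<close>.\<close>

lemma rk_remove:
  assumes "F \<in># m" "F \<noteq> E" "e \<in> F"
  shows "\<rho> F \<le> rk (F - {e})"
proof (rule le_rkI)
  fix G assume G: "G \<in> C"
  have F: "F \<in> C" using assms by (simp add: nested_chain_def)
  show "\<rho> F \<le> \<rho> G + card (F - {e} - G)"
  proof (cases "F \<subseteq> G")
    case True
    then show ?thesis using \<rho>_strict[OF G F] by (cases "F = G") (auto simp: psubset_eq)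
  next
    case False
    then have GF: "G \<subset> F" using C_chain G F by blast
    have "card (F - G) - 1 \<le> card (F - G - {e})" using diff_card_le_card_Diff[of "{e}" "F - G"] by simp
    moreover have "F - {e} - G = F - G - {e}" by auto
    ultimately show ?thesis
      using \<rho>_c[OF F G GF] c_diff[OF F G psubset_imp_subset[OF GF]] assms(2) by simp
  qed
qed

text \<open>Let \<open>G\<close> in the chain of \<open>m'\<close> attain the rank of
  \<open>F\<close>. An element of \<open>F - G\<close> would be a coloop of \<open>F\<close>,
  against \<open>rk_remove\<close>; so \<open>F \<subseteq> G\<close>, the ranks agree, and
  \<open>F = G\<close> because \<open>F\<close> is a flat.\<close>

lemma mem_of_rank_eq:
  assumes "fy_data E k m' j" and eq: "\<And>S. S \<subseteq> E \<Longrightarrow> nested_rank E m' S = rk S"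
    and F: "F \<in># m" "F \<noteq> E"
  shows "F \<in># m'"
proof -
  interpret B: fy_data E k m' j by fact
  have FC: "F \<in> C" using F by (simp add: nested_chain_def)
  have FE: "F \<subseteq> E" using mem F by blast
  obtain G where G: "G \<in> B.C" "B.rk F = B.\<rho> G + card (F - G)" by (rule B.rk_attained)
  have "F \<subseteq> G"
  proof
    fix e assume e: "e \<in> F"
    show "e \<in> G"
    proof (rule ccontr)
      assume "e \<notin> G"
      then have "F - {e} - G \<subset> F - G" using e by auto
      then have "card (F - {e} - G) < card (F - G)"
        using FE finite_E finite_subset by (intro psubset_card_mono) blast+
      then have "B.rk (F - {e}) < B.rk F" using B.rk_le[OF G(1), of "F - {e}"] G(2) by linarith
      then have "rk (F - {e}) < rk F" using eq[of F] eq[of "F - {e}"] FE by (simp add: Diff_subset[THEN subset_trans])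
      then show False using rk_remove[OF F e] rk_chain[OF FC] by simp
    qed
  qed
  then have "B.rk F = B.\<rho> G" using G(2) by (metis Diff_eq_empty_iff add.right_neutral card.empty)
  then have "rk F = rk G" using B.rk_chain[OF G(1)] eq FE B.C_sub[OF G(1)] by simp
  then have "\<not> F \<subset> G" using rk_above_chain[OF FC, of G] rk_chain[OF FC] B.C_sub[OF G(1)] by auto
  then have "F = G" using \<open>F \<subseteq> G\<close> by blast
  then show ?thesis using G(1) F mem by (auto simp: nested_chain_def)
qed

text \<open>Once the chains agree, the multiplicities are the rank jumps between consecutive
  members, up to the extra unit at \<open>E\<close>.\<close>

lemma eq_of_rank_eq:
  assumes "fy_data E k m' j" and eq: "\<And>S. S \<subseteq> E \<Longrightarrow> nested_rank E m' S = rk S"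
  shows "m' = m"
proof -
  interpret B: fy_data E k m' j by fact
  have "F \<in># m \<longleftrightarrow> F \<in># m'" if "F \<noteq> E" for F
    using mem_of_rank_eq[OF assms, of F] B.mem_of_rank_eq[OF fy_data_axioms, of F] eq that by auto
  then have CC: "B.C = C" unfolding nested_chain_def by blast
  have \<rho>: "B.\<rho> F = \<rho> F" if "F \<in> C" for F
    using rk_chain[OF that] B.rk_chain[of F] eq[of F] C_sub[OF that] that CC by simp
  show ?thesis
  proof (rule multiset_eqI)
    fix F
    show "count m' F = count m F"
    proof (cases "F \<in> C \<and> F \<noteq> {}")
      case True
      obtain G where G: "G \<in> C" "G \<subset> F" "\<And>H. H \<in> C \<Longrightarrow> H \<subset> F \<Longrightarrow> H \<subseteq> G"
        "\<rho> F = \<rho> G + count m F + of_bool (F = E)"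
        using pred[of F] True by blast
      obtain G' where G': "G' \<in> C" "G' \<subset> F" "\<And>H. H \<in> C \<Longrightarrow> H \<subset> F \<Longrightarrow> H \<subseteq> G'"
        "B.\<rho> F = B.\<rho> G' + count m' F + of_bool (F = E)"
        using B.pred[of F] True CC by metis
      have "G = G'" using G(3)[of G'] G'(3)[of G] G(1,2) G'(1,2) by blast
      then show ?thesis using G(4) G'(4) \<rho> True G(1) by simp
    next
      case False
      then have "F \<notin># m" "F \<notin># m'" using mem(1) B.mem(1) CC by (auto simp: nested_chain_def)
      then show ?thesis by (simp add: not_in_iff)
    qed
  qed
qed

text \<open>\<open>deg_test_part_nonzero\<close> gives the inequality on the chain of
  \<open>m\<close>; it spreads to \<open>S\<close> from the \<open>F\<close> that attains
  \<open>rk S\<close>, because the other rank grows by at most \<open>card (S - F)\<close>.\<close>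

lemma rank_le_of_deg:
  assumes "fy_data E k m' j" "ranked_ground.deg E (nested_rank E m') (test_part E) \<noteq> 0"
  shows "nested_rank E m' S \<le> rk S"
proof -
  interpret B: fy_data E k m' j by fact
  obtain F where F: "F \<in> C" "rk S = \<rho> F + card (S - F)" by (rule rk_attained)
  have le: "B.rk F \<le> \<rho> F"
  proof (cases "F \<in># m \<and> F \<noteq> E")
    case True
    then show ?thesis using deg_test_part_nonzero[OF B.ranked_ground_axioms _ _ assms(2)] by blast
  next
    case False
    then have "F = {} \<or> F = E" using F(1) by (auto simp: nested_chain_def)
    moreover have "{} \<in> B.C" "E \<in> B.C" by (simp_all add: nested_chain_def)
    ultimately show ?thesis using B.rk_chain[of F] B.\<rho>_E B.\<rho>_empty \<rho>_E \<rho>_empty by auto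
  qed
  show ?thesis
  proof (cases "finite S")
    case True
    obtain G where G: "G \<in> B.C" "B.rk F = B.\<rho> G + card (F - G)" by (rule B.rk_attained)
    have "card (S - G) \<le> card ((F - G) \<union> (S - F))"
      using True C_finite_mem[OF F(1)] by (intro card_mono) auto
    also have "\<dots> \<le> card (F - G) + card (S - F)" by (rule card_Un_le)
    finally show ?thesis using B.rk_le[OF G(1), of S] G(2) le F(2) by linarith
  next
    case False
    \<comment> \<open>An infinite \<open>S\<close> has \<open>card S = 0\<close>, so the term of the
      empty chain member is 0.\<close>
    then have "B.rk S \<le> 0" using B.rk_le[of "{}" S] B.\<rho>_empty by (simp add: nested_chain_def)
    then show ?thesis by simp
  qed
qed

text \<open>The sum of all ranks is a numerical weight that is strictly monotone for the pointwise
  order; equal rank functions force \<open>m' = m\<close>.\<close>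

lemma triangular:
  assumes "fy_data E k m' j" "ranked_ground.deg E (nested_rank E m') (test_part E) \<noteq> 0"
  shows "m' = m \<or> (\<Sum>S\<in>Pow E. nested_rank E m' S) < (\<Sum>S\<in>Pow E. rk S)"
proof (cases "\<forall>S\<in>Pow E. nested_rank E m' S = rk S")
  case True
  then show ?thesis using eq_of_rank_eq[OF assms(1)] by blast
next
  case False
  then have "(\<Sum>S\<in>Pow E. nested_rank E m' S) < (\<Sum>S\<in>Pow E. rk S)"
    using rank_le_of_deg[OF assms] finite_E
    by (intro sum_strict_mono_ex1) (auto simp: less_le)
  then show ?thesis ..
qed

lemma deg_xvar_large:
  assumes "G \<subset> E" "k \<le> card G" "G \<noteq> {}"
  shows "deg (xvar E G * s) = 0"
  using deg_xvar_full_rank[OF assms(1) _ assms(3)] rk_large[of G] rk_large[of E] assms k_le by simp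

end

section \<open>Hilbert functions as codimensions, and their bounds from linear algebra\<close>

interpretation Q: vector_space qscale
  by unfold_locales (auto simp: qscale_def algebra_simps)

definition monomials :: "'v set \<Rightarrow> nat \<Rightarrow> 'v multiset set" where
  "monomials V j = {m. set_mset m \<subseteq> V \<and> size m = j}"

definition forms :: "'v set \<Rightarrow> nat \<Rightarrow> 'v qpoly set" where
  "forms V j = {p. \<forall>m. p m \<noteq> 0 \<longrightarrow> m \<in> monomials V j}"

lemma finite_monomials: "finite V \<Longrightarrow> finite (monomials V j)"
proof (induction j)
  case (Suc j)
  have "monomials V (Suc j) \<subseteq> (\<lambda>(v, m). add_mset v m) ` (V \<times> monomials V j)"
  proof
    fix m assume m: "m \<in> monomials V (Suc j)"
    then obtain v m' where "m = add_mset v m'" by (metis (mono_tags, lifting) mem_Collect_eq monomials_def size_eq_Suc_imp_eq_union)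
    moreover from this m have "(v, m') \<in> V \<times> monomials V j" by (simp add: monomials_def)
    ultimately show "m \<in> (\<lambda>(v, m). add_mset v m) ` (V \<times> monomials V j)" by force
  qed
  then show ?case by (rule finite_subset) (use Suc in simp)
qed (simp add: monomials_def)

lemma sum_fun_apply: "(\<Sum>x\<in>A. f x) u = (\<Sum>x\<in>A. f x u)"
  by (induction A rule: infinite_finite_induct) simp_all

lemma subspace_support: "Q.subspace {p. \<forall>m. p m \<noteq> 0 \<longrightarrow> P m}"
proof (rule Q.subspaceI)
  fix p q :: "'a qpoly"
  assume p: "p \<in> {p. \<forall>m. p m \<noteq> 0 \<longrightarrow> P m}" and q: "q \<in> {p. \<forall>m. p m \<noteq> 0 \<longrightarrow> P m}"
  have "P m" if "p m + q m \<noteq> 0" for m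
    using p q that by (cases "p m = 0") auto
  then show "p + q \<in> {p. \<forall>m. p m \<noteq> 0 \<longrightarrow> P m}" by simp
qed (auto simp: qscale_def)

lemma subspace_forms: "Q.subspace (forms V j)"
  unfolding forms_def by (rule subspace_support)

lemma forms_eq_span:
  assumes "finite V"
  shows "forms V j = Q.span (pmono ` monomials V j)"
proof
  show "Q.span (pmono ` monomials V j) \<subseteq> forms V j"
    by (rule Q.span_minimal[OF _ subspace_forms]) (auto simp: forms_def pmono_def split: if_splits)
  show "forms V j \<subseteq> Q.span (pmono ` monomials V j)"
  proof
    fix p assume p: "p \<in> forms V j"
    have "p = (\<Sum>m\<in>monomials V j. qscale (p m) (pmono m))"
    proof
      fix u
      have "(\<Sum>m\<in>monomials V j. qscale (p m) (pmono m)) u = (\<Sum>m\<in>monomials V j. if u = m then p m else 0)"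
        by (auto simp: sum_fun_apply qscale_def pmono_def fun_eq_iff intro!: sum.cong)
      also have "\<dots> = p u" using finite_monomials[OF assms] p by (auto simp: forms_def)
      finally show "p u = (\<Sum>m\<in>monomials V j. qscale (p m) (pmono m)) u" by simp
    qed
    moreover have "(\<Sum>m\<in>monomials V j. qscale (p m) (pmono m)) \<in> Q.span (pmono ` monomials V j)"
      by (intro Q.span_sum Q.span_scale Q.span_base) auto
    ultimately show "p \<in> Q.span (pmono ` monomials V j)" by simp
  qed
qed

lemma inj_pmono: "inj pmono"
  unfolding inj_def pmono_def by (metis zero_neq_one)

lemma independent_pmono: "Q.independent (pmono ` A)"
  unfolding Q.dependent_explicit
proof safe
  fix T :: "'a qpoly set" and u v
  assume T: "finite T" "T \<subseteq> pmono ` A" and sum0: "(\<Sum>v\<in>T. qscale (u v) v) = 0" and v: "v \<in> T" "u v \<noteq> 0"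
  obtain a where a: "v = pmono a" using T v by auto
  have "0 = (\<Sum>v\<in>T. qscale (u v) v) a" using sum0 by simp
  also have "\<dots> = (\<Sum>w\<in>T. if w = v then u v else 0)"
    unfolding sum_fun_apply
  proof (rule sum.cong[OF refl])
    fix w assume "w \<in> T"
    then obtain b where "w = pmono b" using T by auto
    then show "qscale (u w) w a = (if w = v then u v else 0)"
      using a inj_eq[OF inj_pmono, of b a] by (cases "b = a") (auto simp: qscale_def pmono_def)
  qed
  also have "\<dots> = u v" using T v by simp
  finally show False using v by simp
qed


definition ideal_part :: "'v set \<Rightarrow> 'v qpoly set \<Rightarrow> nat \<Rightarrow> 'v qpoly set" where
  "ideal_part V G j = {p \<in> gen_ideal V G. \<forall>m. p m \<noteq> 0 \<longrightarrow> size m = j}"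

lemma hilb_coeff_eq: "hilb_coeff V G j = card (monomials V j) - Q.dim (ideal_part V G j)"
  by (simp add: hilb_coeff_def monomials_def ideal_part_def)

definition polys :: "'v set \<Rightarrow> 'v qpoly set" where
  "polys V = {p. \<forall>m. p m \<noteq> 0 \<longrightarrow> set_mset m \<subseteq> V}"

lemma subspace_polys: "Q.subspace (polys V)"
  unfolding polys_def by (rule subspace_support)

lemma gen_ideal_polys:
  assumes "G \<subseteq> polys V" shows "gen_ideal V G \<subseteq> polys V"
  unfolding gen_ideal_def
proof (rule Q.span_minimal[OF _ subspace_polys], safe)
  fix u g assume u: "set_mset u \<subseteq> V" and g: "g \<in> G"
  show "mono_mult u g \<in> polys V"
    unfolding polys_def
  proof (safe, rule ccontr)
    fix m x assume m: "mono_mult u g m \<noteq> 0" and x: "x \<in># m" "x \<notin> V"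
    then have "u \<subseteq># m" "g (m - u) \<noteq> 0" by (auto simp: mono_mult_def split: if_splits)
    then have "set_mset (m - u) \<subseteq> V" using assms g by (auto simp: polys_def)
    moreover have "m = u + (m - u)" using \<open>u \<subseteq># m\<close> by simp
    ultimately show False using u x by (metis UnE set_mset_union subsetD)
  qed
qed

lemma ideal_part_forms: "G \<subseteq> polys V \<Longrightarrow> ideal_part V G j \<subseteq> forms V j"
  using gen_ideal_polys[of G V] by (force simp: ideal_part_def forms_def polys_def monomials_def)

text \<open>Functionals that vanish on the ideal and are triangular on the forms \<open>q i\<close>
  keep these independent modulo the ideal. A basis of the ideal part together with the
  \<open>q i\<close> is then independent among the forms, which gives a sum bound and so controls
  the truncated subtraction in \<open>hilb_coeff\<close>.\<close>

lemma hilb_coeff_ge: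
  fixes V :: "'v set" and j :: nat and D :: "'i \<Rightarrow> 'v multiset \<Rightarrow> rat" and w :: "'i \<Rightarrow> nat"
  defines "L \<equiv> \<lambda>i p. \<Sum>m\<in>monomials V j. p m * D i m"
  assumes V: "finite V" and G: "G \<subseteq> polys V" and I: "finite I"
    and kill: "\<And>i u g. i \<in> I \<Longrightarrow> set_mset u \<subseteq> V \<Longrightarrow> g \<in> G \<Longrightarrow> L i (mono_mult u g) = 0"
    and q: "\<And>i. i \<in> I \<Longrightarrow> q i \<in> forms V j"
    and diag: "\<And>i. i \<in> I \<Longrightarrow> L i (q i) \<noteq> 0"
    and tri: "\<And>i i'. i \<in> I \<Longrightarrow> i' \<in> I \<Longrightarrow> L i' (q i) \<noteq> 0 \<Longrightarrow> i' = i \<or> w i' < w i"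
  shows "card I \<le> hilb_coeff V G j"
proof -
  have L_add: "L i (p + p') = L i p + L i p'" for i p p'
    by (simp add: L_def distrib_right sum.distrib)
  have L_scale: "L i (qscale a p) = a * L i p" for i a p
    by (simp add: L_def qscale_def sum_distrib_left mult.assoc)
  have L_sum: "L i (\<Sum>x\<in>A. f x) = (\<Sum>x\<in>A. L i (f x))" for i f A
  proof (induction A rule: infinite_finite_induct)
    case (insert x A)
    show ?case by (simp only: sum.insert[OF insert.hyps] L_add insert.IH)
  qed (simp_all add: L_def)
  have sub: "Q.subspace {p. L i p = 0}" for i
    unfolding Q.subspace_def by (auto simp: L_add L_scale) (simp add: L_def)
  have L_ideal: "L i p = 0" if "p \<in> gen_ideal V G" "i \<in> I" for i p
  proof -
    have "gen_ideal V G \<subseteq> {p. L i p = 0}"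
      unfolding gen_ideal_def by (rule Q.span_minimal[OF _ sub]) (use kill that in auto)
    then show ?thesis using that by blast
  qed
  obtain B where B: "B \<subseteq> ideal_part V G j" "Q.independent B" "ideal_part V G j \<subseteq> Q.span B"
    "card B = Q.dim (ideal_part V G j)"
    using Q.basis_exists by blast
  have Bf: "B \<subseteq> forms V j" using B(1) ideal_part_forms[OF G] by blast
  have finB: "finite B"
  proof (rule Q.independent_span_bound[THEN conjunct1])
    show "finite (pmono ` monomials V j)" using V finite_monomials by blast
    show "B \<subseteq> Q.span (pmono ` monomials V j)" using Bf forms_eq_span[OF V] by blast
  qed (rule B)
  \<comment> \<open>The functional of an index of maximal weight among the nonzero coefficients sees
    only its diagonal term.\<close>
  have comb0: "a i = 0" if "(\<Sum>i\<in>I. qscale (a i) (q i)) \<in> gen_ideal V G" "i \<in> I" for a i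
  proof (rule ccontr)
    assume "a i \<noteq> 0"
    let ?S = "{i \<in> I. a i \<noteq> 0}"
    have "i \<in> ?S" "finite ?S" using that I \<open>a i \<noteq> 0\<close> by auto
    then have "Max (w ` ?S) \<in> w ` ?S" by (intro Max_in) auto
    then obtain i0 where "i0 \<in> ?S" "w i0 = Max (w ` ?S)" by auto
    then have i0: "i0 \<in> I" "a i0 \<noteq> 0" "\<And>i. i \<in> I \<Longrightarrow> a i \<noteq> 0 \<Longrightarrow> w i \<le> w i0"
      using \<open>finite ?S\<close> by auto
    have "0 = L i0 (\<Sum>i\<in>I. qscale (a i) (q i))" using L_ideal that(1) i0 by simp
    also have "\<dots> = (\<Sum>i\<in>I. if i = i0 then a i * L i0 (q i) else 0)"
      unfolding L_sum L_scale
    proof (rule sum.cong[OF refl])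
      fix i assume "i \<in> I"
      then show "a i * L i0 (q i) = (if i = i0 then a i * L i0 (q i) else 0)"
      proof (cases "i = i0 \<or> a i = 0 \<or> L i0 (q i) = 0")
        case False
        then have "w i0 < w i" using tri[of i i0] \<open>i \<in> I\<close> i0(1) by auto
        then show ?thesis using i0(3)[of i] \<open>i \<in> I\<close> False by simp
      qed auto
    qed
    also have "\<dots> = a i0 * L i0 (q i0)" using I i0 by simp
    finally show False using i0 diag by simp
  qed
  have injq: "inj_on q I"
  proof (rule inj_onI, rule ccontr)
    fix i i' assume i: "i \<in> I" "i' \<in> I" "q i = q i'" "i \<noteq> i'"
    define a where "a x = (if x = i then 1 else if x = i' then -1 else 0 :: rat)" for x
    have "(\<Sum>x\<in>I. qscale (a x) (q x)) = (\<Sum>x\<in>{i, i'}. qscale (a x) (q x))"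
      using i I by (intro sum.mono_neutral_right) (auto simp: a_def qscale_def)
    also have "\<dots> = 0" using i by (auto simp: a_def qscale_def)
    finally have "(\<Sum>x\<in>I. qscale (a x) (q x)) = 0" .
    moreover have "0 \<in> gen_ideal V G" unfolding gen_ideal_def by (rule Q.span_zero)
    ultimately have "a i = 0" using comb0[of a i] i by simp
    then show False by (simp add: a_def)
  qed
  have disj: "B \<inter> q ` I = {}"
  proof (rule ccontr)
    assume "B \<inter> q ` I \<noteq> {}"
    then obtain i where i: "i \<in> I" "q i \<in> B" by blast
    then have "L i (q i) = 0" using L_ideal B(1) by (auto simp: ideal_part_def)
    then show False using diag i by blast
  qed
  have "Q.independent (B \<union> q ` I)"
    unfolding Q.independent_explicit_finite_subsets
  proof safe
    fix A u v assume A: "A \<subseteq> B \<union> q ` I" "finite A" "(\<Sum>v\<in>A. qscale (u v) v) = 0" "v \<in> A"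
    define u' where "u' v = (if v \<in> A then u v else 0)" for v
    have "(\<Sum>v\<in>B \<union> q ` I. qscale (u' v) v) = (\<Sum>v\<in>A. qscale (u v) v)"
      using A I finB by (intro sum.mono_neutral_cong_right) (auto simp: u'_def qscale_def)
    then have "(\<Sum>v\<in>B. qscale (u' v) v) + (\<Sum>v\<in>q ` I. qscale (u' v) v) = 0"
      using A(3) finB I disj by (simp add: sum.union_disjoint)
    then have sum0: "(\<Sum>v\<in>B. qscale (u' v) v) + (\<Sum>i\<in>I. qscale (u' (q i)) (q i)) = 0"
      using injq by (simp add: sum.reindex)
    have "(\<Sum>v\<in>B. qscale (- u' v) v) \<in> gen_ideal V G"
      using B(1) unfolding gen_ideal_def
      by (intro Q.span_sum Q.span_scale) (auto simp: ideal_part_def gen_ideal_def)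
    moreover have "(\<Sum>i\<in>I. qscale (u' (q i)) (q i)) = (\<Sum>v\<in>B. qscale (- u' v) v)"
      using sum0 by (simp add: Q.scale_minus_left sum_negf add_eq_0_iff)
    ultimately have q0: "u' (q i) = 0" if "i \<in> I" for i using comb0[of "\<lambda>i. u' (q i)"] that by simp
    then have "(\<Sum>v\<in>B. qscale (u' v) v) = 0" using sum0 by simp
    then have "u' v = 0" if "v \<in> B" for v
      using B(2) finB that unfolding Q.independent_explicit_finite_subsets by blast
    then have "u' v = 0" using A q0 by blast
    then show "u v = 0" using A(4) by (simp add: u'_def)
  qed
  moreover have "B \<union> q ` I \<subseteq> Q.span (pmono ` monomials V j)"
    using Bf q forms_eq_span[OF V] by blast
  ultimately have "card (B \<union> q ` I) \<le> card (pmono ` monomials V j)"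
    using Q.independent_span_bound[of "pmono ` monomials V j"] V finite_monomials by blast
  also have "\<dots> = card (monomials V j)" by (simp add: card_image inj_on_subset[OF inj_pmono])
  finally have "card B + card I \<le> card (monomials V j)"
    using disj finB I injq by (simp add: card_Un_disjoint card_image)
  then show ?thesis using B(4) by (simp add: hilb_coeff_eq)
qed

text \<open>A basis of the ideal part together with \<open>B\<close> spans all forms of degree
  \<open>j\<close>.\<close>

lemma hilb_coeff_le:
  assumes V: "finite V" and G: "G \<subseteq> polys V" and B: "finite B" "B \<subseteq> forms V j"
    and red: "\<And>m. m \<in> monomials V j \<Longrightarrow> \<exists>b\<in>Q.span B. pmono m - b \<in> gen_ideal V G"
  shows "hilb_coeff V G j \<le> card B"
proof -
  obtain A where A: "A \<subseteq> ideal_part V G j" "Q.independent A" "ideal_part V G j \<subseteq> Q.span A"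
    "card A = Q.dim (ideal_part V G j)"
    using Q.basis_exists by blast
  have Af: "A \<subseteq> forms V j" using A(1) ideal_part_forms[OF G] by blast
  have finA: "finite A"
  proof (rule Q.independent_span_bound[THEN conjunct1])
    show "finite (pmono ` monomials V j)" using V finite_monomials by blast
    show "A \<subseteq> Q.span (pmono ` monomials V j)" using Af forms_eq_span[OF V] by blast
  qed (rule A)
  have "pmono ` monomials V j \<subseteq> Q.span (A \<union> B)"
  proof safe
    fix m assume m: "m \<in> monomials V j"
    then obtain b where b: "b \<in> Q.span B" "pmono m - b \<in> gen_ideal V G" using red by blast
    have "Q.span B \<subseteq> forms V j" by (rule Q.span_minimal[OF B(2) subspace_forms])
    then have "b \<in> forms V j" using b by blast
    moreover have "pmono m \<in> forms V j" using m by (auto simp: forms_def pmono_def split: if_splits)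
    ultimately have "pmono m - b \<in> forms V j" using Q.subspace_diff[OF subspace_forms] by blast
    then have "pmono m - b \<in> ideal_part V G j" using b by (auto simp: ideal_part_def forms_def monomials_def)
    then have "pmono m - b \<in> Q.span (A \<union> B)" using A(3) Q.span_mono[of A "A \<union> B"] by blast
    moreover have "b \<in> Q.span (A \<union> B)" using b Q.span_mono[of B "A \<union> B"] by blast
    ultimately have "(pmono m - b) + b \<in> Q.span (A \<union> B)" by (rule Q.span_add)
    then show "pmono m \<in> Q.span (A \<union> B)" by simp
  qed
  then have "card (pmono ` monomials V j) \<le> card (A \<union> B)"
    using Q.independent_span_bound[OF _ independent_pmono, of "A \<union> B" "monomials V j"] finA B(1) by simp
  also have "\<dots> \<le> card A + card B" by (rule card_Un_le)
  finally have "card (monomials V j) \<le> card A + card B"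
    by (simp add: card_image inj_on_subset[OF inj_pmono])
  then show ?thesis using A(4) by (simp add: hilb_coeff_eq)
qed

section \<open>Pulling test elements back to the variables of a presentation\<close>

lemma lin_ext_mult_single:
  "lin_ext \<psi> (a * single k 1) = lin_ext (\<lambda>l. \<psi> (l + k)) (a :: 'k::comm_monoid_add \<Rightarrow>\<^sub>0 rat)"
proof -
  have "a * single k 1 = (\<Sum>l\<in>keys a. single (l + k) (lookup a l))"
    by (subst (1) poly_mapping_expand[of a]) (simp add: sum_distrib_right mult_single)
  then show ?thesis by (simp only: lin_ext_sum lin_ext_single lin_ext_def[of _ a])
qed

text \<open>\<open>p\<close> acts under all functionals \<open>d i\<close> like the \<open>\<phi>\<close>-image of a form of degree \<open>n\<close> in the variables \<open>V\<close>.\<close>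

definition representable ::
    "('i \<Rightarrow> 'r::comm_ring_1 \<Rightarrow> rat) \<Rightarrow> ('v \<Rightarrow> 'r) \<Rightarrow> 'v set \<Rightarrow> 'i set \<Rightarrow> nat \<Rightarrow> 'r \<Rightarrow> bool" where
  "representable d \<phi> V I n p \<longleftrightarrow> (\<exists>q. keys q \<subseteq> monomials V n \<and>
     (\<forall>i\<in>I. \<forall>s. d i (p * s) = lin_ext (\<lambda>u. d i ((\<Prod>v\<in>#u. \<phi> v) * s)) q))"

lemma representable_one: "representable d \<phi> V I 0 1"
  unfolding representable_def
  by (intro exI[of _ "single {#} 1"]) (simp add: monomials_def lin_ext_def)

lemma representable_sum:
  assumes "finite A" "A \<subseteq> V" "\<And>i s. i \<in> I \<Longrightarrow> d i (p * s) = (\<Sum>v\<in>A. d i (\<phi> v * s))"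
  shows "representable d \<phi> V I (Suc 0) p"
  unfolding representable_def
proof (intro exI conjI ballI allI)
  let ?q = "\<Sum>v\<in>A. single {#v#} (1::rat)"
  show "keys ?q \<subseteq> monomials V (Suc 0)"
  proof
    fix u assume "u \<in> keys ?q"
    then have "u \<in> (\<Union>v\<in>A. keys (single {#v#} (1::rat)))"
      using keys_sum[of "\<lambda>v. single {#v#} (1::rat)" A] by blast
    then show "u \<in> monomials V (Suc 0)" using assms(2) by (auto simp: monomials_def)
  qed
  show "d i (p * s) = lin_ext (\<lambda>u. d i ((\<Prod>v\<in>#u. \<phi> v) * s)) ?q" if "i \<in> I" for i s
    using assms(3)[OF that] by (simp add: lin_ext_sum)
qed

text \<open>Since \<open>representable\<close> quantifies over all cofactors \<open>s\<close>, one
  factor can be absorbed into the cofactor of the other. One form serves all functionals at once, as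
  is required of a \<open>q i\<close> in \<open>hilb_coeff_ge\<close>.\<close>

lemma representable_mult:
  assumes "representable d \<phi> V I a p" "representable d \<phi> V I b p'"
  shows "representable d \<phi> V I (a + b) (p * p')"
proof -
  obtain q where q: "keys q \<subseteq> monomials V a"
    "\<And>i s. i \<in> I \<Longrightarrow> d i (p * s) = lin_ext (\<lambda>u. d i ((\<Prod>v\<in>#u. \<phi> v) * s)) q"
    using assms(1) unfolding representable_def by blast
  obtain q' where q': "keys q' \<subseteq> monomials V b"
    "\<And>i s. i \<in> I \<Longrightarrow> d i (p' * s) = lin_ext (\<lambda>u. d i ((\<Prod>v\<in>#u. \<phi> v) * s)) q'"
    using assms(2) unfolding representable_def by blast
  show ?thesis unfolding representable_def
  proof (intro exI conjI ballI allI)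
    show "keys (q * q') \<subseteq> monomials V (a + b)"
    proof
      fix k assume "k \<in> keys (q * q')"
      then show "k \<in> monomials V (a + b)"
        by (rule keys_mult_all[rotated 3, where A = "\<lambda>k. k \<in> monomials V a" and B = "\<lambda>k. k \<in> monomials V b"])
           (use q(1) q'(1) in \<open>auto simp: monomials_def\<close>)
    qed
    fix i s assume i: "i \<in> I"
    have "lin_ext (\<lambda>u. d i ((\<Prod>v\<in>#u. \<phi> v) * s)) (q * q')
        = (\<Sum>k\<in>keys q'. lookup q' k * lin_ext (\<lambda>u. d i ((\<Prod>v\<in>#u. \<phi> v) * s)) (q * single k 1))"
      by (rule lin_ext_mult_expand)
    also have "\<dots> = (\<Sum>k\<in>keys q'. lookup q' k * d i ((\<Prod>v\<in>#k. \<phi> v) * (p * s)))"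
    proof (intro sum.cong refl arg_cong[of _ _ "(*) _"])
      fix k
      have "lin_ext (\<lambda>u. d i ((\<Prod>v\<in>#u. \<phi> v) * s)) (q * single k 1)
          = lin_ext (\<lambda>u. d i ((\<Prod>v\<in>#u. \<phi> v) * ((\<Prod>v\<in>#k. \<phi> v) * s))) q"
        by (simp add: lin_ext_mult_single mult.assoc)
      also have "\<dots> = d i (p * ((\<Prod>v\<in>#k. \<phi> v) * s))" using q(2)[OF i] by simp
      finally show "lin_ext (\<lambda>u. d i ((\<Prod>v\<in>#u. \<phi> v) * s)) (q * single k 1) = d i ((\<Prod>v\<in>#k. \<phi> v) * (p * s))"
        by (simp add: mult_ac)
    qed
    also have "\<dots> = d i (p' * (p * s))" using q'(2)[OF i] by (simp add: lin_ext_def)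
    finally show "d i (p * p' * s) = lin_ext (\<lambda>u. d i ((\<Prod>v\<in>#u. \<phi> v) * s)) (q * q')"
      by (simp add: mult_ac)
  qed
qed

lemma representable_power:
  assumes "representable d \<phi> V I (Suc 0) p"
  shows "representable d \<phi> V I n (p ^ n)"
proof (induction n)
  case (Suc n)
  then show ?case using representable_mult[OF assms Suc] by simp
qed (simp add: representable_one)

lemma representable_prod:
  assumes "finite A" "\<And>a. a \<in> A \<Longrightarrow> representable d \<phi> V I (n a) (f a)"
  shows "representable d \<phi> V I (\<Sum>a\<in>A. n a) (\<Prod>a\<in>A. f a)"
  using assms by (induction A rule: finite_induct) (simp_all add: representable_one representable_mult)

context fy_data begin

lemma deg_hvar_eq_sum_small:
  assumes "i \<in> S" "S \<subseteq> E"
  shows "deg (hvar S * s) = (\<Sum>G | G \<in> unif_flats E k - {E} \<and> i \<in> G \<and> \<not> S \<subseteq> G. deg (xvar E G * s))"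
  unfolding deg_hvar_eq_sum[OF assms]
proof (rule sum.mono_neutral_right)
  show "finite {G. G \<subset> E \<and> i \<in> G \<and> \<not> S \<subseteq> G}"
    using finite_E by (intro finite_subset[OF _ finite_Pow_iff[THEN iffD2]]) auto
  show "\<forall>G\<in>{G. G \<subset> E \<and> i \<in> G \<and> \<not> S \<subseteq> G} - {G. G \<in> unif_flats E k - {E} \<and> i \<in> G \<and> \<not> S \<subseteq> G}. deg (xvar E G * s) = 0"
    by (auto simp: unif_flats_def not_less intro!: deg_xvar_large)
qed (auto simp: unif_flats_def)

text \<open>Both sums equal the value of \<open>h_{i,i'}\<close>, expanded from \<open>i\<close> and
  from \<open>i'\<close>, plus the common part over the sets that contain both points.\<close>

lemma deg_linear_relation:
  assumes "i \<in> E" "i' \<in> E"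
  shows "(\<Sum>G | G \<in> unif_flats E k - {E} \<and> i \<in> G. deg (xvar E G * s)) = (\<Sum>G | G \<in> unif_flats E k - {E} \<and> i' \<in> G. deg (xvar E G * s))"
proof -
  let ?U = "unif_flats E k - {E}" and ?f = "\<lambda>G. deg (xvar E G * s)"
  have fin: "finite ?U"
    using finite_E by (intro finite_subset[OF _ finite_Pow_iff[THEN iffD2]]) (auto simp: unif_flats_def)
  have *: "(\<Sum>G | G \<in> ?U \<and> a \<in> G. ?f G)
      = deg (hvar {i, i'} * s) + (\<Sum>G | G \<in> ?U \<and> {i, i'} \<subseteq> G. ?f G)" if "a \<in> {i, i'}" for a
  proof -
    have eq: "{G. G \<in> ?U \<and> a \<in> G} = {G. G \<in> ?U \<and> a \<in> G \<and> \<not> {i, i'} \<subseteq> G} \<union> {G. G \<in> ?U \<and> {i, i'} \<subseteq> G}"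
      using that by auto
    show ?thesis unfolding deg_hvar_eq_sum_small[OF that, of s, simplified assms, simplified] eq
      using fin deg_hvar_eq_sum_small[OF that, of s] assms
      by (subst sum.union_disjoint) auto
  qed
  show ?thesis using *[of i] *[of i'] by simp
qed

end

section \<open>The lower bound for uniform matroids\<close>

definition pairing :: "'v set \<Rightarrow> nat \<Rightarrow> ('v multiset \<Rightarrow> rat) \<Rightarrow> 'v qpoly \<Rightarrow> rat" where
  "pairing V j D p = (\<Sum>m\<in>monomials V j. p m * D m)"

lemma pairing_diff: "pairing V j D (p - q) = pairing V j D p - pairing V j D q"
  by (simp add: pairing_def left_diff_distrib sum_subtractf)

lemma pairing_sum: "pairing V j D (\<Sum>x\<in>A. f x) = (\<Sum>x\<in>A. pairing V j D (f x))"
  unfolding pairing_def sum_fun_apply sum_distrib_right by (rule sum.swap)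

lemma pairing_pmono: 
  assumes "finite V" "set_mset m \<subseteq> V"
  shows "pairing V j D (pmono m) = (if size m = j then D m else 0)"
proof -
  have "pairing V j D (pmono m) = (\<Sum>u\<in>monomials V j. if u = m then D m else 0)"
    unfolding pairing_def pmono_def by (intro sum.cong) auto
  then show ?thesis using finite_monomials[OF assms(1)] assms(2) by (simp add: monomials_def)
qed

lemma mono_mult_pmono: "mono_mult u (pmono t) = pmono (u + t)"
  by (auto simp: mono_mult_def pmono_def fun_eq_iff)

lemma mono_mult_diff: "mono_mult u (p - q) = mono_mult u p - mono_mult u q"
  by (auto simp: mono_mult_def fun_eq_iff)

lemma mono_mult_sum: "mono_mult u (\<Sum>x\<in>A. f x) = (\<Sum>x\<in>A. mono_mult u (f x))"
  by (auto simp: mono_mult_def fun_eq_iff sum_fun_apply)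

lemma pvar_pmono: "pvar v = pmono {#v#}"
  by (simp add: pvar_def pmono_def)

lemma finite_fy_mono:
  assumes "finite L" shows "finite (fy_mono L c j)"
  by (rule finite_subset[OF _ finite_monomials[OF assms, of j]]) (auto simp: fy_mono_def monomials_def)

text \<open>\<open>Z = {}\<close> serves the reduced ring, \<open>Z = {z}\<close> the augmented one,
  which has variables only for the sets containing the added point. \<open>\<phi>\<close> interprets
  the variables as polynomials in the \<open>h_S\<close>, and \<open>kill\<close> says that the
  functionals respect the relations.\<close>

theorem unif_hilb_coeff_ge:
  fixes \<phi> :: "'v \<Rightarrow> ('a set multiset \<Rightarrow>\<^sub>0 rat)"
  assumes E: "finite E" "0 < k" "k \<le> card E" and V: "finite V" and G: "G \<subseteq> polys V"
    and Z: "Z = {} \<or> (\<exists>z\<in>E. Z = {z})"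
    and var: "\<And>F. F \<in> unif_flats E k - {E} \<Longrightarrow> Z \<subseteq> F \<Longrightarrow> \<exists>v\<in>V. \<phi> v = xvar E F"
    and kill: "\<And>m u g. fy_data E k m j \<Longrightarrow> set_mset u \<subseteq> V \<Longrightarrow> g \<in> G \<Longrightarrow>
      pairing V j (\<lambda>w. ranked_ground.deg E (nested_rank E m) (\<Prod>v\<in>#w. \<phi> v)) (mono_mult u g) = 0"
  shows "card {m \<in> fy_mono (unif_flats E k) (unif_rank E k) j. \<forall>F\<in>#m. Z \<subseteq> F} \<le> hilb_coeff V G j"
proof -
  define I where "I = {m \<in> fy_mono (unif_flats E k) (unif_rank E k) j. \<forall>F\<in>#m. Z \<subseteq> F}"
  define d where "d m = ranked_ground.deg E (nested_rank E m)" for m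
  have fyd: "fy_data E k m j" if "m \<in> I" for m
    using that E by (simp add: I_def fy_data_def)
  have finU: "finite (unif_flats E k)"
    using E(1) by (intro finite_subset[OF _ finite_Pow_iff[THEN iffD2]]) (auto simp: unif_flats_def)
  have finI: "finite I" unfolding I_def using finite_fy_mono[OF finU] by simp
  have rep_x: "representable d \<phi> V I (Suc 0) (xvar E F)" if F: "F \<in> unif_flats E k - {E}" "Z \<subseteq> F" for F
  proof -
    obtain v where "v \<in> V" "\<phi> v = xvar E F" using var[OF F] by blast
    then show ?thesis by (intro representable_sum[of "{v}"]) auto
  qed
  have rep_h: "representable d \<phi> V I (Suc 0) (hvar S)" if S: "S \<subseteq> E" "S \<noteq> {}" "Z \<subseteq> S" for S
  proof -
    \<comment> \<open>Expanding \<open>h_S\<close> from the point of \<open>Z\<close> yields only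
      sets containing \<open>Z\<close>, for which variables exist.\<close>
    obtain i where i: "i \<in> S" "Z \<subseteq> {i}"
      using S Z by (metis empty_subsetI ex_in_conv insert_subset order_refl)
    define Gs where "Gs = {G. G \<in> unif_flats E k - {E} \<and> i \<in> G \<and> \<not> S \<subseteq> G}"
    have "\<forall>F\<in>Gs. \<exists>v\<in>V. \<phi> v = xvar E F" using var i(2) by (auto simp: Gs_def)
    then obtain f where f: "\<And>F. F \<in> Gs \<Longrightarrow> f F \<in> V \<and> \<phi> (f F) = xvar E F" by metis
    have finG: "finite Gs" using finU by (simp add: Gs_def)
    \<comment> \<open>\<open>representable_sum\<close> runs over a set of variables, so different
      flats must receive different variables. The labels of \<open>xvar E F\<close> have
      \<open>F\<close> as their least element.\<close>
    have xinj: "F = F'" if "xvar E F = xvar E F'" "F \<in> Gs" "F' \<in> Gs" for F F'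
    proof -
      have *: "lookup (xvar E F) {#K#} = (if F \<subseteq> K \<and> K \<subseteq> E then - ((-1) ^ card (K - F)) else 0)" if "F \<in> Gs" for F K
      proof -
        have finF: "finite {F..E}" using E(1) by (intro finite_subset[OF _ finite_Pow_iff[THEN iffD2]]) auto
        have sg: "(-1) ^ n * hvar S = single {#S#} ((-1) ^ n)" for n and S :: "'a set"
          by (induction n) (simp_all add: hvar_def single_uminus)
        have "lookup (xvar E F) {#K#} = - (\<Sum>G\<in>{F..E}. if G = K then (-1) ^ card (G - F) else 0)"
          by (simp add: xvar_def sg lookup_sum lookup_single when_def)
        then show ?thesis using finF by simp
      qed
      have "lookup (xvar E F') {#F#} \<noteq> 0" "lookup (xvar E F) {#F'#} \<noteq> 0"
      proof -
        show "lookup (xvar E F') {#F#} \<noteq> 0"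
          using *[OF that(2), of F] that(1) that(2) by (auto simp: Gs_def unif_flats_def)
        show "lookup (xvar E F) {#F'#} \<noteq> 0"
          using *[OF that(3), of F'] that(1) that(3) by (auto simp: Gs_def unif_flats_def)
      qed
      then show ?thesis using *[OF that(3), of F] *[OF that(2), of F'] by (auto split: if_splits)
    qed
    have inj: "inj_on f Gs"
      by (rule inj_onI) (metis f xinj)
    show ?thesis
    proof (rule representable_sum[of "f ` Gs"])
      fix m s assume m: "m \<in> I"
      interpret fy_data E k m j using fyd[OF m] .
      have "d m (hvar S * s) = (\<Sum>G\<in>Gs. d m (xvar E G * s))"
        unfolding d_def Gs_def by (rule deg_hvar_eq_sum_small[OF i(1) S(1)])
      also have "\<dots> = (\<Sum>v\<in>f ` Gs. d m (\<phi> v * s))"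
        using inj f by (simp add: sum.reindex)
      finally show "d m (hvar S * s) = (\<Sum>v\<in>f ` Gs. d m (\<phi> v * s))" .
    qed (use finG f in auto)
  qed
  have rep_t: "representable d \<phi> V I j (fy_data.test_part E m E)" if m: "m \<in> I" for m
  proof -
    interpret fy_data E k m j using fyd[OF m] .
    let ?A = "{F. F \<in># m \<and> F \<subset> E}"
    have mem': "Z \<subseteq> F" "F \<in> unif_flats E k" if "F \<in># m" for F using m that by (auto simp: I_def fy_mono_def)
    have "representable d \<phi> V I (\<Sum>F\<in>?A. count m F) (below E E)"
      unfolding below_def
    proof (rule representable_prod)
      fix F assume F: "F \<in> ?A"
      have "representable d \<phi> V I (Suc 0 + (count m F - 1)) (xvar E F * hvar F ^ (count m F - 1))"
        using F mem' mem by (intro representable_mult rep_x representable_power rep_h) auto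
      moreover have "0 < count m F" using F by simp
      ultimately show "representable d \<phi> V I (count m F) (xvar E F * hvar F ^ (count m F - 1))" by simp
    qed simp
    then have "representable d \<phi> V I ((\<Sum>F\<in>?A. count m F) + count m E) (test_part E)"
      unfolding test_part_def using E_ne Z
      by (intro representable_mult) (auto intro!: representable_power rep_h)
    moreover have "(\<Sum>F\<in>?A. count m F) + count m E = j"
    proof -
      have "j = (\<Sum>F\<in>set_mset m. count m F)"
        using fy by (simp add: fy_mono_def size_multiset_overloaded_eq)
      also have "\<dots> = (\<Sum>F\<in>insert E ?A. count m F)"
        using mem by (intro sum.mono_neutral_left) (auto simp: count_eq_zero_iff)
      finally show ?thesis by (simp add: add.commute)
    qed
    ultimately show ?thesis by simp
  qed
  define D where "D m w = d m (\<Prod>v\<in>#w. \<phi> v)" for m w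
  have "\<exists>q\<in>forms V j. \<forall>m'\<in>I. pairing V j (D m') q = d m' (fy_data.test_part E m E)" if m: "m \<in> I" for m
  proof -
    obtain q where q: "keys q \<subseteq> monomials V j"
      "\<And>i s. i \<in> I \<Longrightarrow> d i (fy_data.test_part E m E * s) = lin_ext (\<lambda>u. d i ((\<Prod>v\<in>#u. \<phi> v) * s)) q"
      using rep_t[OF m] unfolding representable_def by blast
    have "lookup q \<in> forms V j" using q(1) by (auto simp: forms_def in_keys_iff)
    moreover have "pairing V j (D m') (lookup q) = d m' (fy_data.test_part E m E)" if "m' \<in> I" for m'
      using q(2)[OF that, of 1] lin_ext_superset[OF finite_monomials[OF V] q(1)]
      by (simp add: pairing_def D_def)
    ultimately show ?thesis by blast
  qed
  then obtain q where q: "\<And>m. m \<in> I \<Longrightarrow> q m \<in> forms V j"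
    "\<And>m m'. m \<in> I \<Longrightarrow> m' \<in> I \<Longrightarrow> pairing V j (D m') (q m) = d m' (fy_data.test_part E m E)"
    by metis
  have "card I \<le> hilb_coeff V G j"
  proof (rule hilb_coeff_ge[OF V G finI, where D = D and q = q and w = "\<lambda>m. \<Sum>S\<in>Pow E. nested_rank E m S", folded pairing_def])
    show "pairing V j (D m) (mono_mult u g) = 0" if "m \<in> I" "set_mset u \<subseteq> V" "g \<in> G" for m u g
      using kill[OF fyd[OF that(1)] that(2,3)] unfolding D_def d_def .
    show "pairing V j (D m) (q m) \<noteq> 0" if "m \<in> I" for m
    proof -
      interpret fy_data E k m j using fyd[OF that] .
      have "E \<in> C" by (simp add: nested_chain_def)
      then show ?thesis using q(2)[OF that that] deg_test_part[OF _ E_ne] by (simp add: d_def)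
    qed
    show "m' = m \<or> (\<Sum>S\<in>Pow E. nested_rank E m' S) < (\<Sum>S\<in>Pow E. nested_rank E m S)"
      if m: "m \<in> I" "m' \<in> I" "pairing V j (D m') (q m) \<noteq> 0" for m m'
    proof -
      interpret fy_data E k m j using fyd[OF m(1)] .
      show ?thesis using triangular[OF fyd[OF m(2)]] q(2)[OF m(1,2)] m(3) by (simp add: d_def)
    qed
  qed (use q in auto)
  then show ?thesis by (simp add: I_def)
qed

section \<open>Uniform matroids\<close>

lemma unif_mrank:
  assumes "X \<subseteq> {..<n}"
  shows "mrank (unif_indep k n) X = min (card X) k"
proof -
  have finX: "finite X" using assms finite_subset by blast
  let ?S = "{card I |I. I \<subseteq> X \<and> unif_indep k n I}"
  have "finite ?S" using finX by (intro finite_subset[of ?S "card ` Pow X"]) auto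
  moreover have "min (card X) k \<in> ?S"
  proof -
    obtain I where "I \<subseteq> X" "card I = min (card X) k"
      using obtain_subset_with_card_n[of "min (card X) k" X] by auto
    then show ?thesis using assms by (auto simp: unif_indep_def intro!: exI[of _ I])
  qed
  moreover have "a \<le> min (card X) k" if "a \<in> ?S" for a
    using that finX by (auto simp: unif_indep_def intro: card_mono)
  ultimately show ?thesis unfolding mrank_def by (intro Max_eqI) auto
qed

lemma unif_flats_eq:
  assumes "k \<le> n"
  shows "flats (unif_ground n) (unif_indep k n) = insert {..<n} {F. F \<subseteq> {..<n} \<and> card F < k}"
proof -
  have "(\<forall>e\<in>{..<n} - F. mrank (unif_indep k n) F < mrank (unif_indep k n) (insert e F)) \<longleftrightarrow> F = {..<n} \<or> card F < k"
    if F: "F \<subseteq> {..<n}" for F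
  proof -
    have finF: "finite F" using F finite_subset by blast
    have "mrank (unif_indep k n) F < mrank (unif_indep k n) (insert e F) \<longleftrightarrow> card F < k"
      if "e \<in> {..<n} - F" for e
      using that F finF by (subst (1 2) unif_mrank) auto
    then show ?thesis using F by blast
  qed
  then show ?thesis by (auto simp: flats_def unif_ground_def)
qed

lemma pvar_polys: "v \<in> V \<Longrightarrow> pvar v \<in> polys V"
  by (auto simp: polys_def pvar_def split: if_splits)

lemma pmono_polys: "set_mset m \<subseteq> V \<Longrightarrow> pmono m \<in> polys V"
  by (auto simp: polys_def pmono_def split: if_splits)

lemma finite_flats: "finite E \<Longrightarrow> finite (flats E indep)"
  by (rule finite_subset[of _ "Pow E"]) (auto simp: flats_def)

lemma chow_gens_polys: "chow_gens E indep \<subseteq> polys (chow_vars E indep)"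
  unfolding chow_gens_def
  by (auto intro!: pmono_polys Q.subspace_diff[OF subspace_polys] Q.subspace_sum[OF subspace_polys] pvar_polys)

lemma aug_gens_polys: "aug_gens E indep \<subseteq> polys (aug_vars E indep)"
  unfolding aug_gens_def
  by (auto simp: aug_vars_def intro!: pmono_polys Q.subspace_diff[OF subspace_polys] Q.subspace_sum[OF subspace_polys] pvar_polys)

lemma finite_chow_vars: "finite E \<Longrightarrow> finite (chow_vars E indep)"
  by (simp add: chow_vars_def finite_flats)

lemma finite_aug_vars: "finite E \<Longrightarrow> finite (aug_vars E indep)"
  by (simp add: aug_vars_def finite_flats)

lemma pairing_linear:
  assumes "finite V" "set_mset u \<subseteq> V" "A \<subseteq> V"
  shows "pairing V j D (mono_mult u (\<Sum>v\<in>A. pvar v)) = (if size u + 1 = j then \<Sum>v\<in>A. D (add_mset v u) else 0)"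
proof -
  have "pairing V j D (mono_mult u (\<Sum>v\<in>A. pvar v)) = (\<Sum>v\<in>A. if size u + 1 = j then D (add_mset v u) else 0)"
    unfolding mono_mult_sum pairing_sum pvar_pmono mono_mult_pmono
    using assms by (intro sum.cong refl) (subst pairing_pmono, auto)
  then show ?thesis by simp
qed

lemma unif_red_chow_ge:
  assumes "0 < k" "k \<le> n"
  shows "card (fy_mono (unif_flats {..<n} k) (unif_rank {..<n} k) j) \<le> red_chow_hilb (unif_ground n) (unif_indep k n) j"
proof -
  let ?E = "{..<n}" and ?V = "chow_vars (unif_ground n) (unif_indep k n)"
  have V: "?V = unif_flats ?E k - {?E}"
    using unif_flats_eq[OF assms(2)] by (auto simp: chow_vars_def unif_flats_def unif_ground_def)
  have finV: "finite ?V" by (simp add: finite_chow_vars unif_ground_def)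
  have "card {m \<in> fy_mono (unif_flats ?E k) (unif_rank ?E k) j. \<forall>F\<in>#m. {} \<subseteq> F}
      \<le> hilb_coeff ?V (chow_gens (unif_ground n) (unif_indep k n)) j"
  proof (rule unif_hilb_coeff_ge[where \<phi> = "xvar ?E"])
    show "\<exists>v\<in>?V. xvar ?E v = xvar ?E F" if "F \<in> unif_flats ?E k - {?E}" for F
      using that V by auto
    fix m u g
    assume m: "fy_data ?E k m j" and u: "set_mset u \<subseteq> ?V" and g: "g \<in> chow_gens (unif_ground n) (unif_indep k n)"
    interpret fy_data ?E k m j by (rule m)
    let ?D = "\<lambda>w. deg (\<Prod>v\<in>#w. xvar ?E v)"
    from g consider (inc) F G where "g = pmono {#F, G#}" "F \<in> ?V" "G \<in> ?V" "\<not> F \<subseteq> G" "\<not> G \<subseteq> F"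
      | (lin) a b where "g = (\<Sum>F\<in>{F \<in> ?V. a \<in> F}. pvar F) - (\<Sum>F\<in>{F \<in> ?V. b \<in> F}. pvar F)" "a \<in> ?E" "b \<in> ?E"
      unfolding chow_gens_def unif_ground_def by blast
    then show "pairing ?V j ?D (mono_mult u g) = 0"
    proof cases
      case inc
      then have "F \<subset> ?E" "F \<noteq> {}" "G \<subset> ?E" "G \<noteq> {}" using V E_ne by (auto simp: unif_flats_def)
      from deg_xvar_incomparable[OF this(2,1,4,3) inc(4,5), of "\<Prod>v\<in>#u. xvar ?E v"]
      have "?D (u + {#F, G#}) = 0" by (simp add: mult_ac)
      then show ?thesis unfolding inc(1) mono_mult_pmono
        using finV u inc by (subst pairing_pmono) auto
    next
      case lin
      have "(\<Sum>F\<in>{F \<in> ?V. a \<in> F}. ?D (add_mset F u)) = (\<Sum>F\<in>{F \<in> ?V. b \<in> F}. ?D (add_mset F u))"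
        using deg_linear_relation[OF lin(2,3), of "\<Prod>v\<in>#u. xvar ?E v"] unfolding V by simp
      then show ?thesis unfolding lin(1) mono_mult_diff pairing_diff
        using finV u by (subst (1 2) pairing_linear) auto
    qed
  qed (use assms finV chow_gens_polys in auto)
  then show ?thesis by (simp add: red_chow_hilb_def)
qed

text \<open>\<open>None\<close> is the extra element 0 added to the ground set.\<close>

definition cone :: "'a set \<Rightarrow> 'a option set" where
  "cone F = insert None (Some ` F)"

lemma cone_subset_iff [simp]: "cone F \<subseteq> cone G \<longleftrightarrow> F \<subseteq> G"
  by (auto simp: cone_def)

lemma cone_eq_iff [simp]: "cone F = cone G \<longleftrightarrow> F = G"
  by (auto simp: cone_def)

lemma cone_nonempty [simp]: "cone F \<noteq> {}" by (simp add: cone_def)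

lemma card_cone: "finite F \<Longrightarrow> card (cone F) = Suc (card F)"
  by (simp add: cone_def card_image)

lemma cone_surj: "None \<in> G \<Longrightarrow> \<exists>F. G = cone F"
  by (rule exI[of _ "{x. Some x \<in> G}"]) (auto simp: cone_def image_iff, metis not_None_eq)

text \<open>With 0 for the added point, \<open>y_i\<close> is interpreted as \<open>h_{0,i}\<close>.
  Expanded from 0, it is the sum of the \<open>x_F\<close> with \<open>i\<close> not in
  \<open>F\<close>, the defining relation of \<open>y_i\<close>. Expanded from \<open>i\<close>, it
  involves only sets avoiding 0, which are incomparable to the cone over \<open>F\<close> if
  \<open>i\<close> is not in \<open>F\<close>; this gives the relation for
  \<open>y_i x_F\<close>.\<close>

lemma unif_aug_chow_ge:
  assumes "0 < k" "k \<le> n"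
  shows "card {m \<in> fy_mono (unif_flats (cone {..<n}) (Suc k)) (unif_rank (cone {..<n}) (Suc k)) j. \<forall>F\<in>#m. {None} \<subseteq> F}
    \<le> aug_chow_hilb (unif_ground n) (unif_indep k n) j"
  unfolding aug_chow_hilb_def
proof (rule unif_hilb_coeff_ge[where \<phi> = "case_sum (\<lambda>F. xvar (cone {..<n}) (cone F)) (\<lambda>i. hvar {None, Some i})"])
  let ?E = "{..<n}" and ?V = "aug_vars (unif_ground n) (unif_indep k n)"
  let ?\<phi> = "case_sum (\<lambda>F. xvar (cone {..<n}) (cone F)) (\<lambda>i. hvar {None, Some i})"
  define L where "L = flats (unif_ground n) (unif_indep k n) - {unif_ground n}"
  have Leq: "L = insert ?E {F. F \<subseteq> ?E \<and> card F < k} - {?E}"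
    unfolding L_def unif_flats_eq[OF assms(2)] by (simp add: unif_ground_def)
  have L: "F \<in> L \<longleftrightarrow> cone F \<in> unif_flats (cone ?E) (Suc k) - {cone ?E}" for F
  proof (cases "F \<subseteq> ?E")
    case True
    then have "finite F" using finite_subset by blast
    then show ?thesis using True by (auto simp: Leq unif_flats_def card_cone)
  qed (auto simp: Leq unif_flats_def)
  have V: "?V = Inl ` L \<union> Inr ` ?E" by (simp add: aug_vars_def L_def unif_ground_def)
  show finV: "finite ?V" by (simp add: finite_aug_vars unif_ground_def)
  show "finite (cone ?E)" by (simp add: cone_def)
  show "Suc k \<le> card (cone ?E)" using assms by (simp add: card_cone)
  show "aug_gens (unif_ground n) (unif_indep k n) \<subseteq> polys ?V" by (rule aug_gens_polys)
  show "{None} = {} \<or> (\<exists>z\<in>cone ?E. {None} = {z})" by (auto simp: cone_def)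
  show "\<exists>v\<in>?V. ?\<phi> v = xvar (cone ?E) F" if F: "F \<in> unif_flats (cone ?E) (Suc k) - {cone ?E}" "{None} \<subseteq> F" for F
  proof -
    obtain F' where "F = cone F'" using cone_surj[of F] F(2) by auto
    then have "Inl F' \<in> ?V" "?\<phi> (Inl F') = xvar (cone ?E) F" using L[of F'] F V by auto
    then show ?thesis by blast
  qed
  fix m u g
  assume m: "fy_data (cone ?E) (Suc k) m j" and u: "set_mset u \<subseteq> ?V" and g: "g \<in> aug_gens (unif_ground n) (unif_indep k n)"
  interpret fy_data "cone ?E" "Suc k" m j by (rule m)
  let ?D = "\<lambda>w. deg (\<Prod>v\<in>#w. ?\<phi> v)"
  let ?s = "\<Prod>v\<in>#u. ?\<phi> v"
  have LC: "cone F \<noteq> {}" "cone F \<subset> cone ?E" if "F \<in> L" for F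
    using L[of F] that by (auto simp: unif_flats_def psubset_eq)
  from g consider (yi) i where "g = pvar (Inr i) - (\<Sum>F\<in>{F \<in> L. i \<notin> F}. pvar (Inl F))" "i \<in> ?E"
    | (inc) F G where "g = pmono {#Inl F, Inl G#}" "F \<in> L" "G \<in> L" "\<not> F \<subseteq> G" "\<not> G \<subseteq> F"
    | (yx) i F where "g = pmono {#Inr i, Inl F#}" "i \<in> ?E" "F \<in> L" "i \<notin> F"
    unfolding aug_gens_def unif_ground_def L_def by blast
  then show "pairing ?V j ?D (mono_mult u g) = 0"
  proof cases
    case yi
    let ?A = "Inl ` {F \<in> L. i \<notin> F} :: (nat set + nat) set"
    have g: "g = (\<Sum>v\<in>{Inr i}. pvar v) - (\<Sum>v\<in>?A. pvar v)"
      unfolding yi(1) by (simp add: sum.reindex)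
    have "deg (hvar {None, Some i} * ?s) = (\<Sum>G | G \<in> unif_flats (cone ?E) (Suc k) - {cone ?E} \<and> None \<in> G \<and> \<not> {None, Some i} \<subseteq> G. deg (xvar (cone ?E) G * ?s))"
      by (rule deg_hvar_eq_sum_small) (use yi in \<open>auto simp: cone_def\<close>)
    also have "\<dots> = (\<Sum>G\<in>cone ` {F \<in> L. i \<notin> F}. deg (xvar (cone ?E) G * ?s))"
    proof (intro sum.cong refl set_eqI iffI)
      fix G assume "G \<in> {G. G \<in> unif_flats (cone ?E) (Suc k) - {cone ?E} \<and> None \<in> G \<and> \<not> {None, Some i} \<subseteq> G}"
      moreover from this obtain F where "G = cone F" using cone_surj[of G] by auto
      ultimately show "G \<in> cone ` {F \<in> L. i \<notin> F}" using L[of F] by (auto simp: cone_def)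
    next
      fix G assume "G \<in> cone ` {F \<in> L. i \<notin> F}"
      then obtain F where "F \<in> L" "i \<notin> F" "G = cone F" by blast
      then show "G \<in> {G. G \<in> unif_flats (cone ?E) (Suc k) - {cone ?E} \<and> None \<in> G \<and> \<not> {None, Some i} \<subseteq> G}"
        using L[of F] by (auto simp: cone_def)
    qed
    also have "\<dots> = (\<Sum>v\<in>?A. ?D (add_mset v u))"
      by (simp add: sum.reindex inj_on_def)
    finally have eq: "?D (add_mset (Inr i) u) = (\<Sum>v\<in>?A. ?D (add_mset v u))" by simp
    have A: "?A \<subseteq> ?V" "{Inr i} \<subseteq> ?V" using yi by (auto simp: V)
    show ?thesis unfolding g mono_mult_diff pairing_diff pairing_linear[OF finV u A(1)] pairing_linear[OF finV u A(2)]
      using eq by simp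
  next
    case inc
    have "\<not> cone F \<subseteq> cone G" "\<not> cone G \<subseteq> cone F" using inc by simp_all
    from deg_xvar_incomparable[OF LC[OF inc(2)] LC[OF inc(3)] this, of ?s]
    have "?D (u + {#Inl F, Inl G#}) = 0" by (simp add: mult_ac)
    then show ?thesis unfolding inc(1) mono_mult_pmono
      using finV u inc V by (subst pairing_pmono) auto
  next
    case yx
    have "deg (hvar {None, Some i} * (xvar (cone ?E) (cone F) * ?s))
        = (\<Sum>G | G \<subset> cone ?E \<and> Some i \<in> G \<and> \<not> {None, Some i} \<subseteq> G. deg (xvar (cone ?E) G * (xvar (cone ?E) (cone F) * ?s)))"
      by (rule deg_hvar_eq_sum) (use yx in \<open>auto simp: cone_def\<close>)
    also have "\<dots> = 0"
    proof (intro sum.neutral ballI)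
      fix G assume G: "G \<in> {G. G \<subset> cone ?E \<and> Some i \<in> G \<and> \<not> {None, Some i} \<subseteq> G}"
      then have "G \<noteq> {}" "G \<subset> cone ?E" "\<not> G \<subseteq> cone F" "\<not> cone F \<subseteq> G" using yx by (auto simp: cone_def)
      from deg_xvar_incomparable[OF this(1,2) LC[OF yx(3)] this(3,4), of ?s]
      show "deg (xvar (cone ?E) G * (xvar (cone ?E) (cone F) * ?s)) = 0" by (simp add: mult.assoc)
    qed
    finally have "?D (u + {#Inr i, Inl F#}) = 0" by (simp add: mult_ac)
    then show ?thesis unfolding yx(1) mono_mult_pmono
      using finV u yx V by (subst pairing_pmono) auto
  qed
qed simp

section \<open>Rewriting in Chow rings\<close>

text \<open>\<open>J\<close> has to absorb only the \<open>x F\<close>, because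
  \<open>ring_ideal\<close> is closed under multiplication by the chosen variables and not by the
  whole ring. In the applications \<open>L\<close> contains the top flat, whose \<open>x\<close> is
  a linear form.\<close>

locale chow_relations =
  fixes L :: "'b set set" and x :: "'b set \<Rightarrow> 'r::comm_ring_1" and J :: "'r set"
  assumes finite_L: "finite L"
    and J_zero: "0 \<in> J"
    and J_diff: "p \<in> J \<Longrightarrow> q \<in> J \<Longrightarrow> p - q \<in> J"
    and J_mult: "F \<in> L \<Longrightarrow> p \<in> J \<Longrightarrow> x F * p \<in> J"
    and J_incomparable: "F \<in> L \<Longrightarrow> G \<in> L \<Longrightarrow> \<not> F \<subseteq> G \<Longrightarrow> \<not> G \<subseteq> F \<Longrightarrow> x F * x G \<in> J"
begin

text \<open>This is \<open>- h_G\<close>; the sign does not affect which powers and products lie in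
  \<open>J\<close>.\<close>

definition up :: "'b set \<Rightarrow> 'r" where
  "up G = (\<Sum>K | K \<in> L \<and> G \<subseteq> K. x K)"

lemma J_uminus: "p \<in> J \<Longrightarrow> - p \<in> J"
  using J_diff[OF J_zero, of p] by simp

lemma J_add: "p \<in> J \<Longrightarrow> q \<in> J \<Longrightarrow> p + q \<in> J"
  using J_diff[of p "- q"] J_uminus[of q] by simp

lemma J_sum: "(\<And>a. a \<in> A \<Longrightarrow> f a \<in> J) \<Longrightarrow> (\<Sum>a\<in>A. f a) \<in> J"
  by (induction A rule: infinite_finite_induct) (auto simp: J_zero J_add)

lemma J_mult_sum: "A \<subseteq> L \<Longrightarrow> p \<in> J \<Longrightarrow> (\<Sum>K\<in>A. x K) * p \<in> J"
  unfolding sum_distrib_right by (intro J_sum J_mult) auto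

lemma J_mult_up: "p \<in> J \<Longrightarrow> up G ^ n * p \<in> J"
proof (induction n)
  case (Suc n)
  have "up G * (up G ^ n * p) \<in> J" unfolding up_def[of G]
    by (rule J_mult_sum) (use Suc in \<open>auto simp: up_def\<close>)
  then show ?case by (simp add: mult_ac)
qed simp

lemma J_mult_prod: "set_mset m \<subseteq> L \<Longrightarrow> p \<in> J \<Longrightarrow> (\<Prod>F\<in>#m. x F) * p \<in> J"
  by (induction m) (auto simp: mult.assoc J_mult)

text \<open>In the expansion of \<open>up G ^ s\<close> every term other than \<open>x G ^ s\<close>
  has a factor strictly above \<open>G\<close>; \<open>A\<close> is assumed to contain
  \<open>q\<close> times these terms.\<close>

lemma power_expand:
  assumes A: "0 \<in> A" "\<And>p q. p \<in> A \<Longrightarrow> q \<in> A \<Longrightarrow> p + q \<in> A"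
    and u: "\<And>u. size u = s \<Longrightarrow> set_mset u \<subseteq> {K \<in> L. G \<subseteq> K} \<Longrightarrow> u \<noteq> replicate_mset s G \<Longrightarrow> q * (\<Prod>K\<in>#u. x K) \<in> A"
    and G: "G \<in> L"
  shows "q * (up G ^ s - x G ^ s) \<in> A"
  using u
proof (induction s arbitrary: q)
  case 0
  then show ?case using A by simp
next
  case (Suc s)
  have Asum: "(\<Sum>a\<in>B. f a) \<in> A" if "\<And>a. a \<in> B \<Longrightarrow> f a \<in> A" for B and f :: "'b set \<Rightarrow> 'r"
    using that by (induction B rule: infinite_finite_induct) (auto simp: A)
  let ?U = "{K. K \<in> L \<and> G \<subseteq> K}"
  have "q * x K * (up G ^ s - x G ^ s) \<in> A" if K: "K \<in> ?U" for K
  proof (rule Suc.IH)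
    fix u assume u: "size u = s" "set_mset u \<subseteq> {K \<in> L. G \<subseteq> K}" "u \<noteq> replicate_mset s G"
    have "add_mset K u \<noteq> replicate_mset (Suc s) G"
    proof
      assume eq: "add_mset K u = replicate_mset (Suc s) G"
      then have "K = G" by (metis in_replicate_mset union_single_eq_member)
      then show False using eq u(3) by simp
    qed
    then have "q * (\<Prod>K\<in>#add_mset K u. x K) \<in> A" using u K by (intro Suc.prems) auto
    then show "q * x K * (\<Prod>K\<in>#u. x K) \<in> A" by (simp add: mult_ac)
  qed
  then have "(\<Sum>K\<in>?U. q * x K * (up G ^ s - x G ^ s)) \<in> A" by (intro Asum) auto
  then have 1: "q * up G * (up G ^ s - x G ^ s) \<in> A"
    by (simp add: up_def[of G] sum_distrib_left sum_distrib_right)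
  have "q * x K * x G ^ s \<in> A" if K: "K \<in> ?U - {G}" for K
  proof -
    have "add_mset K (replicate_mset s G) \<noteq> replicate_mset (Suc s) G"
      using K by (metis DiffD2 insertI1 in_replicate_mset union_single_eq_member)
    then have "q * (\<Prod>K\<in>#add_mset K (replicate_mset s G). x K) \<in> A"
      using K G by (intro Suc.prems) (auto split: if_splits)
    then show ?thesis by (simp add: mult_ac image_replicate_mset)
  qed
  then have "(\<Sum>K\<in>?U - {G}. q * x K * x G ^ s) \<in> A" by (intro Asum) auto
  then have "q * (\<Sum>K\<in>?U - {G}. x K) * x G ^ s \<in> A"
    by (simp add: sum_distrib_left sum_distrib_right)
  moreover have "up G = x G + (\<Sum>K\<in>?U - {G}. x K)"
    unfolding up_def using finite_L G by (intro sum.remove) auto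
  ultimately have 2: "q * (up G - x G) * x G ^ s \<in> A" by simp
  have "q * (up G ^ Suc s - x G ^ Suc s) = q * up G * (up G ^ s - x G ^ s) + q * (up G - x G) * x G ^ s"
    by (simp add: algebra_simps)
  then show ?case using A(2)[OF 1 2] by simp
qed

text \<open>The measure adds up, over all factors, the number of members of \<open>L\<close>
  strictly above. A monomial that is not a Feichtner-Yuzvinsky one has two incomparable factors and
  lies in \<open>J\<close>, or has too high a power of some \<open>G\<close>; a power relation then
  moves factors strictly upwards, which lowers the measure.\<close>

lemma fy_mono_reduce:
  assumes A: "J \<subseteq> A" "\<And>p q. p \<in> A \<Longrightarrow> q \<in> A \<Longrightarrow> p - q \<in> A"
    and rel: "\<And>F G. F \<in> L \<Longrightarrow> G \<in> L \<Longrightarrow> F \<subset> G \<Longrightarrow> x F * up G ^ (c G - c F) \<in> J"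
    and rel0: "\<And>G. G \<in> L \<Longrightarrow> up G ^ c G \<in> J"
    and fy: "\<And>m. m \<in> fy_mono L c j \<Longrightarrow> (\<Prod>F\<in>#m. x F) \<in> A"
    and m: "set_mset m \<subseteq> L" "size m = j"
  shows "(\<Prod>F\<in>#m. x F) \<in> A"
proof -
  have A0: "0 \<in> A" using A(1) J_zero by blast
  have A_add: "p + q \<in> A" if "p \<in> A" "q \<in> A" for p q
    using A(2)[OF that(1) A(2)[OF A0 that(2)]] by simp
  define \<nu> where "\<nu> F = card {K \<in> L. F \<subset> K}" for F
  have \<nu>_less: "\<nu> K < \<nu> G" if "G \<subset> K" "K \<in> L" for G K
    unfolding \<nu>_def using finite_L that by (intro psubset_card_mono) auto
  show ?thesis using m
  proof (induction "\<Sum>F\<in>#m. \<nu> F" arbitrary: m rule: less_induct)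
    case less
    have main: "(\<Prod>F\<in>#m. x F) \<in> A"
      if G: "G \<in> L" and m: "m = replicate_mset s G + m'" and q: "(\<Prod>F\<in>#m'. x F) * up G ^ s \<in> J" for G s m'
    proof -
      let ?q = "\<Prod>F\<in>#m'. x F"
      have "?q * (up G ^ s - x G ^ s) \<in> A"
      proof (rule power_expand[OF A0 A_add _ G])
        fix u assume u: "size u = s" "set_mset u \<subseteq> {K \<in> L. G \<subseteq> K}" "u \<noteq> replicate_mset s G"
        have lt: "(\<Sum>F\<in>#u. \<nu> F) < s * \<nu> G"
        proof -
          have "(\<Sum>F\<in>#u. \<nu> F) \<le> size u * \<nu> G \<and> (u \<noteq> replicate_mset (size u) G \<longrightarrow> (\<Sum>F\<in>#u. \<nu> F) < size u * \<nu> G)"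
            using u(2)
          proof (induction u)
            case (add K u)
            have K: "\<nu> K \<le> \<nu> G \<and> (K \<noteq> G \<longrightarrow> \<nu> K < \<nu> G)"
              using add.prems \<nu>_less[of G K] by (cases "K = G") (auto simp: psubset_eq)
            have "(\<Sum>F\<in>#u. \<nu> F) \<le> size u * \<nu> G \<and> (u \<noteq> replicate_mset (size u) G \<longrightarrow> (\<Sum>F\<in>#u. \<nu> F) < size u * \<nu> G)"
              using add by simp
            then show ?case using K by (cases "K = G") auto
          qed simp
          then show ?thesis using u by simp
        qed
        have "(\<Prod>F\<in>#u + m'. x F) \<in> A"
          by (rule less.hyps) (use lt u m less.prems in \<open>auto simp: image_replicate_mset\<close>)
        then show "?q * (\<Prod>K\<in>#u. x K) \<in> A" by (simp add: mult.commute)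
      qed
      then have "?q * up G ^ s - ?q * (up G ^ s - x G ^ s) \<in> A" using A q by blast
      then show ?thesis unfolding m by (simp add: algebra_simps image_replicate_mset)
    qed
    show ?case
    proof (cases "\<forall>F\<in>#m. \<forall>G\<in>#m. F \<subseteq> G \<or> G \<subseteq> F")
      case False
      then obtain F G where FG: "F \<in># m" "G \<in># m" "\<not> F \<subseteq> G" "\<not> G \<subseteq> F" by blast
      obtain m' where m': "m = add_mset F m'" using FG(1) by (metis mset_add)
      then have "G \<in># m'" using FG by auto
      then obtain m'' where m'': "m' = add_mset G m''" by (metis mset_add)
      have "(\<Prod>F\<in>#m''. x F) * (x F * x G) \<in> J"
        using less.prems FG m' m'' by (intro J_mult_prod J_incomparable) auto
      then have "(\<Prod>F\<in>#m. x F) \<in> J" by (simp add: m' m'' mult_ac)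
      then show ?thesis using A by blast
    next
      case chain: True
      show ?thesis
      proof (cases "m \<in> fy_mono L c j")
        case False
        then obtain G where G: "G \<in># m" "c G \<le> count m G \<or> (\<exists>F\<in>#m. F \<subset> G \<and> c G \<le> count m G + c F)"
          using less.prems chain by (auto simp: fy_mono_def not_less)
        have GL: "G \<in> L" using G less.prems by blast
        have split: "\<exists>m'. m = replicate_mset s G + m'" if "s \<le> count m G" for s
          using that by (metis count_le_replicate_mset_subset_eq subset_mset.le_iff_add)
        show ?thesis
        proof (cases "c G \<le> count m G")
          case True
          then obtain m' where m': "m = replicate_mset (c G) G + m'" using split by blast
          show ?thesis
            by (rule main[OF GL m']) (use m' less.prems rel0[OF GL] in \<open>intro J_mult_prod, auto\<close>)
        next
          case False
          then obtain F where F: "F \<in># m" "F \<subset> G" "c G - c F \<le> count m G" using G by force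
          then obtain m' where m': "m = replicate_mset (c G - c F) G + m'" using split by blast
          have "F \<in># m'" using F m' by (auto split: if_splits)
          then obtain m'' where m'': "m' = add_mset F m''" by (metis mset_add)
          have "(\<Prod>F\<in>#m''. x F) * (x F * up G ^ (c G - c F)) \<in> J"
            using less.prems m' m'' F GL by (intro J_mult_prod rel) auto
          then have "(\<Prod>F\<in>#m'. x F) * up G ^ (c G - c F) \<in> J" by (simp add: m'' mult_ac)
          then show ?thesis by (rule main[OF GL m'])
        qed
      qed (rule fy)
    qed
  qed
qed

end

text \<open>Common ground of both rings. \<open>rk_inter\<close> expresses that \<open>F\<close> is
  a flat. In \<open>J_star\<close> the sum itself lies in \<open>J\<close> for the reduced ring; for
  the augmented ring it is \<open>- y_i\<close> modulo \<open>J\<close>, and \<open>y_i x_F\<close>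
  vanishes.\<close>

locale chow_flats = chow_relations L x J
  for L :: "'b set set" and x :: "'b set \<Rightarrow> 'r::comm_ring_1" and J +
  fixes E :: "'b set" and rk :: "'b set \<Rightarrow> nat"
  assumes E_L: "E \<in> L" and L_sub: "F \<in> L \<Longrightarrow> F \<subseteq> E"
    and rk_inter: "F \<in> L \<Longrightarrow> K \<in> L \<Longrightarrow> G \<in> L \<Longrightarrow> F \<subseteq> K \<Longrightarrow> i \<in> K \<inter> G \<Longrightarrow> i \<notin> F \<Longrightarrow> rk (F \<inter> G) < rk (K \<inter> G)"
    and J_star: "F \<in> L \<Longrightarrow> i \<in> E \<Longrightarrow> i \<notin> F \<Longrightarrow> x F * (\<Sum>K | K \<in> L \<and> i \<in> K. x K) \<in> J"
begin

lemma up_split: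
  assumes "i \<in> G"
  shows "up G = (\<Sum>K | K \<in> L \<and> i \<in> K. x K) - (\<Sum>K | K \<in> L \<and> i \<in> K \<and> \<not> G \<subseteq> K. x K)"
proof -
  have "{K. K \<in> L \<and> i \<in> K} = {K. K \<in> L \<and> G \<subseteq> K} \<union> {K. K \<in> L \<and> i \<in> K \<and> \<not> G \<subseteq> K}"
    using assms by auto
  then have "(\<Sum>K | K \<in> L \<and> i \<in> K. x K) = up G + (\<Sum>K | K \<in> L \<and> i \<in> K \<and> \<not> G \<subseteq> K. x K)"
    unfolding up_def using finite_L by (simp only:) (subst sum.union_disjoint, auto)
  then show ?thesis by simp
qed

text \<open>For \<open>i\<close> in \<open>G - F\<close>, \<open>J_star\<close> lets one factor
  \<open>up G\<close> be replaced by minus the sum of the \<open>x K\<close> with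
  \<open>i \<in> K\<close> and \<open>G\<close> not inside \<open>K\<close>. Such a \<open>K\<close>
  is incomparable to \<open>F\<close>, so that the term dies, or it contains \<open>F\<close>; then
  \<open>K \<inter> G\<close> has larger rank and one power less suffices.\<close>

lemma mult_up_power:
  assumes "F \<in> L" "G \<in> L" "\<not> G \<subseteq> F" "rk G \<le> rk (F \<inter> G) + s"
  shows "x F * up G ^ s \<in> J"
  using assms
proof (induction s arbitrary: F)
  case 0
  then obtain i where "i \<in> G" "i \<notin> F" by blast
  \<comment> \<open>Exponent 0 contradicts the rank hypothesis, because the flat \<open>F\<close>
    does not contain \<open>G\<close>.\<close>
  then have "rk (F \<inter> G) < rk (E \<inter> G)" using 0 E_L L_sub by (intro rk_inter[of _ _ _ i]) auto
  moreover have "E \<inter> G = G" using L_sub 0 by blast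
  ultimately show ?case using 0 by simp
next
  case (Suc s)
  then obtain i where i: "i \<in> G" "i \<notin> F" by blast
  let ?S = "\<Sum>K | K \<in> L \<and> i \<in> K. x K" and ?B = "{K. K \<in> L \<and> i \<in> K \<and> \<not> G \<subseteq> K}"
  have "x F * up G ^ Suc s = up G ^ s * (x F * ?S) - (\<Sum>K\<in>?B. x F * x K * up G ^ s)"
  proof -
    have "a * ((S - B) * u) = u * (a * S) - a * B * u" for a S B u :: 'r by (simp add: algebra_simps)
    from this[of "x F" ?S "\<Sum>K\<in>?B. x K" "up G ^ s"] show ?thesis
      by (simp only: up_split[OF i(1), symmetric] power_Suc sum_distrib_left[of "x F" _ ?B] sum_distrib_right)
  qed
  moreover have "up G ^ s * (x F * ?S) \<in> J"
    using Suc.prems i L_sub by (intro J_mult_up J_star) auto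
  moreover have "(\<Sum>K\<in>?B. x F * x K * up G ^ s) \<in> J"
  proof (rule J_sum)
    fix K assume K: "K \<in> ?B"
    show "x F * x K * up G ^ s \<in> J"
    proof (cases "F \<subseteq> K")
      case True
      have "rk (F \<inter> G) < rk (K \<inter> G)" using K True i Suc.prems by (intro rk_inter[of _ _ _ i]) auto
      then have "x K * up G ^ s \<in> J" using K Suc.prems by (intro Suc.IH) auto
      then show ?thesis using J_mult Suc.prems by (simp add: mult.assoc)
    next
      case False
      then have "up G ^ s * (x F * x K) \<in> J" using K i Suc.prems by (intro J_mult_up J_incomparable) auto
      then show ?thesis by (simp add: mult_ac)
    qed
  qed
  ultimately show ?case using J_diff by simp
qed

lemma chain_relation:
  assumes "F \<in> L" "G \<in> L" "F \<subset> G" shows "x F * up G ^ (rk G - rk F) \<in> J"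
proof (rule mult_up_power)
  have "F \<inter> G = F" using assms by blast
  then show "rk G \<le> rk (F \<inter> G) + (rk G - rk F)" by simp
qed (use assms in auto)

text \<open>The same splitting without \<open>x F\<close>: each remaining \<open>K\<close> contains
  \<open>i\<close>, so \<open>K \<inter> G\<close> has positive rank and \<open>rk G - 1\<close>
  further factors suffice.\<close>

lemma up_power_in_reduced:
  assumes "G \<in> L" "i \<in> G" "(\<Sum>K | K \<in> L \<and> i \<in> K. x K) \<in> J" "\<And>X. i \<in> X \<Longrightarrow> X \<subseteq> E \<Longrightarrow> 0 < rk X"
  shows "up G ^ rk G \<in> J"
proof -
  obtain s where s: "rk G = Suc s" using assms L_sub by (metis Suc_pred)
  let ?S = "\<Sum>K | K \<in> L \<and> i \<in> K. x K" and ?B = "{K. K \<in> L \<and> i \<in> K \<and> \<not> G \<subseteq> K}"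
  have "up G ^ Suc s = up G ^ s * ?S - (\<Sum>K\<in>?B. x K * up G ^ s)"
  proof -
    have "(S - B) * u = u * S - B * u" for S B u :: 'r by (simp add: algebra_simps)
    from this[of ?S "\<Sum>K\<in>?B. x K" "up G ^ s"] show ?thesis
      by (simp only: up_split[OF assms(2), symmetric] power_Suc sum_distrib_right)
  qed
  moreover have "(\<Sum>K\<in>?B. x K * up G ^ s) \<in> J"
  proof (intro J_sum mult_up_power)
    fix K assume K: "K \<in> ?B"
    have "0 < rk (K \<inter> G)" using K assms(1,2) L_sub by (intro assms(4)) auto
    then show "rk G \<le> rk (K \<inter> G) + s" using s by linarith
  qed (use assms in auto)
  ultimately show ?thesis using s J_diff J_mult_up[OF assms(3)] by simp
qed

text \<open>Here the remaining \<open>K\<close> share no point of \<open>G\<close>, and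
  \<open>K \<inter> G\<close> may have rank 0; all \<open>rk G\<close> further factors are required.
  This is where rank plus one comes from.\<close>

lemma up_power_in_augmented:
  assumes "G \<in> L" "(\<Sum>K\<in>L. x K) = 0"
  shows "up G ^ Suc (rk G) \<in> J"
proof -
  let ?B = "{K. K \<in> L \<and> \<not> G \<subseteq> K}"
  have "L = {K. K \<in> L \<and> G \<subseteq> K} \<union> ?B" by auto
  then have "up G + (\<Sum>K\<in>?B. x K) = 0"
    unfolding up_def using finite_L assms(2) by (subst sum.union_disjoint[symmetric]) auto
  then have "up G = - (\<Sum>K\<in>?B. x K)" by (simp add: eq_neg_iff_add_eq_0)
  then have "up G ^ Suc (rk G) = - (\<Sum>K\<in>?B. x K * up G ^ rk G)"
    by (simp only: power_Suc mult_minus_left sum_distrib_right)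
  moreover have "(\<Sum>K\<in>?B. x K * up G ^ rk G) \<in> J"
    by (intro J_sum mult_up_power) (use assms in auto)
  ultimately show ?thesis using J_uminus by simp
qed

end

section \<open>Chow rings of loopless matroids\<close>

lemma lookup_single_mult: "lookup (single u 1 * p) = mono_mult u (lookup (p :: 'v multiset \<Rightarrow>\<^sub>0 rat))"
proof
  fix m
  have "single u 1 * p = (\<Sum>l\<in>keys p. single (u + l) (lookup p l))"
    by (subst (1) poly_mapping_expand[of p]) (simp add: sum_distrib_left mult_single)
  then have "lookup (single u 1 * p) m = (\<Sum>l\<in>keys p. if u + l = m then lookup p l else 0)"
    by (simp add: lookup_sum lookup_single when_def)
  also have "\<dots> = mono_mult u (lookup p) m"
  proof (cases "u \<subseteq># m")
    case True
    then have "u + l = m \<longleftrightarrow> l = m - u" for l by auto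
    then show ?thesis using True by (simp add: mono_mult_def in_keys_iff)
  next
    case False
    then show ?thesis by (auto simp: mono_mult_def intro!: sum.neutral)
  qed
  finally show "lookup (single u 1 * p) m = mono_mult u (lookup p) m" .
qed

lemma lookup_diff_fun: "lookup (p - q) = lookup p - lookup q"
  by (simp add: fun_eq_iff lookup_minus)

lemma lookup_zero_fun: "lookup 0 = 0"
  by (simp add: fun_eq_iff)

lemma lookup_single_fun: "lookup (single m 1) = pmono m"
  by (auto simp: fun_eq_iff lookup_single pmono_def when_def)

lemma mono_mult_gen_ideal:
  assumes "p \<in> gen_ideal V G" "set_mset w \<subseteq> V"
  shows "mono_mult w p \<in> gen_ideal V G"
proof -
  have sub: "Q.subspace {p. mono_mult w p \<in> gen_ideal V G}"
  proof (rule Q.subspaceI)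
    have "mono_mult w 0 = 0" by (auto simp: mono_mult_def fun_eq_iff)
    then show "0 \<in> {p. mono_mult w p \<in> gen_ideal V G}" by (simp add: gen_ideal_def Q.span_zero)
    have "mono_mult w (p + q) = mono_mult w p + mono_mult w q" for p q
      by (auto simp: mono_mult_def fun_eq_iff)
    then show "p + q \<in> {p. mono_mult w p \<in> gen_ideal V G}"
      if "p \<in> {p. mono_mult w p \<in> gen_ideal V G}" "q \<in> {p. mono_mult w p \<in> gen_ideal V G}" for p q
      using that by (simp add: gen_ideal_def Q.span_add)
    have "mono_mult w (qscale c p) = qscale c (mono_mult w p)" for c p
      by (auto simp: mono_mult_def qscale_def fun_eq_iff)
    then show "qscale c p \<in> {p. mono_mult w p \<in> gen_ideal V G}"
      if "p \<in> {p. mono_mult w p \<in> gen_ideal V G}" for c p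
      using that by (simp add: gen_ideal_def Q.span_scale)
  qed
  have mm: "mono_mult w (mono_mult u g) = mono_mult (w + u) g" for u g
  proof
    fix m
    show "mono_mult w (mono_mult u g) m = mono_mult (w + u) g m"
    proof (cases "w \<subseteq># m")
      case True
      then show ?thesis by (simp add: mono_mult_def subset_mset.le_diff_conv2 add.commute)
    next
      case False
      then have "\<not> w + u \<subseteq># m" by (meson mset_subset_eq_add_left subset_mset.order_trans)
      then show ?thesis using False by (simp add: mono_mult_def)
    qed
  qed
  have "gen_ideal V G \<subseteq> {p. mono_mult w p \<in> gen_ideal V G}"
    unfolding gen_ideal_def[of V G]
  proof (rule Q.span_minimal[OF _ sub[unfolded gen_ideal_def]], safe)
    fix u g assume "set_mset u \<subseteq> V" "g \<in> G"
    then have "mono_mult (w + u) g \<in> {mono_mult u g |u g. set_mset u \<subseteq> V \<and> g \<in> G}"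
      using assms(2) by (auto intro!: exI[of _ "w + u"] exI[of _ g])
    then show "mono_mult w (mono_mult u g) \<in> Q.span {mono_mult u g |u g. set_mset u \<subseteq> V \<and> g \<in> G}"
      unfolding mm by (rule Q.span_base)
  qed
  then show ?thesis using assms(1) by blast
qed

lemma gens_gen_ideal: "g \<in> G \<Longrightarrow> g \<in> gen_ideal V G"
  unfolding gen_ideal_def
  by (rule Q.span_base) (auto simp: mono_mult_def intro!: exI[of _ "{#}"] exI[of _ g])

text \<open>The product on \<open>qpoly\<close> as a function type is pointwise. Finitely supported
  maps carry the polynomial product, so the ideal is pulled back to them.\<close>

definition ring_ideal :: "'v set \<Rightarrow> 'v qpoly set \<Rightarrow> ('v multiset \<Rightarrow>\<^sub>0 rat) set" where
  "ring_ideal V G = {p. lookup p \<in> gen_ideal V G}"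

lemma ring_ideal_zero: "0 \<in> ring_ideal V G"
  by (simp add: ring_ideal_def lookup_zero_fun gen_ideal_def Q.span_zero)

lemma ring_ideal_diff: "p \<in> ring_ideal V G \<Longrightarrow> q \<in> ring_ideal V G \<Longrightarrow> p - q \<in> ring_ideal V G"
  by (simp add: ring_ideal_def lookup_diff_fun gen_ideal_def Q.span_diff)

lemma ring_ideal_mult: "p \<in> ring_ideal V G \<Longrightarrow> set_mset u \<subseteq> V \<Longrightarrow> single u 1 * p \<in> ring_ideal V G"
  by (simp add: ring_ideal_def lookup_single_mult mono_mult_gen_ideal)

lemma ring_ideal_uminus: "p \<in> ring_ideal V G \<Longrightarrow> - p \<in> ring_ideal V G"
  using ring_ideal_diff[OF ring_ideal_zero, of p V G] by simp

lemma ring_ideal_sum: "(\<And>a. a \<in> A \<Longrightarrow> f a \<in> ring_ideal V G) \<Longrightarrow> (\<Sum>a\<in>A. f a) \<in> ring_ideal V G"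
proof (induction A rule: infinite_finite_induct)
  case (insert a A)
  then have "f a - (- (\<Sum>a\<in>A. f a)) \<in> ring_ideal V G" by (intro ring_ideal_diff ring_ideal_uminus) auto
  then show ?case using insert by simp
qed (auto simp: ring_ideal_zero)

text \<open>\<open>gen\<close> accounts for variables outside the \<open>x F\<close>: the
  \<open>y_i\<close> of the augmented ring are congruent to sums of \<open>x F\<close>.\<close>

lemma hilb_coeff_le_fy:
  fixes V :: "'v set" and x :: "'b set \<Rightarrow> ('v multiset \<Rightarrow>\<^sub>0 rat)"
  assumes V: "finite V" and G: "G \<subseteq> polys V"
    and R: "chow_relations L x (ring_ideal V G)"
    and rel: "\<And>F G'. F \<in> L \<Longrightarrow> G' \<in> L \<Longrightarrow> F \<subset> G' \<Longrightarrow>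
      x F * chow_relations.up L x G' ^ (c G' - c F) \<in> ring_ideal V G"
    and rel0: "\<And>G'. G' \<in> L \<Longrightarrow> chow_relations.up L x G' ^ c G' \<in> ring_ideal V G"
    and form: "\<And>F. F \<in> L \<Longrightarrow> keys (x F) \<subseteq> monomials V 1"
    and gen: "\<And>v. v \<in> V \<Longrightarrow> \<exists>S\<subseteq>L. single {#v#} 1 - (\<Sum>K\<in>S. x K) \<in> ring_ideal V G"
  shows "hilb_coeff V G j \<le> card (fy_mono L c j)"
proof -
  interpret chow_relations L x "ring_ideal V G" by (rule R)
  define X where "X m = (\<Prod>F\<in>#m. x F)" for m
  define B where "B = (\<lambda>m. lookup (X m)) ` fy_mono L c j"
  have finB: "finite B" unfolding B_def using finite_fy_mono[OF finite_L] by simp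
  have keysX: "keys (X m) \<subseteq> monomials V (size m)" if "set_mset m \<subseteq> L" for m
    using that
  proof (induction m)
    case empty
    then show ?case by (simp add: X_def monomials_def)
  next
    case (add F m)
    show ?case
    proof
      fix k assume "k \<in> keys (X (add_mset F m))"
      then have "k \<in> keys (x F * X m)" by (simp add: X_def)
      then show "k \<in> monomials V (size (add_mset F m))"
        by (rule keys_mult_all[rotated 3, where A = "\<lambda>k. k \<in> monomials V 1" and B = "\<lambda>k. k \<in> monomials V (size m)"])
           (use add form[of F] in \<open>auto simp: monomials_def\<close>)
    qed
  qed
  have Bf: "B \<subseteq> forms V j"
  proof
    fix b assume "b \<in> B"
    then obtain m where m: "m \<in> fy_mono L c j" "b = lookup (X m)" by (auto simp: B_def)
    then have "keys (X m) \<subseteq> monomials V j" using keysX[of m] by (auto simp: fy_mono_def)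
    then show "b \<in> forms V j" using m by (auto simp: forms_def in_keys_iff)
  qed
  define A where "A = {p. \<exists>b\<in>Q.span B. lookup p - b \<in> gen_ideal V G}"
  have JA: "ring_ideal V G \<subseteq> A"
    unfolding A_def ring_ideal_def using Q.span_zero by (auto intro!: bexI[of _ 0])
  have A_diff: "p - q \<in> A" if pq: "p \<in> A" "q \<in> A" for p q
  proof -
    obtain b where b: "b \<in> Q.span B" "lookup p - b \<in> gen_ideal V G" using pq by (auto simp: A_def)
    obtain b' where b': "b' \<in> Q.span B" "lookup q - b' \<in> gen_ideal V G" using pq by (auto simp: A_def)
    have "(lookup p - b) - (lookup q - b') \<in> gen_ideal V G"
      using b(2) b'(2) unfolding gen_ideal_def by (rule Q.span_diff)
    then have "lookup (p - q) - (b - b') \<in> gen_ideal V G" by (simp add: lookup_diff_fun algebra_simps)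
    moreover have "b - b' \<in> Q.span B" using b(1) b'(1) by (rule Q.span_diff)
    ultimately show ?thesis by (auto simp: A_def)
  qed
  have A_fy: "(\<Prod>F\<in>#m. x F) \<in> A" if "m \<in> fy_mono L c j" for m
  proof -
    have "lookup (X m) \<in> Q.span B" using that by (intro Q.span_base) (simp add: B_def)
    moreover have "lookup (X m) - lookup (X m) \<in> gen_ideal V G" by (simp add: gen_ideal_def Q.span_zero)
    ultimately show ?thesis unfolding A_def X_def[symmetric] by blast
  qed
  have A_add: "p + q \<in> A" if "p \<in> A" "q \<in> A" for p q
    using A_diff[OF that(1) A_diff[OF _ that(2)], of 0] JA J_zero by auto
  have A_sum: "(\<Sum>a\<in>S. f a) \<in> A" if "\<And>a. a \<in> S \<Longrightarrow> f a \<in> A" for S and f :: "'b set \<Rightarrow> _"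
    using that by (induction S rule: infinite_finite_induct) (use A_add JA J_zero in auto)
  have prods: "X m \<in> A" if "set_mset m \<subseteq> L" "size m = j" for m
    unfolding X_def by (rule fy_mono_reduce[OF JA A_diff rel rel0 A_fy that])
  \<comment> \<open>Variables are rewritten one at a time: \<open>u\<close> holds those still to be
    treated, \<open>X m\<close> the product obtained so far.\<close>
  have mixed: "single u 1 * X m \<in> A" if "set_mset u \<subseteq> V" "set_mset m \<subseteq> L" "size u + size m = j" for u m
    using that
  proof (induction u arbitrary: m)
    case empty
    then show ?case using prods by simp
  next
    case (add v u)
    then obtain S where S: "S \<subseteq> L" "single {#v#} 1 - (\<Sum>K\<in>S. x K) \<in> ring_ideal V G"
      using gen[of v] by auto
    have "single u 1 * (X m * (single {#v#} 1 - (\<Sum>K\<in>S. x K))) \<in> ring_ideal V G"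
      using add.prems S(2) J_mult_prod[of m] by (intro ring_ideal_mult) (auto simp: X_def)
    moreover have "(\<Sum>K\<in>S. single u 1 * X (add_mset K m)) \<in> A"
      using add S(1) by (intro A_sum add.IH) auto
    ultimately have "single u 1 * (X m * (single {#v#} 1 - (\<Sum>K\<in>S. x K))) + (\<Sum>K\<in>S. single u 1 * X (add_mset K m)) \<in> A"
      using JA A_add by blast
    moreover have "(\<Sum>K\<in>S. single u 1 * X (add_mset K m)) = single u 1 * (X m * (\<Sum>K\<in>S. x K))"
    proof -
      have "single u 1 * X (add_mset K m) = single u 1 * X m * x K" for K by (simp add: X_def mult_ac)
      then show ?thesis by (simp only: sum_distrib_left[symmetric] mult.assoc)
    qed
    moreover have "single (add_mset v u) 1 = single u 1 * (single {#v#} 1 :: 'v multiset \<Rightarrow>\<^sub>0 rat)"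
      by (simp add: mult_single)
    ultimately show ?case by (simp add: algebra_simps)
  qed
  have "hilb_coeff V G j \<le> card B"
  proof (rule hilb_coeff_le[OF V G finB Bf])
    fix m assume "m \<in> monomials V j"
    then have "single m 1 \<in> A" using mixed[of m "{#}"] by (simp add: X_def monomials_def)
    then show "\<exists>b\<in>Q.span B. pmono m - b \<in> gen_ideal V G" by (simp add: A_def lookup_single_fun)
  qed
  also have "\<dots> \<le> card (fy_mono L c j)" unfolding B_def
    using finite_fy_mono[OF finite_L] by (rule card_image_le)
  finally show ?thesis .
qed

section \<open>Ranks and flats of a loopless matroid\<close>

locale loopless_matroid =
  fixes E :: "'a set" and indep :: "'a set \<Rightarrow> bool"
  assumes matroid: "matroid E indep" and loopless: "loopless E indep" and nonempty: "E \<noteq> {}"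
begin

abbreviation "rk \<equiv> mrank indep"
abbreviation "Fl \<equiv> flats E indep"

lemma finite_E: "finite E" and indep_empty: "indep {}" and indep_sub: "indep I \<Longrightarrow> I \<subseteq> E"
  and indep_mono: "indep J \<Longrightarrow> I \<subseteq> J \<Longrightarrow> indep I"
  and indep_augment: "indep I \<Longrightarrow> indep J \<Longrightarrow> card I < card J \<Longrightarrow> \<exists>e\<in>J - I. indep (insert e I)"
  using matroid unfolding matroid_def by blast+

lemma indep_finite: "indep I \<Longrightarrow> finite I"
  by (rule finite_subset[OF indep_sub finite_E])

lemma rank_set_finite: "finite {card I |I. I \<subseteq> X \<and> indep I}"
proof -
  have "{card I |I. I \<subseteq> X \<and> indep I} \<subseteq> card ` Pow E" using indep_sub by auto
  then show ?thesis using finite_E finite_subset by blast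
qed

lemma card_le_rk: "indep I \<Longrightarrow> I \<subseteq> X \<Longrightarrow> card I \<le> rk X"
  unfolding mrank_def using rank_set_finite by (intro Max_ge) auto

lemma ex_basis: obtains I where "indep I" "I \<subseteq> X" "card I = rk X"
proof -
  have "rk X \<in> {card I |I. I \<subseteq> X \<and> indep I}"
    unfolding mrank_def using rank_set_finite indep_empty by (intro Max_in) auto
  then show ?thesis using that by auto
qed

lemma rk_mono: "X \<subseteq> Y \<Longrightarrow> rk X \<le> rk Y"
  by (metis ex_basis card_le_rk order_trans)

lemma extend_basis:
  assumes "indep I" "I \<subseteq> X"
  obtains B where "indep B" "I \<subseteq> B" "B \<subseteq> X" "card B = rk X"
proof -
  have "\<exists>B. indep B \<and> I \<subseteq> B \<and> B \<subseteq> X \<and> card B = rk X"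
    using assms
  proof (induction "rk X - card I" arbitrary: I rule: less_induct)
    case less
    show ?case
    proof (cases "card I = rk X")
      case False
      then have lt: "card I < rk X" using card_le_rk[OF less.prems] by simp
      obtain K where K: "indep K" "K \<subseteq> X" "card K = rk X" by (rule ex_basis)
      then obtain e where e: "e \<in> K - I" "indep (insert e I)" using indep_augment less.prems lt by metis
      have "finite I" using less.prems(1) by (rule indep_finite)
      then have "rk X - card (insert e I) < rk X - card I" using e lt by simp
      then obtain B where "indep B" "insert e I \<subseteq> B" "B \<subseteq> X" "card B = rk X"
        using less.hyps[of "insert e I"] e K less.prems by blast
      then show ?thesis by blast
    qed (use less.prems in blast)
  qed
  then show ?thesis using that by blast
qed

text \<open>Extend a basis of \<open>X\<close> to one of \<open>Y\<close>. Augmenting the latter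
  inside \<open>insert e Y\<close> can only add \<open>e\<close>, so \<open>e\<close> extends the
  smaller basis as well.\<close>

lemma rk_insert_mono:
  assumes "X \<subseteq> Y" "rk Y < rk (insert e Y)"
  shows "rk X < rk (insert e X)"
proof -
  obtain I where I: "indep I" "I \<subseteq> X" "card I = rk X" by (rule ex_basis)
  have "I \<subseteq> Y" using I assms(1) by blast
  with I(1) obtain I' where I': "indep I'" "I \<subseteq> I'" "I' \<subseteq> Y" "card I' = rk Y" by (rule extend_basis)
  obtain K where K: "indep K" "K \<subseteq> insert e Y" "card K = rk (insert e Y)" by (rule ex_basis)
  have "card I' < card K" using K I' assms(2) by simp
  then obtain f where f: "f \<in> K - I'" "indep (insert f I')" using indep_augment[OF I'(1) K(1)] by blast
  have finI': "finite I'" using I'(1) by (rule indep_finite)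
  have "f = e"
  proof (rule ccontr)
    assume "f \<noteq> e"
    then have "card (insert f I') \<le> rk Y" using f K I' by (intro card_le_rk) auto
    then show False using f I' finI' by simp
  qed
  then have "insert e I \<subseteq> insert f I'" "e \<notin> I" using f(1) I'(2) by auto
  then have "indep (insert e I)" "e \<notin> I" using indep_mono[OF f(2)] by auto
  moreover have "finite I" using I(1) by (rule indep_finite)
  ultimately show ?thesis using card_le_rk[of "insert e I" "insert e X"] I(2,3) by (simp add: subset_insertI2 Suc_le_eq)
qed

lemma flat_sub: "F \<in> Fl \<Longrightarrow> F \<subseteq> E"
  by (simp add: flats_def)

lemma E_flat: "E \<in> Fl"
  by (simp add: flats_def)

lemma flat_rk_insert: "F \<in> Fl \<Longrightarrow> e \<in> E \<Longrightarrow> e \<notin> F \<Longrightarrow> rk F < rk (insert e F)"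
  by (simp add: flats_def)

lemma flat_rk_inter:
  assumes "F \<in> Fl" "F \<subseteq> K" "i \<in> K \<inter> G" "i \<notin> F" "K \<subseteq> E"
  shows "rk (F \<inter> G) < rk (K \<inter> G)"
proof -
  have "rk (F \<inter> G) < rk (insert i (F \<inter> G))"
    by (rule rk_insert_mono[of _ F]) (use flat_rk_insert assms in auto)
  also have "\<dots> \<le> rk (K \<inter> G)" using assms by (intro rk_mono) auto
  finally show ?thesis .
qed

lemma rk_pos: "i \<in> X \<Longrightarrow> i \<in> E \<Longrightarrow> 0 < rk X"
  using card_le_rk[of "{i}" X] loopless by (auto simp: loopless_def)

lemma rk_strict: "F \<in> Fl \<Longrightarrow> F \<subset> X \<Longrightarrow> X \<subseteq> E \<Longrightarrow> rk F < rk X"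
  using flat_rk_inter[of F X _ X] by (auto simp: Int_absorb2)

lemma red_chow_hilb_le: "red_chow_hilb E indep j \<le> card (fy_mono (Fl - {{}}) rk j)"
proof -
  let ?V = "chow_vars E indep" and ?L = "Fl - {{}}"
  let ?J = "ring_ideal ?V (chow_gens E indep)"
  obtain i0 where i0: "i0 \<in> E" using nonempty by blast
  \<comment> \<open>With this \<open>x E\<close>, the sum of the \<open>x K\<close> over all flats
    containing \<open>i\<close>, now including \<open>E\<close>, is the linear generator for
    \<open>i\<close> and \<open>i0\<close>.\<close>
  define x :: "'a set \<Rightarrow> ('a set multiset \<Rightarrow>\<^sub>0 rat)" where
    "x F = (if F = E then - (\<Sum>K\<in>{K \<in> ?V. i0 \<in> K}. single {#K#} 1) else single {#F#} 1)" for F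
  have finV: "finite ?V" using finite_chow_vars finite_E by blast
  have L: "?L = insert E ?V" "E \<notin> ?V" using E_flat nonempty by (auto simp: chow_vars_def)
  have xV: "x F = single {#F#} 1" if "F \<in> ?V" for F using that L by (auto simp: x_def)
  have var: "single {#v#} 1 * p \<in> ?J" if "v \<in> ?V" "p \<in> ?J" for v p
    using ring_ideal_mult[OF that(2), of "{#v#}"] that by simp
  interpret chow_relations ?L x ?J
  proof
    show "finite ?L" using finV L by simp
    show "x F * p \<in> ?J" if F: "F \<in> ?L" "p \<in> ?J" for F p
    proof (cases "F = E")
      case True
      show ?thesis unfolding True x_def
        by (simp add: sum_distrib_right) (intro ring_ideal_uminus ring_ideal_sum var; use F in auto)
    qed (use F L var xV in auto)
    show "x F * x G \<in> ?J" if FG: "F \<in> ?L" "G \<in> ?L" "\<not> F \<subseteq> G" "\<not> G \<subseteq> F" for F G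
    proof -
      have "F \<noteq> E" "G \<noteq> E" using FG flat_sub by auto
      then have V: "F \<in> ?V" "G \<in> ?V" using FG L by auto
      then have "pmono {#F, G#} \<in> chow_gens E indep" unfolding chow_gens_def using FG(3,4) by blast
      then have "pmono {#F, G#} \<in> gen_ideal ?V (chow_gens E indep)" by (rule gens_gen_ideal)
      moreover have "lookup (x F * x G) = pmono {#F, G#}"
        using V by (simp add: xV mult_single lookup_single_fun add_mset_commute)
      ultimately show ?thesis by (simp add: ring_ideal_def)
    qed
  qed (auto simp: ring_ideal_zero ring_ideal_diff)
  have lin: "(\<Sum>K | K \<in> ?L \<and> i \<in> K. x K) \<in> ?J" if i: "i \<in> E" for i
  proof -
    have eq: "{K. K \<in> ?L \<and> i \<in> K} = insert E {K \<in> ?V. i \<in> K}" using L i by auto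
    have "(\<Sum>K | K \<in> ?L \<and> i \<in> K. x K) = (\<Sum>K\<in>{K \<in> ?V. i \<in> K}. single {#K#} 1) - (\<Sum>K\<in>{K \<in> ?V. i0 \<in> K}. single {#K#} 1)"
      unfolding eq using finV L by (subst sum.insert) (auto simp: xV x_def[of E])
    then have "lookup (\<Sum>K | K \<in> ?L \<and> i \<in> K. x K) = (\<Sum>F\<in>{F \<in> ?V. i \<in> F}. pvar F) - (\<Sum>F\<in>{F \<in> ?V. i0 \<in> F}. pvar F)"
      by (simp add: lookup_diff_fun fun_eq_iff lookup_sum sum_fun_apply pvar_pmono lookup_single_fun[symmetric])
    moreover have "\<dots> \<in> chow_gens E indep" unfolding chow_gens_def using i i0 by blast
    ultimately show ?thesis using gens_gen_ideal by (simp add: ring_ideal_def)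
  qed
  interpret chow_flats ?L x ?J E rk
  proof
    show "rk (F \<inter> G) < rk (K \<inter> G)" if "F \<in> ?L" "K \<in> ?L" "G \<in> ?L" "F \<subseteq> K" "i \<in> K \<inter> G" "i \<notin> F" for F K G i
      using flat_rk_inter[of F K i G] that flat_sub by auto
    show "x F * (\<Sum>K | K \<in> ?L \<and> i \<in> K. x K) \<in> ?J" if "F \<in> ?L" "i \<in> E" for F i
      using J_mult lin that by blast
  qed (use L flat_sub in auto)
  show ?thesis unfolding red_chow_hilb_def
  proof (rule hilb_coeff_le_fy[OF finV chow_gens_polys chow_relations_axioms chain_relation])
    show "up G ^ rk G \<in> ?J" if G: "G \<in> ?L" for G
    proof -
      obtain i where i: "i \<in> G" "i \<in> E" using G flat_sub by blast
      show ?thesis using up_power_in_reduced[OF G i(1) lin[OF i(2)]] rk_pos i by blast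
    qed
    show "keys (x F) \<subseteq> monomials ?V 1" if F: "F \<in> ?L" for F
    proof (cases "F = E")
      case True
      have "keys (x E) = keys (\<Sum>K\<in>{K \<in> ?V. i0 \<in> K}. single {#K#} (1::rat))"
        by (simp add: x_def Poly_Mapping.keys_def)
      also have "\<dots> \<subseteq> (\<Union>K\<in>{K \<in> ?V. i0 \<in> K}. keys (single {#K#} (1::rat)))" by (rule keys_sum)
      finally show ?thesis using True by (auto simp: monomials_def)
    next
      case False
      then have "F \<in> ?V" using F L by auto
      then show ?thesis by (simp add: xV monomials_def)
    qed
    show "\<exists>S\<subseteq>?L. single {#v#} 1 - (\<Sum>K\<in>S. x K) \<in> ?J" if "v \<in> ?V" for v
      using that L xV J_zero by (intro exI[of _ "{v}"]) auto
  qed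
qed

lemma aug_chow_hilb_le: "aug_chow_hilb E indep j \<le> card (fy_mono Fl (\<lambda>F. Suc (rk F)) j)"
proof -
  let ?V = "aug_vars E indep" and ?P = "Fl - {E}"
  let ?J = "ring_ideal ?V (aug_gens E indep)"
  \<comment> \<open>This \<open>x E\<close> makes all \<open>x K\<close> sum to 0 exactly, so the
    sum over \<open>K\<close> containing \<open>i\<close> is minus the sum over \<open>K\<close>
    avoiding \<open>i\<close>, which is \<open>- y i\<close> modulo the ideal.\<close>
  define x :: "'a set \<Rightarrow> (('a set + 'a) multiset \<Rightarrow>\<^sub>0 rat)" where
    "x F = (if F = E then - (\<Sum>K\<in>?P. single {#Inl K#} 1) else single {#Inl F#} 1)" for F
  define y :: "'a \<Rightarrow> (('a set + 'a) multiset \<Rightarrow>\<^sub>0 rat)" where "y i = single {#Inr i#} 1" for i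
  have finV: "finite ?V" using finite_aug_vars finite_E by blast
  have finL: "finite Fl" using finite_flats finite_E by blast
  have L: "Fl = insert E ?P" using E_flat by auto
  have V: "Inl F \<in> ?V \<longleftrightarrow> F \<in> ?P" "Inr i \<in> ?V \<longleftrightarrow> i \<in> E" for F i by (auto simp: aug_vars_def)
  have xV: "x F = single {#Inl F#} 1" if "F \<in> ?P" for F using that by (auto simp: x_def)
  have var: "single {#v#} 1 * p \<in> ?J" if "v \<in> ?V" "p \<in> ?J" for v p
    using ring_ideal_mult[OF that(2), of "{#v#}"] that by simp
  interpret chow_relations Fl x ?J
  proof
    show "finite Fl" by (rule finL)
    show "x F * p \<in> ?J" if F: "F \<in> Fl" "p \<in> ?J" for F p
    proof (cases "F = E")
      case True
      show ?thesis unfolding True x_def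
        by (simp add: sum_distrib_right) (intro ring_ideal_uminus ring_ideal_sum var; use F V in auto)
    qed (use F V var xV in auto)
    show "x F * x G \<in> ?J" if FG: "F \<in> Fl" "G \<in> Fl" "\<not> F \<subseteq> G" "\<not> G \<subseteq> F" for F G
    proof -
      have P: "F \<in> ?P" "G \<in> ?P" using FG flat_sub by auto
      then have "pmono {#Inl F, Inl G#} \<in> aug_gens E indep" unfolding aug_gens_def using FG(3,4) by blast
      then have "pmono {#Inl F, Inl G#} \<in> gen_ideal ?V (aug_gens E indep)" by (rule gens_gen_ideal)
      moreover have "lookup (x F * x G) = pmono {#Inl F, Inl G#}"
        using P by (simp add: xV mult_single lookup_single_fun add_mset_commute)
      ultimately show ?thesis by (simp add: ring_ideal_def)
    qed
  qed (auto simp: ring_ideal_zero ring_ideal_diff)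
  have sum0: "(\<Sum>K\<in>Fl. x K) = 0"
  proof -
    have "(\<Sum>K\<in>Fl. x K) = x E + (\<Sum>K\<in>?P. x K)"
      using finL E_flat by (rule sum.remove)
    also have "(\<Sum>K\<in>?P. x K) = (\<Sum>K\<in>?P. single {#Inl K#} 1)" by (rule sum.cong) (auto simp: xV)
    finally show ?thesis by (simp add: x_def[of E])
  qed
  have y: "y i - (\<Sum>K\<in>{K \<in> ?P. i \<notin> K}. x K) \<in> ?J" if i: "i \<in> E" for i
  proof -
    have "(\<Sum>K\<in>{K \<in> ?P. i \<notin> K}. x K) = (\<Sum>K\<in>{K \<in> ?P. i \<notin> K}. single {#Inl K#} 1)"
      by (rule sum.cong) (auto simp: xV)
    then have "lookup (y i - (\<Sum>K\<in>{K \<in> ?P. i \<notin> K}. x K)) = pvar (Inr i) - (\<Sum>K\<in>{K \<in> ?P. i \<notin> K}. pvar (Inl K))"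
      by (simp add: y_def lookup_diff_fun fun_eq_iff lookup_sum sum_fun_apply pvar_pmono lookup_single_fun[symmetric])
    moreover have "\<dots> \<in> aug_gens E indep" unfolding aug_gens_def using i by blast
    ultimately show ?thesis using gens_gen_ideal by (simp add: ring_ideal_def)
  qed
  have xy: "x F * y i \<in> ?J" if F: "F \<in> Fl" "i \<in> E" "i \<notin> F" for F i
  proof -
    have P: "F \<in> ?P" using F by auto
    then have "pmono {#Inr i, Inl F#} \<in> aug_gens E indep" unfolding aug_gens_def using F(2,3) by blast
    then have "pmono {#Inr i, Inl F#} \<in> gen_ideal ?V (aug_gens E indep)" by (rule gens_gen_ideal)
    moreover have "lookup (x F * y i) = pmono {#Inr i, Inl F#}"
      using P by (simp add: xV y_def mult_single lookup_single_fun add_mset_commute)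
    ultimately show ?thesis by (simp add: ring_ideal_def)
  qed
  interpret chow_flats Fl x ?J E rk
  proof
    show "rk (F \<inter> G) < rk (K \<inter> G)" if "F \<in> Fl" "K \<in> Fl" "G \<in> Fl" "F \<subseteq> K" "i \<in> K \<inter> G" "i \<notin> F" for F K G i
      using flat_rk_inter[of F K i G] that flat_sub by auto
    show "x F * (\<Sum>K | K \<in> Fl \<and> i \<in> K. x K) \<in> ?J" if F: "F \<in> Fl" "i \<in> E" "i \<notin> F" for F i
    proof -
      let ?N = "{K \<in> ?P. i \<notin> K}"
      have "Fl = {K. K \<in> Fl \<and> i \<in> K} \<union> ?N" using F by auto
      then have "(\<Sum>K | K \<in> Fl \<and> i \<in> K. x K) + (\<Sum>K\<in>?N. x K) = 0"
        using sum0 finL by (subst sum.union_disjoint[symmetric]) auto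
      then have eq: "(\<Sum>K | K \<in> Fl \<and> i \<in> K. x K) = (y i - (\<Sum>K\<in>?N. x K)) - y i" 
        by (simp add: eq_neg_iff_add_eq_0)
      have "x F * (y i - (\<Sum>K\<in>?N. x K)) - x F * y i \<in> ?J"
        by (intro J_diff J_mult y xy F)
      then show ?thesis unfolding eq right_diff_distrib[of "x F" _ "y i"] .
    qed
  qed (use E_flat flat_sub in auto)
  show ?thesis unfolding aug_chow_hilb_def
  proof (rule hilb_coeff_le_fy[OF finV aug_gens_polys chow_relations_axioms])
    show "x F * up G ^ (Suc (rk G) - Suc (rk F)) \<in> ?J" if "F \<in> Fl" "G \<in> Fl" "F \<subset> G" for F G
      using chain_relation[OF that] by simp
    show "up G ^ Suc (rk G) \<in> ?J" if "G \<in> Fl" for G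
      by (rule up_power_in_augmented[OF that sum0])
    show "keys (x F) \<subseteq> monomials ?V 1" if F: "F \<in> Fl" for F
    proof (cases "F = E")
      case True
      have "keys (x E) = keys (\<Sum>K\<in>?P. single {#Inl K :: 'a set + 'a#} (1::rat))"
        by (simp add: x_def Poly_Mapping.keys_def)
      also have "\<dots> \<subseteq> (\<Union>K\<in>?P. keys (single {#Inl K#} (1::rat)))" by (rule keys_sum)
      finally show ?thesis using True V by (auto simp: monomials_def)
    next
      case False
      then have "F \<in> ?P" using F by auto
      then show ?thesis using V by (simp add: xV monomials_def)
    qed
    show "\<exists>S\<subseteq>Fl. single {#v#} 1 - (\<Sum>K\<in>S. x K) \<in> ?J" if v: "v \<in> ?V" for v
    proof (cases v)
      case (Inl F)
      then have "F \<in> ?P" using v V by blast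
      then show ?thesis using Inl xV J_zero by (intro exI[of _ "{F}"]) auto
    next
      case (Inr i)
      then have "i \<in> E" using v V by blast
      then show ?thesis using y[of i] Inr by (intro exI[of _ "{K \<in> ?P. i \<notin> K}"]) (auto simp: y_def)
    qed
  qed
qed

end

section \<open>Comparison with the uniform matroid\<close>

context loopless_matroid begin

text \<open>Induction with the largest set removed: the basis of the next largest set contains all
  the smaller ones and extends to a basis of the largest.\<close>

lemma ex_nested_bases:
  assumes "finite S" "\<And>F G. F \<in> S \<Longrightarrow> G \<in> S \<Longrightarrow> F \<subseteq> G \<or> G \<subseteq> F"
  shows "\<exists>B. (\<forall>F\<in>S. indep (B F) \<and> B F \<subseteq> F \<and> card (B F) = rk F) \<and>
    (\<forall>F\<in>S. \<forall>G\<in>S. F \<subseteq> G \<longrightarrow> B F \<subseteq> B G)"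
  using assms
proof (induction "card S" arbitrary: S rule: less_induct)
  case less
  show ?case
  proof (cases "S = {}")
    case False
    then obtain M where M: "M \<in> S" "\<And>F. F \<in> S \<Longrightarrow> M \<subseteq> F \<Longrightarrow> F = M"
      using finite_has_maximal[OF less.prems(1)] by metis
    have top: "F \<subseteq> M" if "F \<in> S" for F using M less.prems(2)[OF that M(1)] that by blast
    let ?S = "S - {M}"
    have "card ?S < card S" using less.prems(1) M(1) by (rule card_Diff1_less)
    then have "\<exists>B. (\<forall>F\<in>?S. indep (B F) \<and> B F \<subseteq> F \<and> card (B F) = rk F) \<and>
        (\<forall>F\<in>?S. \<forall>G\<in>?S. F \<subseteq> G \<longrightarrow> B F \<subseteq> B G)"
      by (rule less.hyps) (use less.prems in simp_all)
    then obtain B where "\<forall>F\<in>?S. indep (B F) \<and> B F \<subseteq> F \<and> card (B F) = rk F"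
      "\<forall>F\<in>?S. \<forall>G\<in>?S. F \<subseteq> G \<longrightarrow> B F \<subseteq> B G"
      by (elim exE conjE)
    then have B: "\<And>F. F \<in> ?S \<Longrightarrow> indep (B F) \<and> B F \<subseteq> F \<and> card (B F) = rk F"
      "\<And>F G. F \<in> ?S \<Longrightarrow> G \<in> ?S \<Longrightarrow> F \<subseteq> G \<Longrightarrow> B F \<subseteq> B G"
      by blast+
    obtain I where I: "indep I" "I \<subseteq> M" "\<And>F. F \<in> ?S \<Longrightarrow> B F \<subseteq> I"
    proof (cases "?S = {}")
      case True
      then show ?thesis using that[of "{}"] indep_empty by blast
    next
      case False
      then obtain N where N: "N \<in> ?S" "\<And>F. F \<in> ?S \<Longrightarrow> N \<subseteq> F \<Longrightarrow> F = N"
        using finite_has_maximal[of ?S] less.prems(1) by (metis finite_Diff)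
      have "B F \<subseteq> B N" if "F \<in> ?S" for F
        using B(2)[OF that N(1)] N(2)[OF that] less.prems(2)[of F N] N(1) that by blast
      moreover have "B N \<subseteq> M" using B(1)[OF N(1)] top[of N] N(1) by blast
      ultimately show ?thesis using that[of "B N"] B(1)[OF N(1)] by blast
    qed
    obtain K where K: "indep K" "I \<subseteq> K" "K \<subseteq> M" "card K = rk M"
      using I(1,2) by (rule extend_basis)
    show ?thesis
    proof (intro exI[of _ "B(M := K)"] conjI ballI impI)
      fix F G assume FG: "F \<in> S" "G \<in> S" "F \<subseteq> G"
      show "(B(M := K)) F \<subseteq> (B(M := K)) G"
      proof (cases "G = M")
        case True
        then show ?thesis using I(3)[of F] K(2) FG by (cases "F = M") auto
      next
        case False
        then have "F \<noteq> M" using FG M by blast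
        then show ?thesis using B(2)[of F G] FG False by simp
      qed
    qed (use B(1) K in auto)
  qed simp
qed

text \<open>The matroid closure; it recovers a flat from any of its bases.\<close>

definition span_of :: "'a set \<Rightarrow> 'a set" where
  "span_of B = {e \<in> E. rk (insert e B) \<le> rk B}"

lemma span_of_basis:
  assumes F: "F \<in> Fl" and B: "indep B" "B \<subseteq> F" "card B = rk F"
  shows "span_of B = F"
proof -
  have rB: "rk B = rk F" using card_le_rk[OF B(1) order_refl] rk_mono[OF B(2)] B(3) by simp
  have "rk (insert e B) \<le> rk B \<longleftrightarrow> e \<in> F" if e: "e \<in> E" for e
  proof
    assume "e \<in> F"
    then show "rk (insert e B) \<le> rk B" using rB rk_mono[of "insert e B" F] B(2) by simp
  next
    assume le: "rk (insert e B) \<le> rk B"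
    show "e \<in> F"
      using rk_insert_mono[OF B(2) flat_rk_insert[OF F e]] le by (meson not_le)
  qed
  then show ?thesis using flat_sub[OF F] by (auto simp: span_of_def)
qed

text \<open>Each flat is replaced by the image of a basis, which preserves inclusions, exponents and
  the values of \<open>c\<close>. The bases depend on \<open>m\<close>, but decoding by closure does
  not, so the map on monomials is injective.\<close>

lemma card_fy_mono_le:
  fixes emb :: "'a set \<Rightarrow> 'c set"
  assumes L: "L \<subseteq> Fl" and finite_T: "finite T"
    and emb: "\<And>A B. A \<subseteq> E \<Longrightarrow> B \<subseteq> E \<Longrightarrow> emb A \<subseteq> emb B \<longleftrightarrow> A \<subseteq> B"
    and proper: "\<And>F B. F \<in> L \<Longrightarrow> F \<noteq> E \<Longrightarrow> B \<subseteq> E \<Longrightarrow> card B = rk F \<Longrightarrow> emb B \<in> T \<and> emb B \<noteq> emb E \<and> c' (emb B) = c F"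
    and top: "emb E \<in> T" "c' (emb E) = c E"
    and Z: "\<And>B. Z \<subseteq> emb B"
  shows "card (fy_mono L c j) \<le> card {m \<in> fy_mono T c' j. \<forall>F\<in>#m. Z \<subseteq> F}"
proof -
  have emb_eq: "emb A = emb B \<longleftrightarrow> A = B" if "A \<subseteq> E" "B \<subseteq> E" for A B
    using emb[of A B] emb[of B A] that by auto
  have "\<forall>m\<in>fy_mono L c j. \<exists>B. (\<forall>F\<in>set_mset m. indep (B F) \<and> B F \<subseteq> F \<and> card (B F) = rk F) \<and>
    (\<forall>F\<in>set_mset m. \<forall>G\<in>set_mset m. F \<subseteq> G \<longrightarrow> B F \<subseteq> B G)"
    by (intro ballI ex_nested_bases) (auto simp: fy_mono_def)
  then obtain B where B: "\<And>m F. m \<in> fy_mono L c j \<Longrightarrow> F \<in># m \<Longrightarrow> indep (B m F) \<and> B m F \<subseteq> F \<and> card (B m F) = rk F"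
    and B_mono: "\<And>m F G. m \<in> fy_mono L c j \<Longrightarrow> F \<in># m \<Longrightarrow> G \<in># m \<Longrightarrow> F \<subseteq> G \<Longrightarrow> B m F \<subseteq> B m G"
    by metis
  \<comment> \<open>\<open>E\<close> is sent to \<open>E\<close> and not to a basis: a set of
    \<open>rk E\<close> elements is not a proper flat of the uniform matroid.\<close>
  define \<beta> where "\<beta> m F = (if F = E then E else B m F)" for m F
  define h where "h m = image_mset (\<lambda>F. emb (\<beta> m F)) m" for m
  define dec where "dec X = (if X = emb E then E else span_of (inv_into (Pow E) emb X))" for X
  have mem: "F \<in> L" "F \<subseteq> E" if "m \<in> fy_mono L c j" "F \<in># m" for m F
    using that L flat_sub by (auto simp: fy_mono_def)
  have BE: "B m F \<subseteq> E" if "m \<in> fy_mono L c j" "F \<in># m" for m F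
    using B[OF that] mem[OF that] by blast
  have \<beta>E: "\<beta> m F \<subseteq> E" if "m \<in> fy_mono L c j" "F \<in># m" for m F
    using BE[OF that] by (simp add: \<beta>_def)
  have emb_inj: "inj_on emb (Pow E)" using emb_eq by (auto simp: inj_on_def)
  have dec: "dec (emb (\<beta> m F)) = F" if m: "m \<in> fy_mono L c j" "F \<in># m" for m F
  proof (cases "F = E")
    case False
    have "emb (B m F) \<noteq> emb E" using proper[OF mem(1)[OF m] False BE[OF m]] B[OF m] by blast
    then show ?thesis using False BE[OF m] B[OF m] mem[OF m] L
      by (simp add: dec_def \<beta>_def inv_into_f_f[OF emb_inj]) (intro span_of_basis, auto)
  qed (simp add: dec_def \<beta>_def)
  have \<beta>_props: "emb (\<beta> m F) \<in> T" "c' (emb (\<beta> m F)) = c F" if m: "m \<in> fy_mono L c j" "F \<in># m" for m F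
    using proper[OF mem(1)[OF m] _ BE[OF m]] B[OF m] top by (auto simp: \<beta>_def)
  have \<beta>_mono: "\<beta> m F \<subseteq> \<beta> m G" if "m \<in> fy_mono L c j" "F \<in># m" "G \<in># m" "F \<subseteq> G" for m F G
    using B_mono[OF that] BE[OF that(1,2)] mem(2)[OF that(1,3)] that(4) by (auto simp: \<beta>_def)
  have h_inj: "inj_on h (fy_mono L c j)"
  proof (rule inj_on_inverseI)
    fix m assume m: "m \<in> fy_mono L c j"
    have "image_mset dec (h m) = image_mset (\<lambda>F. F) m"
      unfolding h_def image_mset.compositionality comp_def by (rule image_mset_cong) (simp add: dec[OF m])
    then show "image_mset dec (h m) = m" by simp
  qed
  have h_fy: "h m \<in> {m \<in> fy_mono T c' j. \<forall>F\<in>#m. Z \<subseteq> F}" if m: "m \<in> fy_mono L c j" for m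
  proof -
    let ?f = "\<lambda>F. emb (\<beta> m F)"
    have inj: "inj_on ?f (set_mset m)" by (rule inj_on_inverseI[of _ dec]) (rule dec[OF m])
    have cnt: "count (h m) (?f G) = count m G" if "G \<in># m" for G
    proof -
      have "?f -` {?f G} \<inter> set_mset m = {G}" using inj that by (auto simp: inj_on_def)
      then show ?thesis by (simp add: h_def count_image_mset)
    qed
    have chain: "F \<subseteq> G \<or> G \<subseteq> F" if "F \<in># m" "G \<in># m" for F G using m that by (auto simp: fy_mono_def)
    have fe: "?f F \<subseteq> ?f G" if "F \<in># m" "G \<in># m" "F \<subseteq> G" for F G
      using \<beta>_mono[OF m that] emb[OF \<beta>E[OF m that(1)] \<beta>E[OF m that(2)]] by simp
    have "h m \<in> fy_mono T c' j"
      unfolding fy_mono_def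
    proof (intro CollectI conjI ballI impI)
      show "set_mset (h m) \<subseteq> T" using \<beta>_props(1)[OF m] by (auto simp: h_def)
      show "size (h m) = j" using m by (simp add: h_def fy_mono_def)
      fix X assume "X \<in># h m"
      then obtain G where G: "G \<in># m" "X = ?f G" by (auto simp: h_def)
      show "count (h m) X < c' X" using cnt[OF G(1)] \<beta>_props(2)[OF m G(1)] m G by (simp add: fy_mono_def)
      fix Y assume "Y \<in># h m"
      then obtain F where F: "F \<in># m" "Y = ?f F" by (auto simp: h_def)
      show "X \<subseteq> Y \<or> Y \<subseteq> X" using chain[OF F(1) G(1)] fe F G by auto
      assume YX: "Y \<subset> X"
      then have "F \<subset> G" using chain[OF F(1) G(1)] fe[OF G(1) F(1)] F G by blast
      then have "count m G + c F < c G" using m F G by (simp add: fy_mono_def)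
      then show "count (h m) X + c' Y < c' X"
        using cnt[OF G(1)] \<beta>_props(2)[OF m G(1)] \<beta>_props(2)[OF m F(1)] F(2) G(2) by simp
    qed
    moreover have "\<forall>F\<in>#h m. Z \<subseteq> F" using Z by (auto simp: h_def)
    ultimately show ?thesis by blast
  qed
  have "finite {m \<in> fy_mono T c' j. \<forall>F\<in>#m. Z \<subseteq> F}" using finite_fy_mono[OF finite_T] by simp
  then show ?thesis using h_inj h_fy by (intro card_inj_on_le[of h]) auto
qed

lemma rk_E_le_card: "rk E \<le> card E"
  by (metis ex_basis card_mono finite_E)

lemma hilb_le_unif:
  defines "n \<equiv> card E" and "k \<equiv> rk E"
  shows "red_chow_hilb E indep j \<le> red_chow_hilb (unif_ground n) (unif_indep k n) j"
    and "aug_chow_hilb E indep j \<le> aug_chow_hilb (unif_ground n) (unif_indep k n) j"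
proof -
  have kn: "k \<le> n" unfolding k_def n_def by (rule rk_E_le_card)
  have k0: "0 < k" unfolding k_def using nonempty rk_pos by blast
  obtain g where g: "bij_betw g E {..<n}"
    using ex_bij_betw_finite_nat[OF finite_E] unfolding n_def atLeast0LessThan by blast
  have gE: "g ` E = {..<n}" and ginj: "inj_on g E" using g by (auto simp: bij_betw_def)
  have emb: "g ` A \<subseteq> g ` B \<longleftrightarrow> A \<subseteq> B" if "A \<subseteq> E" "B \<subseteq> E" for A B
    using inj_on_image_mem_iff[OF ginj _ that(2)] that(1) by blast
  have cardg: "card (g ` B) = card B" if "B \<subseteq> E" for B
    using that ginj by (intro card_image inj_on_subset[OF ginj])
  have lt: "rk F < k" if "F \<in> Fl" "F \<noteq> E" for F
    unfolding k_def using rk_strict[OF that(1), of E] that flat_sub by blast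
  have fin: "finite (unif_flats A i)" if "finite A" for A :: "'c set" and i
    using that by (intro finite_subset[OF _ finite_Pow_iff[THEN iffD2, OF that]]) (auto simp: unif_flats_def)
  have "card (fy_mono (Fl - {{}}) rk j)
      \<le> card {m \<in> fy_mono (unif_flats {..<n} k) (unif_rank {..<n} k) j. \<forall>F\<in>#m. {} \<subseteq> F}"
  proof (rule card_fy_mono_le[where emb = "\<lambda>B. g ` B", OF _ _ emb])
    fix F B assume F: "F \<in> Fl - {{}}" "F \<noteq> E" and B: "B \<subseteq> E" "card B = rk F"
    have c: "card (g ` B) = rk F" "rk F < k" using cardg B lt F by auto
    obtain i where "i \<in> F" using F by blast
    then have "0 < rk F" using rk_pos flat_sub F by blast
    then have "g ` B \<noteq> {}" using c by auto
    moreover have "g ` B \<noteq> {..<n}" using c kn by auto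
    moreover have "g ` B \<subseteq> {..<n}" using B gE by blast
    ultimately show "g ` B \<in> unif_flats {..<n} k \<and> g ` B \<noteq> g ` E \<and> unif_rank {..<n} k (g ` B) = rk F"
      using c gE by (auto simp: unif_flats_def unif_rank_def)
  qed (use fin gE in \<open>auto simp: unif_flats_def unif_rank_def k_def\<close>)
  then show "red_chow_hilb E indep j \<le> red_chow_hilb (unif_ground n) (unif_indep k n) j"
    using red_chow_hilb_le[of j] unif_red_chow_ge[OF k0 kn, of j] by simp
  have "card (fy_mono Fl (\<lambda>F. Suc (rk F)) j)
      \<le> card {m \<in> fy_mono (unif_flats (cone {..<n}) (Suc k)) (unif_rank (cone {..<n}) (Suc k)) j. \<forall>F\<in>#m. {None} \<subseteq> F}"
  proof (rule card_fy_mono_le[where emb = "\<lambda>B. cone (g ` B)"])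
    show "cone (g ` A) \<subseteq> cone (g ` B) \<longleftrightarrow> A \<subseteq> B" if "A \<subseteq> E" "B \<subseteq> E" for A B
      using emb[OF that] by simp
    fix F B assume F: "F \<in> Fl" "F \<noteq> E" and B: "B \<subseteq> E" "card B = rk F"
    have c: "card (g ` B) = rk F" "rk F < k" using cardg B lt F by auto
    have "finite (g ` B)" using B finite_E finite_subset by blast
    then have c2: "card (cone (g ` B)) = Suc (rk F)" using c card_cone by metis
    have "g ` B \<noteq> {..<n}" using c kn by auto
    moreover have "g ` B \<subseteq> {..<n}" using B gE by blast
    ultimately show "cone (g ` B) \<in> unif_flats (cone {..<n}) (Suc k) \<and> cone (g ` B) \<noteq> cone (g ` E) \<and>
        unif_rank (cone {..<n}) (Suc k) (cone (g ` B)) = Suc (rk F)"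
      using c c2 gE by (auto simp: unif_flats_def unif_rank_def)
  next
    show "finite (unif_flats (cone {..<n}) (Suc k))" by (rule fin) (simp add: cone_def)
  qed (use gE in \<open>auto simp: unif_flats_def unif_rank_def k_def cone_def\<close>)
  then show "aug_chow_hilb E indep j \<le> aug_chow_hilb (unif_ground n) (unif_indep k n) j"
    using aug_chow_hilb_le[of j] unif_aug_chow_ge[OF k0 kn, of j] by simp
qed

end

text \<open>The empty ground set is treated apart, as the general argument picks a point of
  \<open>E\<close>. Both rings are then the base field.\<close>

lemma hilb_coeff_empty: "hilb_coeff ({} :: 'a set) {} j = of_bool (j = 0)"
proof -
  have "ideal_part ({} :: 'a set) {} j \<subseteq> Q.span {}"
    by (auto simp: ideal_part_def gen_ideal_def)
  then have "Q.dim (ideal_part ({} :: 'a set) {} j) \<le> card ({} :: 'a qpoly set)"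
    by (rule Q.dim_le_card) simp
  moreover have "monomials {} j = (if j = 0 then {{#}} else {} :: 'a multiset set)"
    by (auto simp: monomials_def)
  ultimately show ?thesis by (simp add: hilb_coeff_eq)
qed

lemma hilb_empty_ground:
  "red_chow_hilb {} indep j = of_bool (j = 0)" "aug_chow_hilb {} indep j = of_bool (j = 0)"
proof -
  have "flats {} indep = {{}}" by (auto simp: flats_def)
  then have "chow_vars {} indep = {}" "chow_gens {} indep = {}" "aug_vars {} indep = {}" "aug_gens {} indep = {}"
    by (auto simp: chow_vars_def chow_gens_def aug_vars_def aug_gens_def)
  then show "red_chow_hilb {} indep j = of_bool (j = 0)" "aug_chow_hilb {} indep j = of_bool (j = 0)"
    by (simp_all add: red_chow_hilb_def aug_chow_hilb_def hilb_coeff_empty)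
qed

theorem theorem1p13:
  fixes E :: "'a set" and indep :: "'a set \<Rightarrow> bool" and k n :: nat
  assumes "matroid E indep"
    and "loopless E indep"
    and "mrank indep E = k"
    and "card E = n"
  shows "(\<forall>j. red_chow_hilb E indep j
              \<le> red_chow_hilb (unif_ground n) (unif_indep k n) j)
       \<and> (\<forall>j. aug_chow_hilb E indep j
              \<le> aug_chow_hilb (unif_ground n) (unif_indep k n) j)"
proof (cases "E = {}")
  case True
  then have "unif_ground n = {}" using assms(4) by (simp add: unif_ground_def)
  then show ?thesis using True by (simp add: hilb_empty_ground)
next
  case False
  then interpret loopless_matroid E indep using assms(1,2) by unfold_locales
  show ?thesis using hilb_le_unif assms(3,4) by simp
qed

end
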